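(* Let $k$ be a positive integer and $(\mathscr F_n)_{n\ge1}$ an interval filtration on $[0,1]$. Let $(f_n)_{n\ge1}$ be a sequence of functions with $f_n\in\mathscr S_k(\mathscr F_n)$ for all $n$ and set $X_n:=\sum_{\ell\le n}f_\ell^2$. Then there exists a sequence of non-negative functions $g_n\in\mathscr S_k(\mathscr F_n)$ so that for each $n$: (1) $g_n\le g_{n+1}$; (2) $X_n^{1/2}\le g_n$; (3) $\mathbb E\, g_n\le C\,\mathbb E\, X_n^{1/2}$, where the constant $C$ depends only on $k$ and on $\sup_{m\le n}\gamma_k(\mathscr F_m)$.
   Context: $\mathbb E f=\int_0^1 f(t)\,dt$, and $|\cdot|$ is Lebesgue measure on $[0,1]$. An interval $\sigma$-algebra on $[0,1]$ is a $\sigma$-algebra $\mathscr F$ generated by a finite partition of $[0,1]$ into intervals of positive length (the atoms of $\mathscr F$). An interval filtration is an increasing sequence of interval $\sigma$-algebras. For a positive integer $k$, $\mathscr S_k(\mathscr F)=\{f\in C^{k-2}[0,1]: f \text{ is a polynomial of order } k \text{ (degree at most } k-1) \text{ on each atom of } \mathscr F\}$ (for $k=1$: functions constant on each atom). The B-spline basis $(N_i)$ of $\mathscr S_k(\mathscr F)$ is the standard one (normalized to be a non-negative partition of unity, interior breakpoints simple knots, endpoints $0,1$ knots of multiplicity $k$); each support $E_i=\operatorname{supp} N_i$ is an interval consisting of at most $k$ neighboring atoms, ordered so that $\inf E_i\le\inf E_{i+1}$ and $\sup E_i\le \sup E_{i+1}$. The $k$-regularity parameter is $$\gamma_k(\mathscr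 F)=\max_i \max\big(|E_i|/|E_{i+1}|,\ |E_{i+1}|/|E_i|\big),$$ the first maximum over all $i$ for which $E_i,E_{i+1}$ are both defined (set to $1$ if there is no such $i$). *)

theory Defs
  imports "HOL-Analysis.Analysis" "HOL-Computational_Algebra.Polynomial"
begin

text \<open>The intervals of a partition may be open, closed or half-open.\<close>

definition interval_partition :: "real set set \<Rightarrow> bool" where
  "interval_partition P \<longleftrightarrow> finite P \<and> partition_on {0..1} P \<and>
     (\<forall>I\<in>P. is_interval I \<and> measure lborel I > 0)"

definition interval_sigma_algebra :: "real set set \<Rightarrow> bool" where
  "interval_sigma_algebra \<F> \<longleftrightarrow>
     (\<exists>P. interval_partition P \<and> \<F> = sigma_sets {0..1} P)"

text \<open>For an interval sigma-algebra these are exactly the intervals of the generating partition.\<close>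

definition atoms :: "real set set \<Rightarrow> real set set" where
  "atoms \<F> = {A \<in> \<F>. A \<noteq> {} \<and> (\<forall>B\<in>\<F>. B \<subseteq> A \<longrightarrow> B = {} \<or> B = A)}"

text \<open>Sequences are indexed by \<open>n \<ge> 1\<close>; the value at 0 is irrelevant.\<close>

definition interval_filtration :: "(nat \<Rightarrow> real set set) \<Rightarrow> bool" where
  "interval_filtration \<F> \<longleftrightarrow>
     (\<forall>n\<ge>1. interval_sigma_algebra (\<F> n)) \<and> (\<forall>n\<ge>1. \<F> n \<subseteq> \<F> (Suc n))"

text \<open>\<open>D j\<close> is the \<open>j\<close>-th derivative of \<open>f\<close> on \<open>S\<close>; on \<open>{0..1}\<close> it is one-sided at the endpoints.\<close>

definition C_on :: "nat \<Rightarrow> real set \<Rightarrow> (real \<Rightarrow> real) \<Rightarrow> bool" where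
  "C_on m S f \<longleftrightarrow>
     (\<exists>D. (\<forall>x\<in>S. D 0 x = f x) \<and>
          (\<forall>j<m. \<forall>x\<in>S. (D j has_real_derivative D (Suc j) x) (at x within S)) \<and>
          (\<forall>j\<le>m. continuous_on S (D j)))"

text \<open>Functions on \<open>[0,1]\<close> are represented by functions on the real line whose values outside
  \<open>[0,1]\<close> are ignored. For \<open>k = 1\<close> there is no smoothness condition.\<close>

definition spline_space :: "nat \<Rightarrow> real set set \<Rightarrow> (real \<Rightarrow> real) set" where
  "spline_space k \<F> =
     {f. (k \<ge> 2 \<longrightarrow> C_on (k - 2) {0..1} f) \<and>
         (\<forall>A\<in>atoms \<F>. \<exists>p::real poly. degree p < k \<and> (\<forall>x\<in>A. f x = poly p x))}"

text \<open>In increasing order, \<open>0 = s\<^sub>0 < \<dots> < s\<^sub>m = 1\<close> with \<open>m = card (atoms \<F>)\<close>.\<close>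

definition breakpoints :: "real set set \<Rightarrow> real list" where
  "breakpoints \<F> = sorted_list_of_set (Inf ` atoms \<F> \<union> Sup ` atoms \<F>)"

text \<open>The knots \<open>t\<^sub>0 \<le> t\<^sub>1 \<le> \<dots>\<close> are \<open>k\<close> copies of 0 (truncated subtraction), then the interior
  breakpoints once each, then \<open>t\<^sub>j = 1\<close> for \<open>j \<ge> m + k - 1\<close>. Only \<open>j \<le> m + 2 * k - 2\<close>
  is used for the B-spline basis, i.e. \<open>k\<close> copies of 1.\<close>

definition knot :: "nat \<Rightarrow> real set set \<Rightarrow> nat \<Rightarrow> real" where
  "knot k \<F> j = breakpoints \<F> ! min (j - (k - 1)) (card (atoms \<F>))"

text \<open>Cox--de Boor recursion on the degree \<open>d\<close> (order \<open>d + 1\<close>) over a knot sequence \<open>t\<close>. The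
  B-splines of order 1 are the indicators of the atoms themselves (and 0 over repeated knots),
  rather than of half-open knot intervals, so that values at breakpoints follow the atoms.
  The usual convention that terms with vanishing denominator are dropped is \<open>x / 0 = 0\<close>.\<close>

primrec cox_de_boor ::
    "real set set \<Rightarrow> (nat \<Rightarrow> real) \<Rightarrow> nat \<Rightarrow> nat \<Rightarrow> real \<Rightarrow> real" where
  "cox_de_boor \<F> t 0 i x =
     indicator (\<Union>{A \<in> atoms \<F>. Inf A = t i \<and> Sup A = t (i + 1)}) x"
| "cox_de_boor \<F> t (Suc d) i x =
     (x - t i) / (t (i + d + 1) - t i) * cox_de_boor \<F> t d i x +
     (t (i + d + 2) - x) / (t (i + d + 2) - t (i + 1)) * cox_de_boor \<F> t d (i + 1) x"

definition bspline :: "nat \<Rightarrow> real set set \<Rightarrow> nat \<Rightarrow> real \<Rightarrow> real" where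
  "bspline k \<F> i = cox_de_boor \<F> (knot k \<F>) (k - 1) i"

text \<open>The dimension of the spline space; the basis consists of \<open>bspline k \<F> i\<close> for
  \<open>i < num_bsplines k \<F>\<close>.\<close>

definition num_bsplines :: "nat \<Rightarrow> real set set \<Rightarrow> nat" where
  "num_bsplines k \<F> = card (atoms \<F>) + k - 1"

definition bspline_support :: "nat \<Rightarrow> real set set \<Rightarrow> nat \<Rightarrow> real set" where
  "bspline_support k \<F> i = closure {x. bspline k \<F> i x \<noteq> 0}"

definition regularity :: "nat \<Rightarrow> real set set \<Rightarrow> real" where
  "regularity k \<F> =
     (let E = (\<lambda>i. measure lborel (bspline_support k \<F> i));
          J = {i. i + 1 < num_bsplines k \<F>}
      in if J = {} then 1
         else Max ((\<lambda>i. max (E i / E (i + 1)) (E (i + 1) / E i)) ` J))"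

definition expect :: "(real \<Rightarrow> real) \<Rightarrow> real" where
  "expect f = (LBINT t:{0..1}. f t)"

end

theory Submission imports Defs begin

text \<open>The majorants are built by a stopping rule. Write \<open>u n\<close> for the square root of \<open>X n\<close>. At time
  \<open>n\<close>, for every atom of the current partition that contains a point where the old majorant is
  smaller than \<open>u n\<close>, a multiple of a bump in the current spline space is added; the multiple is
  twice the supremum of \<open>u n\<close> over the atom, and the bump is 1 on all atoms at most \<open>2 * (k - 1)\<close>
  steps away. Since the spline spaces increase, the majorants are splines; they are increasing
  because bumps are non-negative, and they dominate \<open>u n\<close> by construction.

  Two facts control the expectation.

  First, if \<open>v\<close> is the supremum of \<open>u n\<close> over an atom, then \<open>u n\<close> is at least a multiple of \<open>v\<close> on a
  whole marker interval which is at most \<open>k - 1\<close> atoms away and whose length is comparable to the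
  support of the bump (\<open>square_function_large_nearby\<close>). Indeed, the values of a spline on an atom
  are convex combinations of B-spline coefficients, each coefficient is the polar form of any
  polynomial piece in the support of the B-spline, and it is
  bounded by the values of the piece on the largest atom in the support.
  A polynomial is large on a substantial part of such an atom (\<open>large_on_subinterval\<close>), and by
  regularity its length is comparable to all supports nearby. Vector-valued splines are treated in
  the same way, which gives the statement for the square function.

  Second, if \<open>x\<close> belongs to the marker intervals of two chosen atoms of different times, then the
  later supremum is at least twice the earlier one (\<open>values_double\<close>), because the earlier bump is 1
  on the later atom and raised the majorant there. The suprema whose marker intervals contain
  \<open>x\<close> therefore form a geometric sum, dominated by its largest term and hence by a multiple of
  \<open>u n x\<close>. Integrating over \<open>x\<close> and replacing each marker interval by the support of its bump
  gives the bound (\<open>expect_g_le\<close>).\<close>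

section \<open>Polynomials of bounded degree\<close>

lemma poly_as_sum_upto:
  fixes p :: "real poly"
  assumes "degree p \<le> d"
  shows "poly p x = (\<Sum>i\<le>d. coeff p i * x ^ i)"
  unfolding poly_altdef
  by (rule sum.mono_neutral_left) (use assms in \<open>auto simp: coeff_eq_0\<close>)

text \<open>Norms on a finite-dimensional space are equivalent. Here this follows by induction on the
  degree, because a dilation by 2 can be used to remove the leading term, and for nodes in geometric
  progression each dilation costs only one more node.\<close>

lemma coeff_bound_by_node_values:
  "\<exists>C>0. \<forall>p::real poly. degree p \<le> d \<longrightarrow>
     (\<forall>i. \<bar>coeff p i\<bar> \<le> C * (\<Sum>m\<le>d. \<bar>poly p ((1/2)^m)\<bar>))"
proof (induction d)
  case 0
  show ?case
    by (rule exI[of _ 1]) (auto simp: coeff_pCons elim!: degree_eq_zeroE split: nat.splits)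
next
  case (Suc d)
  then obtain C where "C > 0"
    and C: "\<And>(p::real poly) i. degree p \<le> d \<Longrightarrow> \<bar>coeff p i\<bar> \<le> C * (\<Sum>m\<le>d. \<bar>poly p ((1/2)^m)\<bar>)"
    by auto
  define K where "K = C * (1 + 2 ^ Suc d)"
  have "K > 0"
    using \<open>C > 0\<close> by (simp add: K_def add_pos_pos)
  show ?case
  proof (intro exI[of _ "1 + real (d + 2) * K"] conjI allI impI)
    show "0 < 1 + real (d + 2) * K"
      using \<open>K > 0\<close> by (simp add: add_pos_pos)
  next
    fix p :: "real poly" and i
    assume deg: "degree p \<le> Suc d"
    define S where "S = (\<Sum>m\<le>Suc d. \<bar>poly p ((1/2)^m)\<bar>)"
    \<comment> \<open>The leading term cancels; every other coefficient is multiplied by a number of modulus at least 1.\<close>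
    define q where "q = p - smult (2 ^ Suc d) (pcompose p [:0, 1/2:])"
    have q_coeff: "coeff q i = coeff p i * (1 - 2 ^ Suc d / 2 ^ i)" for i
      by (simp add: q_def coeff_pcompose_linear power_one_over field_simps)
    have "degree q \<le> d"
    proof (rule degree_le, intro allI impI)
      fix i assume "i > d"
      then show "coeff q i = 0"
        using deg by (cases "i = Suc d") (auto simp: q_coeff coeff_eq_0)
    qed
    have "(\<Sum>m\<le>d. \<bar>poly q ((1/2)^m)\<bar>)
        \<le> (\<Sum>m\<le>d. \<bar>poly p ((1/2)^m)\<bar> + 2 ^ Suc d * \<bar>poly p ((1/2)^Suc m)\<bar>)"
    proof (rule sum_mono)
      fix m
      have "poly q ((1/2)^m) = poly p ((1/2)^m) - 2 ^ Suc d * poly p ((1/2)^Suc m)"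
        by (simp add: q_def poly_pcompose)
      then show "\<bar>poly q ((1/2)^m)\<bar> \<le> \<bar>poly p ((1/2)^m)\<bar> + 2 ^ Suc d * \<bar>poly p ((1/2)^Suc m)\<bar>"
        using abs_triangle_ineq4[of "poly p ((1/2)^m)" "2 ^ Suc d * poly p ((1/2)^Suc m)"]
        by (simp add: abs_mult)
    qed
    also have "\<dots> = (\<Sum>m\<le>d. \<bar>poly p ((1/2)^m)\<bar>) + 2 ^ Suc d * (\<Sum>m\<le>d. \<bar>poly p ((1/2)^Suc m)\<bar>)"
      by (simp only: sum.distrib sum_distrib_left)
    also have "\<dots> \<le> S + 2 ^ Suc d * S"
    proof (intro add_mono mult_left_mono)
      show "(\<Sum>m\<le>d. \<bar>poly p ((1/2)^m)\<bar>) \<le> S"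
        by (simp add: S_def)
      show "(\<Sum>m\<le>d. \<bar>poly p ((1/2)^Suc m)\<bar>) \<le> S"
        unfolding S_def sum.atMost_Suc_shift[where n = d] by simp
    qed simp
    finally have sum_q: "(\<Sum>m\<le>d. \<bar>poly q ((1/2)^m)\<bar>) \<le> (1 + 2 ^ Suc d) * S"
      by (simp add: algebra_simps)
    have low: "\<bar>coeff p i\<bar> \<le> K * S" if "i \<le> d" for i
    proof -
      have "(2::real) ^ 1 \<le> 2 ^ (Suc d - i)"
        using that by (intro power_increasing) auto
      then have "(1::real) \<le> \<bar>1 - 2 ^ Suc d / 2 ^ i\<bar>"
        using that by (simp add: power_diff)
      then have "\<bar>coeff p i\<bar> * 1 \<le> \<bar>coeff p i\<bar> * \<bar>1 - 2 ^ Suc d / 2 ^ i\<bar>"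
        by (rule mult_left_mono) simp
      also have "\<dots> = \<bar>coeff q i\<bar>"
        by (simp add: q_coeff abs_mult)
      also have "\<dots> \<le> C * (\<Sum>m\<le>d. \<bar>poly q ((1/2)^m)\<bar>)"
        by (rule C) fact
      also have "\<dots> \<le> C * ((1 + 2 ^ Suc d) * S)"
        using sum_q \<open>C > 0\<close> by (intro mult_left_mono) auto
      finally show ?thesis
        by (simp add: K_def)
    qed
    have "\<bar>poly p 1\<bar> \<le> S"
      unfolding S_def sum.atMost_Suc_shift by (simp add: sum_nonneg)
    have "S \<ge> 0"
      by (simp add: S_def sum_nonneg)
    have "poly p 1 = (\<Sum>i\<le>d. coeff p i) + coeff p (Suc d)"
      using poly_as_sum_upto[OF deg, of 1] by simp
    then have "\<bar>coeff p (Suc d)\<bar> \<le> \<bar>poly p 1\<bar> + (\<Sum>i\<le>d. \<bar>coeff p i\<bar>)"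
      using sum_abs[of "coeff p" "{..d}"] by linarith
    also have "\<dots> \<le> S + (\<Sum>i\<le>d. K * S)"
      using low \<open>\<bar>poly p 1\<bar> \<le> S\<close> by (intro add_mono sum_mono) auto
    finally have top: "\<bar>coeff p (Suc d)\<bar> \<le> (1 + real (d + 1) * K) * S"
      by (simp add: algebra_simps)
    have nn: "0 \<le> K * S"
      using \<open>K > 0\<close> \<open>S \<ge> 0\<close> by simp
    have "0 \<le> real d * (K * S)"
      using nn by simp
    consider "i \<le> d" | "i = Suc d" | "i > Suc d"
      by linarith
    then have "\<bar>coeff p i\<bar> \<le> (1 + real (d + 2) * K) * S"
    proof cases
      case 1
      show ?thesis
        using low[OF 1] nn \<open>S \<ge> 0\<close> \<open>0 \<le> real d * (K * S)\<close> by (simp add: algebra_simps)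
    next
      case 2
      show ?thesis
        using top nn 2 by (simp add: algebra_simps)
    next
      case 3
      then have "coeff p i = 0"
        using deg by (simp add: coeff_eq_0)
      then show ?thesis
        using nn \<open>S \<ge> 0\<close> \<open>0 \<le> real d * (K * S)\<close> by (simp add: algebra_simps)
    qed
    then show "\<bar>coeff p i\<bar> \<le> (1 + real (d + 2) * K) * (\<Sum>m\<le>Suc d. \<bar>poly p ((1/2)^m)\<bar>)"
      by (simp only: S_def)
  qed
qed

lemma abs_power_diff_le:
  fixes x y :: real
  assumes "\<bar>x\<bar> \<le> 1" "\<bar>y\<bar> \<le> 1"
  shows "\<bar>x ^ i - y ^ i\<bar> \<le> real i * \<bar>x - y\<bar>"
proof (induction i)
  case (Suc i)
  have "x ^ Suc i - y ^ Suc i = x * (x ^ i - y ^ i) + (x - y) * y ^ i"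
    by (simp add: algebra_simps)
  then have "\<bar>x ^ Suc i - y ^ Suc i\<bar> \<le> \<bar>x\<bar> * \<bar>x ^ i - y ^ i\<bar> + \<bar>x - y\<bar> * \<bar>y ^ i\<bar>"
    by (metis abs_mult abs_triangle_ineq)
  also have "\<dots> \<le> 1 * \<bar>x ^ i - y ^ i\<bar> + \<bar>x - y\<bar> * 1"
    using assms by (intro add_mono mult_right_mono mult_left_mono) (auto simp: power_abs power_le_one)
  finally show ?case
    using Suc by (simp add: algebra_simps)
qed simp

text \<open>On the unit interval the Lipschitz constant of a polynomial of bounded degree is at most a
  multiple of its maximum. A non-negative polynomial therefore stays above half of its maximum on
  an interval around the maximal point, and the length of this interval relative to the whole does
  not depend on the polynomial.\<close>

lemma large_on_subinterval:
  "\<exists>c>0. (\<forall>(Y::real poly) a h z. degree Y \<le> D \<longrightarrow> h > 0 \<longrightarrow> z \<in> {a..a+h} \<longrightarrow>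
     (\<forall>y\<in>{a..a+h}. 0 \<le> poly Y y) \<longrightarrow>
     (\<exists>\<alpha> \<beta>. a \<le> \<alpha> \<and> \<alpha> < \<beta> \<and> \<beta> \<le> a + h \<and> c * h \<le> \<beta> - \<alpha> \<and>
        (\<forall>y\<in>{\<alpha><..<\<beta>}. poly Y z / 2 \<le> poly Y y)))"
proof -
  obtain C where "C > 0"
    and C: "\<And>(p::real poly) i. degree p \<le> D \<Longrightarrow> \<bar>coeff p i\<bar> \<le> C * (\<Sum>m\<le>D. \<bar>poly p ((1/2)^m)\<bar>)"
    using coeff_bound_by_node_values[of D] by auto
  define L where "L = 1 + (\<Sum>i\<le>D. C * real (Suc D) * real i)"
  have "(\<Sum>i\<le>D. C * real (Suc D) * real i) \<ge> 0"
    using \<open>C > 0\<close> by (intro sum_nonneg) auto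
  then have "L \<ge> 1"
    by (simp add: L_def)
  define c where "c = 1 / (2 * L)"
  have "c > 0" "c \<le> 1/2"
    using \<open>L \<ge> 1\<close> by (auto simp: c_def field_simps)
  have "\<exists>\<alpha> \<beta>. a \<le> \<alpha> \<and> \<alpha> < \<beta> \<and> \<beta> \<le> a + h \<and> c * h \<le> \<beta> - \<alpha> \<and>
        (\<forall>y\<in>{\<alpha><..<\<beta>}. poly Y z / 2 \<le> poly Y y)"
    if deg: "degree Y \<le> D" and h: "h > 0" and z: "z \<in> {a..a+h}"
      and nonneg: "\<forall>y\<in>{a..a+h}. 0 \<le> poly Y y" for Y a h z
  proof -
    have "\<exists>w\<in>{a..a+h}. \<forall>y\<in>{a..a+h}. poly Y y \<le> poly Y w"
      using h by (intro continuous_attains_sup continuous_intros) auto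
    then obtain w where w: "w \<in> {a..a+h}" and w_max: "\<And>y. y \<in> {a..a+h} \<Longrightarrow> poly Y y \<le> poly Y w"
      by blast
    define Z where "Z = pcompose Y [:a, h:]"
    have Z: "poly Z y = poly Y (a + h * y)" for y
      by (simp add: Z_def poly_pcompose mult.commute)
    have "degree Z \<le> D"
      using deg h by (simp add: Z_def degree_pcompose)
    have unit: "a + h * y \<in> {a..a+h}" if "0 \<le> y" "y \<le> 1" for y
      using that h by (simp add: mult_left_le)
    have "poly Y w \<ge> 0"
      using nonneg w by blast
    have Z_coeff: "\<bar>coeff Z i\<bar> \<le> C * real (Suc D) * poly Y w" for i
    proof -
      have "(\<Sum>m\<le>D. \<bar>poly Z ((1/2)^m)\<bar>) \<le> (\<Sum>m\<le>D. poly Y w)"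
      proof (rule sum_mono)
        fix m
        have "a + h * (1/2)^m \<in> {a..a+h}"
          by (rule unit) (auto simp: power_le_one)
        then show "\<bar>poly Z ((1/2)^m)\<bar> \<le> poly Y w"
          using nonneg w_max unfolding Z by fastforce
      qed
      then have "C * (\<Sum>m\<le>D. \<bar>poly Z ((1/2)^m)\<bar>) \<le> C * (real (Suc D) * poly Y w)"
        using \<open>C > 0\<close> by (intro mult_left_mono) auto
      then show ?thesis
        using C[OF \<open>degree Z \<le> D\<close>, of i] by (simp add: algebra_simps)
    qed
    have lip: "\<bar>poly Z x - poly Z y\<bar> \<le> L * poly Y w * \<bar>x - y\<bar>"
      if "0 \<le> x" "x \<le> 1" "0 \<le> y" "y \<le> 1" for x y
    proof -
      have "\<bar>poly Z x - poly Z y\<bar> = \<bar>\<Sum>i\<le>D. coeff Z i * (x ^ i - y ^ i)\<bar>"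
        by (simp add: poly_as_sum_upto[OF \<open>degree Z \<le> D\<close>] sum_subtractf right_diff_distrib)
      also have "\<dots> \<le> (\<Sum>i\<le>D. \<bar>coeff Z i\<bar> * \<bar>x ^ i - y ^ i\<bar>)"
        by (rule order_trans[OF sum_abs]) (simp add: abs_mult)
      also have "\<dots> \<le> (\<Sum>i\<le>D. (C * real (Suc D) * poly Y w) * (real i * \<bar>x - y\<bar>))"
        using that Z_coeff abs_power_diff_le[of x y] \<open>C > 0\<close> \<open>poly Y w \<ge> 0\<close>
        by (intro sum_mono mult_mono) auto
      also have "\<dots> = (\<Sum>i\<le>D. C * real (Suc D) * real i) * (poly Y w * \<bar>x - y\<bar>)"
        unfolding sum_distrib_right by (simp add: mult_ac)
      also have "\<dots> \<le> L * (poly Y w * \<bar>x - y\<bar>)"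
        using \<open>poly Y w \<ge> 0\<close> by (intro mult_right_mono) (auto simp: L_def)
      finally show ?thesis
        by (simp add: mult.assoc)
    qed
    have near: "poly Y z / 2 \<le> poly Y y" if "y \<in> {a..a+h}" "\<bar>y - w\<bar> \<le> c * h" for y
    proof -
      define y' where "y' = (y - a) / h"
      define w' where "w' = (w - a) / h"
      have y': "y = a + h * y'" "0 \<le> y'" "y' \<le> 1"
        using h that by (auto simp: y'_def field_simps)
      have w': "w = a + h * w'" "0 \<le> w'" "w' \<le> 1"
        using h w by (auto simp: w'_def field_simps)
      have "y - w = h * (y' - w')"
        by (simp add: y'(1) w'(1) algebra_simps)
      then have "h * \<bar>y' - w'\<bar> \<le> h * c"
        using that h by (simp add: abs_mult mult.commute)
      then have "\<bar>y' - w'\<bar> \<le> c"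
        using h by simp
      have "\<bar>poly Z y' - poly Z w'\<bar> \<le> L * poly Y w * \<bar>y' - w'\<bar>"
        by (rule lip) (use y' w' in auto)
      also have "\<dots> \<le> L * poly Y w * c"
        using \<open>\<bar>y' - w'\<bar> \<le> c\<close> \<open>L \<ge> 1\<close> \<open>poly Y w \<ge> 0\<close> by (intro mult_left_mono) auto
      also have "\<dots> = poly Y w / 2"
        using \<open>L \<ge> 1\<close> by (simp add: c_def)
      finally have "poly Y w / 2 \<le> poly Y y"
        unfolding Z y'(1)[symmetric] w'(1)[symmetric] by linarith
      moreover have "poly Y z \<le> poly Y w"
        using w_max z by blast
      ultimately show ?thesis
        by linarith
    qed
    define e where "e = c * h"
    have ch: "0 < e" "e \<le> h / 2" "c * h = e"
      using \<open>c > 0\<close> \<open>c \<le> 1/2\<close> h mult_right_mono[of c "1/2" h] by (auto simp: e_def)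
    note near = near[unfolded ch(3)]
    show ?thesis
    proof (cases "w \<le> a + h / 2")
      case True
      show ?thesis
        by (rule exI[of _ w], rule exI[of _ "w + e"]) (use True ch w near in auto)
    next
      case False
      show ?thesis
        by (rule exI[of _ "w - e"], rule exI[of _ w]) (use False ch w near in auto)
    qed
  qed
  then show ?thesis
    using \<open>c > 0\<close> \<open>c \<le> 1/2\<close> by (intro exI[where x = c, OF conjI] allI impI) auto
qed

subsection \<open>Polar forms\<close>

text \<open>The polar form (blossom) of a polynomial of degree at most \<open>d\<close>: the symmetric function of
  \<open>u 0, \<dots>, u (d - 1)\<close> that is affine in each variable and agrees with \<open>p\<close> on the diagonal. Written
  through the coefficients it is visibly linear in \<open>p\<close>.\<close>

definition polar :: "nat \<Rightarrow> (nat \<Rightarrow> real) \<Rightarrow> real poly \<Rightarrow> real" where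
  "polar d u p =
     (\<Sum>i\<le>d. coeff p (d - i) * coeff (\<Prod>r<d. [:u r, -1:]) i * (-1) ^ i / real (d choose i))"

lemma polar_add: "polar d u (p + q) = polar d u p + polar d u q"
  by (simp add: polar_def sum.distrib[symmetric] add_divide_distrib[symmetric] algebra_simps)

lemma polar_smult: "polar d u (smult c p) = c * polar d u p"
  by (simp add: polar_def sum_distrib_left mult_ac)

lemma polar_power:
  "polar d u ([:-\<tau>, 1:] ^ d) = (\<Prod>r<d. u r - \<tau>)"
proof -
  have deg: "degree (\<Prod>r<d. [:u r, -1:]) \<le> d"
    by (rule order_trans[OF degree_prod_sum_le]) auto
  have "polar d u ([:-\<tau>, 1:] ^ d) = (\<Sum>i\<le>d. coeff (\<Prod>r<d. [:u r, -1:]) i * \<tau> ^ i)"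
    unfolding polar_def
  proof (rule sum.cong[OF refl])
    fix i assume "i \<in> {..d}"
    then have i: "i \<le> d" by simp
    have c: "coeff ([:-\<tau>, 1:] ^ d) (d - i) = real (d choose i) * (-\<tau>) ^ i"
      using i by (simp add: coeff_linear_poly_power binomial_symmetric[of i d])
    show "coeff ([:-\<tau>, 1:] ^ d) (d - i) * coeff (\<Prod>r<d. [:u r, -1:]) i * (-1) ^ i / real (d choose i)
       = coeff (\<Prod>r<d. [:u r, -1:]) i * \<tau> ^ i"
      unfolding c using i by (simp add: power_mult_distrib[symmetric] mult_ac)
  qed
  also have "\<dots> = poly (\<Prod>r<d. [:u r, -1:]) \<tau>"
    by (rule poly_as_sum_upto[OF deg, symmetric])
  finally show ?thesis
    by (simp add: poly_prod)
qed

text \<open>The powers \<open>(x - \<tau>) ^ d\<close> span the polynomials of degree at most \<open>d\<close>: expanding in \<open>\<tau>\<close> and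
  comparing coefficients recovers every monomial. Identities for polar forms thus need to be
  checked only on powers, where the polar form is a product.\<close>

lemma linear_functionals_eq_on_powers:
  fixes L M :: "real poly \<Rightarrow> real"
  assumes add1: "\<And>p q. L (p + q) = L p + L q" and sm1: "\<And>c p. L (smult c p) = c * L p"
    and add2: "\<And>p q. M (p + q) = M p + M q" and sm2: "\<And>c p. M (smult c p) = c * M p"
    and eq: "\<And>\<tau>. L ([:-\<tau>, 1:] ^ d) = M ([:-\<tau>, 1:] ^ d)"
    and deg: "degree p \<le> d"
  shows "L p = M p"
proof -
  have expand: "L q = (\<Sum>i\<le>d. coeff q i * L (monom 1 i))"
    if "degree q \<le> d" and add: "\<And>p q. L (p + q) = L p + L q" and sm: "\<And>c p. L (smult c p) = c * L p"
    for L :: "real poly \<Rightarrow> real" and q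
  proof -
    have zero: "L 0 = 0"
      using sm[of 0 0] by simp
    have sum: "L (sum f A) = (\<Sum>a\<in>A. L (f a))" if "finite A" for f and A :: "nat set"
      using that by (induction A rule: finite_induct) (auto simp: zero add)
    have "L q = L (\<Sum>i\<le>d. smult (coeff q i) (monom 1 i))"
      using poly_as_sum_of_monoms'[OF that(1)] by (simp add: smult_monom)
    then show ?thesis
      by (simp add: sum sm)
  qed
  have deg_pow: "degree ([:-\<tau>, 1:] ^ d) \<le> d" for \<tau> :: real
    by (simp add: degree_linear_power)
  have pow: "L ([:-\<tau>, 1:] ^ d) = (\<Sum>i\<le>d. (real (d choose i) * (-1) ^ i * L (monom 1 (d - i))) * \<tau> ^ i)"
    if add: "\<And>p q. L (p + q) = L p + L q" and sm: "\<And>c p. L (smult c p) = c * L p"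
    for L :: "real poly \<Rightarrow> real" and \<tau>
  proof -
    have "L ([:-\<tau>, 1:] ^ d) = (\<Sum>i\<le>d. coeff ([:-\<tau>, 1:] ^ d) i * L (monom 1 i))"
      by (rule expand[OF deg_pow add sm])
    also have "\<dots> = (\<Sum>i\<le>d. coeff ([:-\<tau>, 1:] ^ d) (d - i) * L (monom 1 (d - i)))"
      by (rule sum.reindex_bij_witness[of _ "\<lambda>i. d - i" "\<lambda>i. d - i"]) auto
    also have "\<dots> = (\<Sum>i\<le>d. (real (d choose i) * (-1) ^ i * L (monom 1 (d - i))) * \<tau> ^ i)"
    proof (rule sum.cong[OF refl])
      fix i assume "i \<in> {..d}"
      then have i: "i \<le> d" by simp
      have c: "coeff ([:-\<tau>, 1:] ^ d) (d - i) = real (d choose i) * ((-1) ^ i * \<tau> ^ i)"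
        using i by (simp add: coeff_linear_poly_power binomial_symmetric[of i d]
            power_mult_distrib[symmetric])
      show "coeff ([:-\<tau>, 1:] ^ d) (d - i) * L (monom 1 (d - i))
         = (real (d choose i) * (-1) ^ i * L (monom 1 (d - i))) * \<tau> ^ i"
        unfolding c by (simp add: mult_ac)
    qed
    finally show ?thesis .
  qed
  have "\<forall>\<tau>. (\<Sum>i\<le>d. (real (d choose i) * (-1) ^ i * L (monom 1 (d - i))) * \<tau> ^ i)
          = (\<Sum>i\<le>d. (real (d choose i) * (-1) ^ i * M (monom 1 (d - i))) * \<tau> ^ i)"
    using eq unfolding pow[of L, OF add1 sm1] pow[of M, OF add2 sm2] by blast
  then have "\<forall>i\<le>d. real (d choose i) * (-1) ^ i * L (monom 1 (d - i))
                 = real (d choose i) * (-1) ^ i * M (monom 1 (d - i))"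
    by (simp only: polyfun_eq_coeffs)
  then have *: "L (monom 1 (d - i)) = M (monom 1 (d - i))" if "i \<le> d" for i
    using that by auto
  have "L (monom 1 i) = M (monom 1 i)" if "i \<le> d" for i
    using *[of "d - i"] that by simp
  then show ?thesis
    by (simp add: expand[of p L, OF deg add1 sm1] expand[of p M, OF deg add2 sm2])
qed

lemma polar_affine:
  assumes "degree p \<le> d" "h \<noteq> 0"
  shows "polar d u p = polar d (\<lambda>r. (u r - a) / h) (pcompose p [:a, h:])"
proof (rule linear_functionals_eq_on_powers[where d = d and
        M = "\<lambda>p. polar d (\<lambda>r. (u r - a) / h) (pcompose p [:a, h:])"])
  fix \<tau>
  have pow: "pcompose (q ^ n) [:a, h:] = pcompose q [:a, h:] ^ n" for q n
    by (induction n) (simp_all add: pcompose_mult pcompose_1)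
  have "pcompose ([:-\<tau>, 1:] ^ d) [:a, h:] = [:a - \<tau>, h:] ^ d"
    by (simp add: pow pcompose_pCons)
  also have "[:a - \<tau>, h:] = smult h [:- ((\<tau> - a) / h), 1:]"
    using assms by (simp add: field_simps)
  finally have "polar d (\<lambda>r. (u r - a) / h) (pcompose ([:-\<tau>, 1:] ^ d) [:a, h:])
      = h ^ d * (\<Prod>r<d. (u r - a) / h - (\<tau> - a) / h)"
    by (simp only: smult_power polar_smult polar_power)
  also have "\<dots> = (\<Prod>r<d. h * ((u r - a) / h - (\<tau> - a) / h))"
    by (simp add: prod.distrib)
  also have "\<dots> = (\<Prod>r<d. u r - \<tau>)"
    using assms by (intro prod.cong) (auto simp: field_simps)
  finally show "polar d u ([:-\<tau>, 1:] ^ d)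
      = polar d (\<lambda>r. (u r - a) / h) (pcompose ([:-\<tau>, 1:] ^ d) [:a, h:])"
    by (simp only: polar_power)
qed (use assms in \<open>auto simp: polar_add polar_smult pcompose_add pcompose_smult\<close>)

lemma abs_coeff_prod_linear_le:
  assumes "\<And>r. r < d \<Longrightarrow> \<bar>u r\<bar> \<le> K"
  shows "\<bar>coeff (\<Prod>r<d. [:u r, -1:]) i\<bar> \<le> (1 + K :: real) ^ d"
  using assms
proof (induction d arbitrary: i)
  case (Suc d)
  have "K \<ge> 0"
    using Suc.prems[of 0] by simp
  define Q where "Q = (\<Prod>r<d. [:u r, -1:])"
  have IH: "\<bar>coeff Q i\<bar> \<le> (1 + K) ^ d" for i
    using Suc by (simp add: Q_def)
  define P where "P = (\<Prod>r<Suc d. [:u r, -1:])"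
  have P: "P = [:u d, -1:] * Q"
    by (simp add: P_def Q_def mult.commute del: mult_pCons_left mult_pCons_right)
  have "coeff P i = u d * coeff Q i - (case i of 0 \<Rightarrow> 0 | Suc j \<Rightarrow> coeff Q j)"
    unfolding P by (cases i) (auto simp: coeff_pCons)
  moreover have "\<bar>u d * coeff Q i\<bar> \<le> K * (1 + K) ^ d"
    using Suc.prems[of d] IH[of i] \<open>K \<ge> 0\<close> unfolding abs_mult by (intro mult_mono) auto
  moreover have "\<bar>case i of 0 \<Rightarrow> 0 | Suc j \<Rightarrow> coeff Q j\<bar> \<le> (1 + K) ^ d"
    using IH \<open>K \<ge> 0\<close> by (cases i) auto
  ultimately have "\<bar>coeff P i\<bar> \<le> K * (1 + K) ^ d + (1 + K) ^ d"
    by linarith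
  then show ?case
    by (simp add: P_def algebra_simps)
qed simp

text \<open>The constant depends only on the degree and on how far the arguments are from \<open>a\<close> in
  units of \<open>h\<close>, because by affine invariance everything can be moved to the unit interval.\<close>

lemma polar_bound:
  "\<exists>C>0. \<forall>(p::real poly) a h u. degree p \<le> d \<longrightarrow> h > 0 \<longrightarrow> (\<forall>r<d. \<bar>u r - a\<bar> \<le> K * h) \<longrightarrow>
     \<bar>polar d u p\<bar> \<le> C * (\<Sum>m\<le>d. \<bar>poly p (a + h * (1/2)^m)\<bar>)"
proof -
  obtain C where "C > 0"
    and C: "\<And>(p::real poly) i. degree p \<le> d \<Longrightarrow> \<bar>coeff p i\<bar> \<le> C * (\<Sum>m\<le>d. \<bar>poly p ((1/2)^m)\<bar>)"
    using coeff_bound_by_node_values[of d] by auto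
  define M where "M = (1 + \<bar>K\<bar>) ^ d"
  have "M > 0"
    by (simp add: M_def)
  show ?thesis
  proof (intro exI[of _ "real (Suc d) * C * M"] conjI allI impI)
    show "0 < real (Suc d) * C * M"
      using \<open>C > 0\<close> \<open>M > 0\<close> by simp
  next
    fix p :: "real poly" and a h u
    assume deg: "degree p \<le> d" and h: "h > 0" and u: "\<forall>r<d. \<bar>u r - a\<bar> \<le> K * h"
    define q where "q = pcompose p [:a, h:]"
    define v where "v = (\<lambda>r. (u r - a) / h)"
    define S where "S = (\<Sum>m\<le>d. \<bar>poly p (a + h * (1/2)^m)\<bar>)"
    have "degree q \<le> d"
      using deg h by (simp add: q_def degree_pcompose)
    then have q: "\<bar>coeff q i\<bar> \<le> C * S" for i
      using C[of q i] by (simp add: q_def S_def poly_pcompose mult.commute)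
    have v: "\<bar>coeff (\<Prod>r<d. [:v r, -1:]) i\<bar> \<le> M" for i
      unfolding M_def
    proof (rule abs_coeff_prod_linear_le)
      fix r assume "r < d"
      then have "\<bar>u r - a\<bar> / h \<le> K"
        using u h by (simp add: field_simps)
      then show "\<bar>v r\<bar> \<le> \<bar>K\<bar>"
        using h by (simp add: v_def)
    qed
    have "S \<ge> 0"
      by (simp add: S_def sum_nonneg)
    have "\<bar>polar d u p\<bar> = \<bar>polar d v q\<bar>"
      using polar_affine[OF deg, of h u a] h by (simp add: q_def v_def)
    also have "\<dots> \<le> (\<Sum>i\<le>d. \<bar>coeff q (d - i) * coeff (\<Prod>r<d. [:v r, -1:]) i * (-1) ^ i / real (d choose i)\<bar>)"
      unfolding polar_def by (rule sum_abs)
    also have "\<dots> \<le> (\<Sum>i\<le>d. C * S * M)"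
    proof (rule sum_mono)
      fix i assume "i \<in> {..d}"
      then have "0 < d choose i"
        by (simp add: zero_less_binomial)
      then have "1 \<le> real (d choose i)"
        by linarith
      have "\<bar>coeff q (d - i) * coeff (\<Prod>r<d. [:v r, -1:]) i * (-1) ^ i / real (d choose i)\<bar>
          = \<bar>coeff q (d - i)\<bar> * \<bar>coeff (\<Prod>r<d. [:v r, -1:]) i\<bar> / real (d choose i)"
        by (simp add: abs_mult)
      also have "\<dots> \<le> \<bar>coeff q (d - i)\<bar> * \<bar>coeff (\<Prod>r<d. [:v r, -1:]) i\<bar> / 1"
        using \<open>1 \<le> real (d choose i)\<close> \<open>i \<in> {..d}\<close> by (intro divide_left_mono) auto
      also have "\<dots> \<le> C * S * M"
        using q v \<open>C > 0\<close> \<open>S \<ge> 0\<close> by (simp, intro mult_mono) auto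
      finally show "\<bar>coeff q (d - i) * coeff (\<Prod>r<d. [:v r, -1:]) i * (-1) ^ i / real (d choose i)\<bar> \<le> C * S * M" .
    qed
    also have "\<dots> = real (Suc d) * C * M * S"
      by simp
    finally show "\<bar>polar d u p\<bar> \<le> real (Suc d) * C * M * (\<Sum>m\<le>d. \<bar>poly p (a + h * (1/2)^m)\<bar>)"
      by (simp only: S_def)
  qed
qed

section \<open>Interval partitions\<close>

lemma sigma_sets_partition:
  assumes "partition_on \<Omega> P" "A \<in> sigma_sets \<Omega> P"
  shows "\<exists>Q\<subseteq>P. A = \<Union>Q"
  using assms(2)
proof (induction rule: sigma_sets.induct)
  case (Basic A)
  then show ?case
    by (intro exI[of _ "{A}"]) auto
next
  case (Compl A)
  then obtain Q where Q: "Q \<subseteq> P" "A = \<Union>Q"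
    by blast
  have "B \<inter> C = {}" if "B \<in> P - Q" "C \<in> Q" for B C
  proof -
    have "B \<in> P" "C \<in> P" "B \<noteq> C"
      using that Q by auto
    then show ?thesis
      using assms(1) unfolding partition_on_def disjoint_def by blast
  qed
  moreover have "\<Omega> = \<Union>P"
    using assms(1) by (simp add: partition_on_def)
  ultimately have "\<Omega> - A = \<Union>(P - Q)"
    unfolding Q(2) by blast
  then show ?case
    by blast
next
  case (Union A)
  then obtain Q where "\<And>i. Q i \<subseteq> P" "\<And>i. A i = \<Union>(Q i)"
    by metis
  then show ?case
    by (intro exI[of _ "\<Union>i. Q i"]) auto
qed auto

lemma atoms_sigma_sets:
  assumes "partition_on \<Omega> P"
  shows "atoms (sigma_sets \<Omega> P) = P"
proof (intro equalityI subsetI)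
  fix A assume "A \<in> atoms (sigma_sets \<Omega> P)"
  then have A: "A \<in> sigma_sets \<Omega> P" "A \<noteq> {}"
    and min: "\<And>B. B \<in> sigma_sets \<Omega> P \<Longrightarrow> B \<subseteq> A \<Longrightarrow> B = {} \<or> B = A"
    by (auto simp: atoms_def)
  obtain Q where Q: "Q \<subseteq> P" "A = \<Union>Q"
    using sigma_sets_partition[OF assms A(1)] by blast
  then obtain B where "B \<in> Q" "B \<noteq> {}"
    using A(2) by blast
  then have "B = A"
    using min[of B] Q by (auto intro: sigma_sets.Basic)
  then show "A \<in> P"
    using \<open>B \<in> Q\<close> Q by blast
next
  fix A assume "A \<in> P"
  have "A \<noteq> {}"
    using \<open>A \<in> P\<close> assms by (auto simp: partition_on_def)
  moreover have "B = {} \<or> B = A" if B: "B \<in> sigma_sets \<Omega> P" "B \<subseteq> A" for B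
  proof -
    obtain Q where Q: "Q \<subseteq> P" "B = \<Union>Q"
      using sigma_sets_partition[OF assms B(1)] by blast
    have "C = A" if "C \<in> Q" for C
    proof (rule ccontr)
      assume "C \<noteq> A"
      then have "C \<inter> A = {}" "C \<noteq> {}"
        using that Q \<open>A \<in> P\<close> assms by (auto simp: partition_on_def disjoint_def)
      then show False
        using that Q B(2) by blast
    qed
    then show ?thesis
      using Q by blast
  qed
  ultimately show "A \<in> atoms (sigma_sets \<Omega> P)"
    using \<open>A \<in> P\<close> by (auto simp: atoms_def intro: sigma_sets.Basic)
qed

text \<open>Positions are measured by counting atoms. The count refers to no enumeration of the atoms,
  so it can be compared between the partitions of different times.\<close>

definition atom_index :: "real set set \<Rightarrow> real \<Rightarrow> nat" where
  "atom_index \<F> x = card {A \<in> atoms \<F>. \<forall>z\<in>A. z < x}"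

text \<open>The atoms enumerated from left to right. An atom may contain both, one or none of its
  endpoints, so it is only known to lie between the open and the closed interval.\<close>

locale interval_grid =
  fixes \<F> :: "real set set" and s :: "nat \<Rightarrow> real" and a :: "nat \<Rightarrow> real set" and m :: nat
  assumes m_pos: "0 < m" and s_0: "s 0 = 0" and s_m: "s m = 1"
    and s_step: "\<And>i. i < m \<Longrightarrow> s i < s (Suc i)"
    and open_subset_atom: "\<And>i. i < m \<Longrightarrow> {s i<..<s (Suc i)} \<subseteq> a i"
    and atom_subset_closed: "\<And>i. i < m \<Longrightarrow> a i \<subseteq> {s i..s (Suc i)}"
    and atoms_disjoint: "\<And>i j. i < j \<Longrightarrow> j < m \<Longrightarrow> a i \<inter> a j = {}"
    and atoms_cover: "(\<Union>i<m. a i) = {0..1}"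
    and atoms_eq: "atoms \<F> = a ` {..<m}"
    and breakpoints_eq: "breakpoints \<F> = map s [0..<Suc m]"

text \<open>The atoms are sorted by their left endpoints. The right endpoint of each atom is the next
  left endpoint: if it were larger, two atoms would overlap, and if it were smaller, the points in
  between would belong to no atom.\<close>

lemma interval_sigma_algebra_grid:
  assumes "interval_sigma_algebra \<F>"
  shows "\<exists>s a m. interval_grid \<F> s a m"
proof -
  obtain P where P: "interval_partition P" "\<F> = sigma_sets {0..1} P"
    using assms by (auto simp: interval_sigma_algebra_def)
  have fin: "finite P" and part: "partition_on {0..1} P"
    and P_int: "\<And>A. A \<in> P \<Longrightarrow> is_interval A" and P_pos: "\<And>A. A \<in> P \<Longrightarrow> measure lborel A > 0"
    using P(1) by (auto simp: interval_partition_def)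
  have at: "atoms \<F> = P"
    using atoms_sigma_sets[OF part] P(2) by simp
  have un: "\<Union>P = {0..1}" and ne: "\<And>A. A \<in> P \<Longrightarrow> A \<noteq> {}"
    using part by (auto simp: partition_on_def)
  have disj: "A \<inter> B = {}" if "A \<in> P" "B \<in> P" "A \<noteq> B" for A B
    using part that by (auto simp: partition_on_def disjoint_def)
  have sub01: "A \<subseteq> {0..1}" if "A \<in> P" for A
    using un that by blast
  have bdd: "bdd_below A" "bdd_above A" if "A \<in> P" for A
    using sub01[OF that] bdd_below_mono[of "{0..1}" A] bdd_above_mono[of "{0..1}" A] by auto
  have closed: "A \<subseteq> {Inf A..Sup A}" if "A \<in> P" for A
    using bdd[OF that] by (auto intro: cInf_lower cSup_upper)
  have less: "Inf A < Sup A" if "A \<in> P" for A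
  proof (rule ccontr)
    assume "\<not> Inf A < Sup A"
    then have "A \<subseteq> {Inf A}"
      using closed[OF that] by force
    then have "A = {Inf A}"
      using ne[OF that] by blast
    then have "measure lborel A = 0"
      using measure_lborel_singleton[of "Inf A"] by simp
    then show False
      using P_pos[OF that] by simp
  qed
  have op: "{Inf A<..<Sup A} \<subseteq> A" if AP: "A \<in> P" for A
  proof
    fix y assume y: "y \<in> {Inf A<..<Sup A}"
    obtain x where "x \<in> A" "x < y"
      using y ne[OF AP] cInf_lessD[of A y] by auto
    moreover obtain z where "z \<in> A" "y < z"
      using y ne[OF AP] less_cSupD[of A y] by auto
    ultimately show "y \<in> A"
      using P_int[OF AP] unfolding is_interval_1 by (meson less_imp_le)
  qed
  have overlap: "A = B" if "A \<in> P" "B \<in> P" "Inf B < Sup A" "Inf A < Sup B" for A B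
  proof (rule ccontr)
    assume "A \<noteq> B"
    have "max (Inf A) (Inf B) < min (Sup A) (Sup B)"
      using that less by auto
    then obtain y where "max (Inf A) (Inf B) < y" "y < min (Sup A) (Sup B)"
      using dense by blast
    then have "y \<in> A" "y \<in> B"
      using op[OF that(1)] op[OF that(2)] by auto
    then show False
      using disj[OF that(1,2) \<open>A \<noteq> B\<close>] by blast
  qed
  have Inf_inj: "inj_on Inf P"
  proof (rule inj_onI)
    fix A B assume "A \<in> P" "B \<in> P" "Inf A = Inf B"
    then show "A = B"
      using overlap[of A B] less[of A] less[of B] by simp
  qed
  define xs where "xs = sorted_list_of_set (Inf ` P)"
  define m where "m = card P"
  have xs: "sorted xs" "distinct xs" "set xs = Inf ` P" "length xs = m"
    using fin by (auto simp: xs_def m_def card_image[OF Inf_inj])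
  define s where "s = (\<lambda>i. if i < m then xs ! i else 1)"
  define a where "a = (\<lambda>i. inv_into P Inf (s i))"
  have s_in: "s i \<in> Inf ` P" if "i < m" for i
    using that xs nth_mem[of i xs] by (simp add: s_def)
  have a_in: "a i \<in> P" and Inf_a: "Inf (a i) = s i" if "i < m" for i
    unfolding a_def using s_in[OF that] by (auto intro: inv_into_into f_inv_into_f)
  have a_surj: "\<exists>i<m. A = a i" if "A \<in> P" for A
  proof -
    have "Inf A \<in> set xs"
      using that xs by auto
    then obtain i where "i < m" "xs ! i = Inf A"
      using xs(4) by (auto simp: in_set_conv_nth)
    then have "Inf (a i) = Inf A"
      using Inf_a by (simp add: s_def)
    then show ?thesis
      using Inf_inj a_in that \<open>i < m\<close> by (auto dest: inj_onD)
  qed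
  have a_image: "a ` {..<m} = P"
    using a_in a_surj by auto
  have s_strict: "s i < s j" if "i < j" "j < m" for i j
    using that xs sorted_wrt_nth_less[of "(<)" xs i j]
    by (simp add: s_def strict_sorted_iff)
  have s_lt1: "s i < 1" if "i < m" for i
  proof -
    have "Sup (a i) \<le> 1"
      using sub01[OF a_in[OF that]] ne[OF a_in[OF that]] by (intro cSup_least) auto
    then show ?thesis
      using less[OF a_in[OF that]] Inf_a[OF that] by simp
  qed
  have "m > 0"
    using un fin by (auto simp: m_def card_gt_0_iff)
  have s_step: "s i < s (Suc i)" if "i < m" for i
    using that s_strict[of i "Suc i"] s_lt1[OF that] by (cases "Suc i < m") (auto simp: s_def)
  have s_mono: "s i \<le> s j" if "i \<le> j" "j \<le> m" for i j
  proof (cases "i = j")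
    case False
    show ?thesis
    proof (cases "j < m")
      case True
      then show ?thesis
        using s_strict[of i j] that False by simp
    next
      case False
      then have "s j = 1"
        by (simp add: s_def)
      then show ?thesis
        using s_lt1[of i] that \<open>i \<noteq> j\<close> by simp
    qed
  qed simp
  have Sup_le: "Sup (a i) \<le> s (Suc i)" if "i < m" for i
  proof (cases "Suc i < m")
    case True
    show ?thesis
    proof (rule ccontr)
      assume "\<not> Sup (a i) \<le> s (Suc i)"
      then have "Inf (a (Suc i)) < Sup (a i)"
        using Inf_a[OF True] by simp
      moreover have "Inf (a i) < Sup (a (Suc i))"
        using Inf_a True that s_step[OF that] less[OF a_in[OF True]] by simp
      ultimately have "a i = a (Suc i)"
        using overlap a_in True that by blast
      then show False
        using Inf_a[OF that] Inf_a[OF True] s_step[OF that] by simp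
    qed
  next
    case False
    then have "s (Suc i) = 1"
      by (simp add: s_def)
    moreover have "Sup (a i) \<le> 1"
      using sub01[OF a_in[OF that]] ne[OF a_in[OF that]] by (intro cSup_least) auto
    ultimately show ?thesis
      by simp
  qed
  have Sup_a: "Sup (a i) = s (Suc i)" if im: "i < m" for i
  proof (rule ccontr)
    assume "Sup (a i) \<noteq> s (Suc i)"
    then obtain y where y: "Sup (a i) < y" "y < s (Suc i)"
      using Sup_le[OF im] dense[of "Sup (a i)" "s (Suc i)"] by auto
    have "0 \<le> Sup (a i)"
      using ne[OF a_in[OF that]] sub01[OF a_in[OF that]] bdd(2)[OF a_in[OF that]]
      by (meson atLeastAtMost_iff cSup_upper2 ex_in_conv subsetD)
    moreover have "s (Suc i) \<le> 1"
      using s_mono[of "Suc i" m] that by (auto simp: s_def)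
    ultimately obtain B where "B \<in> P" "y \<in> B"
      using y un by (metis UnionE atLeastAtMost_iff dual_order.trans less_imp_le)
    then obtain j where j: "j < m" "y \<in> a j"
      using a_surj by blast
    then have jy: "s j \<le> y" "y \<le> Sup (a j)"
      using closed[OF a_in[OF j(1)]] Inf_a[OF j(1)] by auto
    show False
    proof (cases "j \<le> i")
      case True
      then have "Sup (a j) \<le> Sup (a i)"
      proof (cases "j = i")
        case False
        then have "Sup (a j) \<le> s (Suc j)" "s (Suc j) \<le> s i"
          using True that Sup_le[OF j(1)] s_mono[of "Suc j" i] by auto
        then show ?thesis
          using less[OF a_in[OF that]] Inf_a[OF that] by simp
      qed simp
      then show False
        using y jy by simp
    next
      case False
      then have "s (Suc i) \<le> s j"
        using s_mono[of "Suc i" j] j by simp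
      then show False
        using y jy by simp
    qed
  qed
  have s_image: "s ` {..m} = Inf ` P \<union> Sup ` P"
  proof -
    have "Inf ` P = s ` {..<m}"
      unfolding a_image[symmetric] image_image using Inf_a by (auto simp: image_iff)
    moreover have "Sup ` P = s ` Suc ` {..<m}"
      unfolding a_image[symmetric] image_image using Sup_a by (auto simp: image_iff)
    moreover have "{..m} = {..<m} \<union> Suc ` {..<m}"
      using \<open>m > 0\<close> by (auto simp: lessThan_Suc_atMost[symmetric] image_Suc_lessThan)
    ultimately show ?thesis
      by (simp add: image_Un)
  qed
  have s_strict': "s i < s j" if "i < j" "j \<le> m" for i j
    using s_step[of i] s_mono[of "Suc i" j] that by auto
  have "sorted_wrt (<) (map s [0..<Suc m])"
    unfolding sorted_wrt_map
    by (rule sorted_wrt_mono_rel[of _ "(<)"]) (auto intro: s_strict' simp del: upt_Suc)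
  then have "sorted_list_of_set (set (map s [0..<Suc m])) = map s [0..<Suc m]"
    by (simp only: strict_sorted_iff sorted_list_of_set.idem_if_sorted_distinct)
  moreover have "set (map s [0..<Suc m]) = Inf ` P \<union> Sup ` P"
    using s_image by (simp add: atLeast0LessThan lessThan_Suc_atMost del: upt_Suc)
  ultimately have bp: "breakpoints \<F> = map s [0..<Suc m]"
    by (simp add: breakpoints_def at del: upt_Suc)
  have "s 0 = 0"
  proof (rule antisym)
    obtain B where "B \<in> P" "0 \<in> B"
      using un by (metis UnionE atLeastAtMost_iff order_refl zero_le_one)
    then obtain j where j: "j < m" "0 \<in> a j"
      using a_surj by blast
    have "s 0 \<le> s j"
      using j s_mono by simp
    also have "s j \<le> 0"
      using closed[OF a_in[OF j(1)]] Inf_a[OF j(1)] j(2) by auto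
    finally show "s 0 \<le> 0" .
    have "0 \<le> Inf (a 0)"
      using ne[OF a_in[OF \<open>m > 0\<close>]] sub01[OF a_in[OF \<open>m > 0\<close>]] by (intro cInf_greatest) auto
    then show "0 \<le> s 0"
      using Inf_a[OF \<open>m > 0\<close>] by simp
  qed
  have "interval_grid \<F> s a m"
  proof
    fix i assume i: "i < m"
    show "{s i<..<s (Suc i)} \<subseteq> a i" "a i \<subseteq> {s i..s (Suc i)}"
      using op[OF a_in[OF i]] closed[OF a_in[OF i]] Inf_a[OF i] Sup_a[OF i] by auto
  next
    fix i j :: nat assume ij: "i < j" "j < m"
    have "a i \<noteq> a j"
      using Inf_a[of i] Inf_a[of j] s_strict[OF ij] ij by auto
    then show "a i \<inter> a j = {}"
      using disj a_in ij by auto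
  next
    show "s m = 1"
      by (simp add: s_def)
    show "(\<Union>i<m. a i) = {0..1}"
      unfolding a_image un ..
    show "atoms \<F> = a ` {..<m}"
      by (simp only: a_image at)
  qed (fact \<open>m > 0\<close> \<open>s 0 = 0\<close> s_step bp)+
  then show ?thesis
    by blast
qed

context interval_grid
begin

lemma s_strict: "i < j \<Longrightarrow> j \<le> m \<Longrightarrow> s i < s j"
proof (induction j)
  case (Suc j)
  then show ?case
    using s_step[of j] by (cases "i = j") auto
qed simp

lemma s_mono: "i \<le> j \<Longrightarrow> j \<le> m \<Longrightarrow> s i \<le> s j"
  using s_strict[of i j] by (cases "i = j") auto

lemma s_range: "i \<le> m \<Longrightarrow> 0 \<le> s i \<and> s i \<le> 1"
  using s_mono[of 0 i] s_mono[of i m] s_0 s_m by simp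

lemma atom_bounds:
  assumes "i < m" "x \<in> a i"
  shows "s i \<le> x" "x \<le> s (Suc i)"
  using atom_subset_closed[OF assms(1)] assms(2) by auto

lemma atom_nonempty: "i < m \<Longrightarrow> a i \<noteq> {}"
  using open_subset_atom[of i] dense[OF s_step[of i]] by force

lemma atom_unique: "i < m \<Longrightarrow> j < m \<Longrightarrow> x \<in> a i \<Longrightarrow> x \<in> a j \<Longrightarrow> i = j"
  using atoms_disjoint[of i j] atoms_disjoint[of j i] by (cases i j rule: linorder_cases) auto

lemma atom_less:
  assumes "i < j" "j < m" "x \<in> a i" "y \<in> a j"
  shows "x < y"
proof -
  have "x \<le> s (Suc i)" "s (Suc i) \<le> s j" "s j \<le> y"
    using atom_bounds[of i x] atom_bounds[of j y] s_mono[of "Suc i" j] assms by auto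
  moreover have "x \<noteq> y"
    using atoms_disjoint[of i j] assms by auto
  ultimately show ?thesis
    by simp
qed

lemma atom_le_index:
  assumes "i < m" "j < m" "x \<in> a i" "y \<in> a j" "x \<le> y"
  shows "i \<le> j"
  using atom_less[of j i y x] assms by (meson leD leI)

lemma atom_exists: "x \<in> {0..1} \<Longrightarrow> \<exists>i<m. x \<in> a i"
  using atoms_cover by blast

lemma atom_subset_unit: "i < m \<Longrightarrow> a i \<subseteq> {0..1}"
  using atoms_cover by blast

lemma inj_atoms: "inj_on a {..<m}"
proof (rule inj_onI)
  fix i j assume "i \<in> {..<m}" "j \<in> {..<m}" "a i = a j"
  then show "i = j"
    using atom_nonempty[of i] atom_unique[of i j] by auto
qed

lemma card_atoms: "card (atoms \<F>) = m"
  by (simp add: atoms_eq card_image[OF inj_atoms])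

lemma atom_index_eq:
  assumes "i < m" "x \<in> a i"
  shows "atom_index \<F> x = i"
proof -
  have "{A \<in> atoms \<F>. \<forall>z\<in>A. z < x} = a ` {..<i}"
  proof (intro equalityI subsetI)
    fix A assume "A \<in> {A \<in> atoms \<F>. \<forall>z\<in>A. z < x}"
    then obtain j where j: "j < m" "A = a j" "\<forall>z\<in>a j. z < x"
      by (auto simp: atoms_eq)
    obtain z where z: "z \<in> a j"
      using atom_nonempty[OF j(1)] by blast
    have "j < i"
      using atom_less[of i j x z] z j assms by (metis less_asym linorder_neqE_nat less_irrefl)
    then show "A \<in> a ` {..<i}"
      using j by blast
  next
    fix A assume "A \<in> a ` {..<i}"
    then obtain j where "j < i" "A = a j"
      by blast
    then show "A \<in> {A \<in> atoms \<F>. \<forall>z\<in>A. z < x}"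
      using atom_less[of j i _ x] assms by (auto simp: atoms_eq)
  qed
  moreover have "inj_on a {..<i}"
    using inj_atoms assms(1) by (auto intro: inj_on_subset)
  ultimately show ?thesis
    by (simp add: atom_index_def card_image)
qed

end

lemma interval_filtration_le:
  assumes "interval_filtration \<F>" "1 \<le> i" "i \<le> j"
  shows "\<F> i \<subseteq> \<F> j"
  using assms(3)
proof (induction rule: dec_induct)
  case (step n)
  then have "\<F> n \<subseteq> \<F> (Suc n)"
    using assms by (simp add: interval_filtration_def)
  then show ?case
    using step by blast
qed simp

lemma atom_refinement:
  assumes "interval_sigma_algebra \<F>" "interval_sigma_algebra \<G>" "\<F> \<subseteq> \<G>"
    and "A \<in> atoms \<F>" "B \<in> atoms \<G>" "A \<inter> B \<noteq> {}"
  shows "B \<subseteq> A"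
proof -
  obtain P where P: "interval_partition P" "\<G> = sigma_sets {0..1} P"
    using assms(2) by (auto simp: interval_sigma_algebra_def)
  then have part: "partition_on {0..1} P"
    by (simp add: interval_partition_def)
  have "A \<in> sigma_sets {0..1} P"
    using assms(3,4) P(2) by (auto simp: atoms_def)
  then obtain Q where Q: "Q \<subseteq> P" "A = \<Union>Q"
    using sigma_sets_partition[OF part] by blast
  have "B \<in> P"
    using assms(5) atoms_sigma_sets[OF part] P(2) by simp
  obtain C where "C \<in> Q" "C \<inter> B \<noteq> {}"
    using assms(6) Q by blast
  then have "C = B"
    using part Q \<open>B \<in> P\<close> unfolding partition_on_def disjoint_def by blast
  then show ?thesis
    using Q \<open>C \<in> Q\<close> by blast
qed

text \<open>Every coarse atom between two points contains a fine atom between them, hence at most as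
  many coarse atoms as fine ones separate the points.\<close>

lemma atom_index_refinement:
  assumes F: "interval_sigma_algebra \<F>" and G: "interval_sigma_algebra \<G>" and sub: "\<F> \<subseteq> \<G>"
    and x: "x \<in> {0..1}" and y: "y \<in> {0..1}"
  shows "\<bar>int (atom_index \<F> x) - int (atom_index \<F> y)\<bar> \<le> \<bar>int (atom_index \<G> x) - int (atom_index \<G> y)\<bar>"
proof -
  have main: "\<bar>int (atom_index \<F> x) - int (atom_index \<F> y)\<bar> \<le> \<bar>int (atom_index \<G> x) - int (atom_index \<G> y)\<bar>"
    if xy: "x \<in> {0..1}" "y \<in> {0..1}" "x \<le> y" for x y
  proof -
    obtain s a m where "interval_grid \<F> s a m"
      using interval_sigma_algebra_grid[OF F] by blast
    then interpret F: interval_grid \<F> s a m .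
    obtain s' a' m' where "interval_grid \<G> s' a' m'"
      using interval_sigma_algebra_grid[OF G] by blast
    then interpret G: interval_grid \<G> s' a' m' .
    have sub_atom: "a' q' \<subseteq> a q" if "q < m" "q' < m'" "w \<in> a q" "w \<in> a' q'" for q q' w
      by (rule atom_refinement[OF F G sub]) (use that F.atoms_eq G.atoms_eq in auto)
    obtain i where i: "i < m" "x \<in> a i" using F.atom_exists xy by blast
    obtain j where j: "j < m" "y \<in> a j" using F.atom_exists xy by blast
    obtain i' where i': "i' < m'" "x \<in> a' i'" using G.atom_exists xy by blast
    obtain j' where j': "j' < m'" "y \<in> a' j'" using G.atom_exists xy by blast
    have le: "i \<le> j" "i' \<le> j'"
      using F.atom_le_index[OF i(1) j(1) i(2) j(2)] G.atom_le_index[OF i'(1) j'(1) i'(2) j'(2)] xy by auto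
    have "\<exists>q'\<in>{i'..<j'}. a' q' \<subseteq> a q" if q: "q \<in> {i..<j}" for q
    proof -
      have "\<exists>w\<in>a q. x \<le> w"
      proof (cases "q = i")
        case False
        then show ?thesis
          using F.atom_nonempty[of q] F.atom_less[of i q x] i j q by fastforce
      qed (use i in auto)
      then obtain w where w: "w \<in> a q" "x \<le> w"
        by blast
      have "w < y"
        using F.atom_less[of q j w y] q j w by auto
      have "w \<in> {0..1}"
        using F.atom_subset_unit[of q] q j w by auto
      then obtain q' where q': "q' < m'" "w \<in> a' q'"
        using G.atom_exists by blast
      have "a' q' \<subseteq> a q"
        using sub_atom[of q q' w] q j w q' by auto
      moreover have "i' \<le> q'" "q' \<le> j'"
        using G.atom_le_index[of i' q' x w] G.atom_le_index[of q' j' w y] i' j' q' w \<open>w < y\<close> by auto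
      moreover have "q' \<noteq> j'"
      proof
        assume "q' = j'"
        then have "y \<in> a q"
          using \<open>a' q' \<subseteq> a q\<close> j' by blast
        then show False
          using F.atom_unique[of q j y] q j by auto
      qed
      ultimately show ?thesis
        by (intro bexI[of _ q']) auto
    qed
    then obtain \<phi> where \<phi>: "\<And>q. q \<in> {i..<j} \<Longrightarrow> \<phi> q \<in> {i'..<j'} \<and> a' (\<phi> q) \<subseteq> a q"
      by metis
    have "inj_on \<phi> {i..<j}"
    proof (rule inj_onI)
      fix p q assume pq: "p \<in> {i..<j}" "q \<in> {i..<j}" "\<phi> p = \<phi> q"
      have "\<phi> p < m'"
        using \<phi>[OF pq(1)] j' by auto
      then have "a' (\<phi> p) \<noteq> {}"
        using G.atom_nonempty by blast
      then obtain w where "w \<in> a p" "w \<in> a q"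
        using \<phi>[OF pq(1)] \<phi>[OF pq(2)] pq(3) by (metis ex_in_conv subsetD)
      then show "p = q"
        using F.atom_unique[of p q w] pq j by auto
    qed
    then have "card {i..<j} \<le> card {i'..<j'}"
      using \<phi> by (intro card_inj_on_le[of \<phi>]) auto
    then show ?thesis
      using F.atom_index_eq[OF i] F.atom_index_eq[OF j] G.atom_index_eq[OF i'] G.atom_index_eq[OF j'] le
      by simp
  qed
  show ?thesis
  proof (cases "x \<le> y")
    case True
    then show ?thesis using main x y by blast
  next
    case False
    then show ?thesis using main[of y x] x y by linarith
  qed
qed

lemma spline_space_mono:
  assumes "interval_sigma_algebra \<F>" "interval_sigma_algebra \<G>" "\<F> \<subseteq> \<G>"
  shows "spline_space k \<F> \<subseteq> spline_space k \<G>"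
proof
  fix f assume f: "f \<in> spline_space k \<F>"
  obtain s a m where "interval_grid \<F> s a m"
    using interval_sigma_algebra_grid[OF assms(1)] by blast
  then interpret F: interval_grid \<F> s a m .
  obtain s' a' m' where "interval_grid \<G> s' a' m'"
    using interval_sigma_algebra_grid[OF assms(2)] by blast
  then interpret G: interval_grid \<G> s' a' m' .
  have "\<exists>p::real poly. degree p < k \<and> (\<forall>x\<in>B. f x = poly p x)" if "B \<in> atoms \<G>" for B
  proof -
    obtain j where j: "j < m'" "B = a' j"
      using \<open>B \<in> atoms \<G>\<close> G.atoms_eq by auto
    moreover obtain w where "w \<in> B"
      using G.atom_nonempty[OF j(1)] j(2) by auto
    ultimately have "w \<in> {0..1}"
      using G.atom_subset_unit by blast
    then obtain i where "i < m" "w \<in> a i"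
      using F.atom_exists by blast
    then have "a i \<in> atoms \<F>" "B \<subseteq> a i"
      using atom_refinement[OF assms, of "a i" B] \<open>w \<in> B\<close> that F.atoms_eq by auto
    then show ?thesis
      using f unfolding spline_space_def by blast
  qed
  then show "f \<in> spline_space k \<G>"
    using f by (simp add: spline_space_def)
qed

section \<open>B-splines\<close>

context interval_grid
begin

lemma Inf_atom: "i < m \<Longrightarrow> Inf (a i) = s i"
proof (rule cInf_eq_non_empty[OF atom_nonempty])
  fix y assume i: "i < m" and y: "\<And>x. x \<in> a i \<Longrightarrow> y \<le> x"
  show "y \<le> s i"
  proof (rule dense_ge_bounded[OF s_step[OF i]])
    fix w assume "s i < w" "w < s (Suc i)"
    then show "y \<le> w"
      using open_subset_atom[OF i] y by auto
  qed
qed (auto dest: atom_bounds)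

lemma Sup_atom: "i < m \<Longrightarrow> Sup (a i) = s (Suc i)"
proof (rule cSup_eq_non_empty[OF atom_nonempty])
  fix y assume i: "i < m" and y: "\<And>x. x \<in> a i \<Longrightarrow> x \<le> y"
  show "s (Suc i) \<le> y"
  proof (rule dense_le_bounded[OF s_step[OF i]])
    fix w assume "s i < w" "w < s (Suc i)"
    then show "w \<le> y"
      using open_subset_atom[OF i] y by auto
  qed
qed (auto dest: atom_bounds)

lemma s_inj: "i \<le> m \<Longrightarrow> j \<le> m \<Longrightarrow> s i = s j \<Longrightarrow> i = j"
  using s_strict[of i j] s_strict[of j i] by (cases i j rule: linorder_cases) auto

lemma s_diff_sum:
  assumes "lo \<le> hi"
  shows "s hi - s lo = (\<Sum>q = lo..<hi. s (Suc q) - s q)"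
  using sum_Suc_diff'[of lo hi s] assms by simp

lemma locate_between:
  assumes "lo < hi" "hi \<le> m" "s lo \<le> z" "z \<le> s hi"
  shows "\<exists>q. lo \<le> q \<and> q < hi \<and> s q \<le> z \<and> z \<le> s (Suc q)"
  using assms
proof (induction hi)
  case (Suc hi)
  show ?case
  proof (cases "s hi \<le> z \<or> lo = hi")
    case True
    then show ?thesis
      using Suc.prems by (intro exI[of _ hi]) auto
  next
    case False
    then obtain q where "lo \<le> q \<and> q < hi \<and> s q \<le> z \<and> z \<le> s (Suc q)"
      using Suc.IH Suc.prems by fastforce
    then show ?thesis
      by (intro exI[of _ q]) auto
  qed
qed simp

end

locale spline_grid = interval_grid +
  fixes k :: nat
  assumes k_pos: "1 \<le> k"
begin

abbreviation t where "t \<equiv> knot k \<F>"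

abbreviation N where "N \<equiv> cox_de_boor \<F> (knot k \<F>)"

abbreviation M where "M \<equiv> m + (k - 1)"

lemma knot_eq: "t j = s (min (j - (k - 1)) m)"
  by (simp add: knot_def card_atoms breakpoints_eq nth_append del: upt_Suc)

lemma knot_mono: "i \<le> j \<Longrightarrow> t i \<le> t j"
  unfolding knot_eq by (rule s_mono) auto

text \<open>The first breakpoint 0 is a \<open>k\<close>-fold knot, which shifts all indices: the atom \<open>q\<close> lies
  between the knots \<open>q + (k - 1)\<close> and \<open>q + k\<close>.\<close>

lemma knot_shift: "q \<le> m \<Longrightarrow> t (q + (k - 1)) = s q"
  by (simp add: knot_eq)

lemma N_0:
  "N 0 i x = (if k - 1 \<le> i \<and> i < M then indicator (a (i - (k - 1))) x else 0)"
proof (cases "k - 1 \<le> i \<and> i < M")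
  case True
  define q where "q = i - (k - 1)"
  have q: "q < m" "t i = s q" "t (i + 1) = s (Suc q)"
    using True by (auto simp: q_def knot_eq min_def Suc_diff_le)
  have "{A \<in> atoms \<F>. Inf A = s q \<and> Sup A = s (Suc q)} = {a q}"
  proof (intro equalityI subsetI)
    fix A assume "A \<in> {A \<in> atoms \<F>. Inf A = s q \<and> Sup A = s (Suc q)}"
    then obtain j where "j < m" "A = a j" "s j = s q"
      by (auto simp: atoms_eq Inf_atom)
    then show "A \<in> {a q}"
      using s_inj[of j q] q by simp
  qed (use q in \<open>auto simp: atoms_eq Inf_atom Sup_atom\<close>)
  then show ?thesis
    using True q by (simp add: q_def cox_de_boor.simps(1))
next
  case False
  then have "min (i - (k - 1)) m = min (i + 1 - (k - 1)) m"
    by auto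
  then have "t i = t (i + 1)"
    by (simp only: knot_eq)
  then have "{A \<in> atoms \<F>. Inf A = t i \<and> Sup A = t (i + 1)} = {}"
    using s_step by (fastforce simp: atoms_eq Inf_atom Sup_atom)
  then show ?thesis
    using False by (simp only: cox_de_boor.simps) simp
qed

declare cox_de_boor.simps(1) [simp del]

lemma knot_le_atom:
  assumes "q < m" "x \<in> a q" "j \<le> q + (k - 1)"
  shows "t j \<le> x"
  using knot_mono[OF assms(3)] knot_shift[of q] atom_bounds[OF assms(1,2)] assms(1) by simp

lemma atom_le_knot:
  assumes "q < m" "x \<in> a q" "q + (k - 1) < j"
  shows "x \<le> t j"
  using knot_mono[of "Suc q + (k - 1)" j] knot_shift[of "Suc q"] atom_bounds[OF assms(1,2)] assms by simp

lemma knot_step: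
  assumes "q < m" "i \<le> q + (k - 1)" "q + (k - 1) < j"
  shows "t i < t j"
  using knot_mono[of i "q + (k - 1)"] knot_mono[of "Suc q + (k - 1)" j] knot_shift[of q]
    knot_shift[of "Suc q"] s_step[of q] assms by simp

lemma N_local:
  assumes "q < m" "x \<in> a q" "N d i x \<noteq> 0"
  shows "i \<le> q + (k - 1) \<and> q + (k - 1) \<le> i + d"
  using assms(3)
proof (induction d arbitrary: i)
  case 0
  then have i: "k - 1 \<le> i" "i < M" "x \<in> a (i - (k - 1))"
    by (auto simp: N_0 indicator_def split: if_splits)
  then have "i - (k - 1) = q"
    using atom_unique[of "i - (k - 1)" q x] assms by auto
  then show ?case
    using i by auto
next
  case (Suc d)
  then have "N d i x \<noteq> 0 \<or> N d (i + 1) x \<noteq> 0"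
    by auto
  then show ?case
    using Suc.IH[of i] Suc.IH[of "i + 1"] by auto
qed

lemma N_outside:
  assumes "x \<notin> {0..1}"
  shows "N d i x = 0"
proof (induction d arbitrary: i)
  case 0
  show ?case
  proof (cases "k - 1 \<le> i \<and> i < M")
    case True
    then have "i - (k - 1) < m"
      by linarith
    then have "x \<notin> a (i - (k - 1))"
      using assms atom_subset_unit by blast
    then show ?thesis
      by (simp add: N_0)
  qed (auto simp: N_0)
qed simp

lemma N_nonneg: "0 \<le> N d i x"
proof (cases "x \<in> {0..1}")
  case True
  then obtain q where q: "q < m" "x \<in> a q"
    using atom_exists by blast
  show ?thesis
  proof (induction d arbitrary: i)
    case (Suc d)
    have "0 \<le> (x - t i) / (t (i + d + 1) - t i) * N d i x"
    proof (cases "N d i x = 0")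
      case False
      then show ?thesis
        using knot_le_atom[OF q, of i] N_local[OF q] knot_mono[of i "i + d + 1"] Suc[of i] by auto
    qed simp
    moreover have "0 \<le> (t (i + d + 2) - x) / (t (i + d + 2) - t (i + 1)) * N d (i + 1) x"
    proof (cases "N d (i + 1) x = 0")
      case False
      then have "q + (k - 1) < i + d + 2"
        using N_local[OF q, of d "i + 1"] by auto
      then show ?thesis
        using atom_le_knot[OF q, of "i + d + 2"] knot_mono[of "i + 1" "i + d + 2"] Suc[of "i + 1"]
        by (intro mult_nonneg_nonneg divide_nonneg_nonneg) auto
    qed simp
    ultimately show ?case
      by simp
  qed (simp add: N_0)
qed (simp add: N_outside)

lemma N_pos:
  assumes q: "q < m" and x: "s q < x" "x < s (Suc q)"
    and i: "i \<le> q + (k - 1)" "q + (k - 1) \<le> i + d"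
  shows "0 < N d i x"
  using i
proof (induction d arbitrary: i)
  case 0
  then have "i = q + (k - 1)"
    by simp
  moreover have "x \<in> a q"
    using x open_subset_atom[OF q] by auto
  ultimately show ?case
    using q by (simp add: N_0)
next
  case (Suc d)
  have xq: "x \<in> a q"
    using x open_subset_atom[OF q] by auto
  have nonneg: "0 \<le> (x - t i) / (t (i + d + 1) - t i) * N d i x"
  proof -
    have "t i \<le> x" "t i \<le> t (i + d + 1)"
      using knot_le_atom[OF q xq] Suc.prems knot_mono by auto
    then show ?thesis
      by (simp add: N_nonneg)
  qed
  have nonneg': "0 \<le> (t (i + d + 2) - x) / (t (i + d + 2) - t (i + 1)) * N d (i + 1) x"
  proof -
    have "x \<le> t (i + d + 2)" "t (i + 1) \<le> t (i + d + 2)"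
      using atom_le_knot[OF q xq, of "i + d + 2"] Suc.prems by (auto intro: knot_mono)
    then show ?thesis
      by (intro mult_nonneg_nonneg divide_nonneg_nonneg N_nonneg) auto
  qed
  show ?case
  proof (cases "q + (k - 1) \<le> i + d")
    case True
    have "t i < x"
      using knot_mono[OF Suc.prems(1)] knot_shift[of q] q x by simp
    moreover have "t i < t (i + d + 1)"
      using knot_step[OF q, of i "i + d + 1"] Suc.prems True by simp
    ultimately have "0 < (x - t i) / (t (i + d + 1) - t i) * N d i x"
      using Suc.IH[of i] Suc.prems True by simp
    then show ?thesis
      using nonneg' by simp
  next
    case False
    then have eq: "q + (k - 1) = i + d + 1"
      using Suc.prems by simp
    have "t (i + d + 2) = s (Suc q)"
      using knot_shift[of "Suc q"] q eq by simp
    moreover have "t (i + 1) < t (i + d + 2)"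
      using knot_step[OF q, of "i + 1" "i + d + 2"] eq by simp
    ultimately have "0 < (t (i + d + 2) - x) / (t (i + d + 2) - t (i + 1)) * N d (i + 1) x"
      using Suc.IH[of "i + 1"] eq x by simp
    then show ?thesis
      using nonneg by simp
  qed
qed

text \<open>Summation by parts in the Cox--de Boor recursion: each B-spline of lower order receives
  contributions from two neighbours. The two boundary terms vanish, since on the atom \<open>q\<close> the
  lower-order B-splines number 0 and \<open>M\<close> are zero.\<close>

lemma sum_N_Suc:
  assumes q: "q < m" "x \<in> a q" and d: "Suc d \<le> k - 1"
  shows "(\<Sum>i<M. c i * N (Suc d) i x)
    = (\<Sum>i<M. ((x - t i) * c i + (t (i + d + 1) - x) * c (i - 1)) / (t (i + d + 1) - t i) * N d i x)"
proof -
  define g where "g = (\<lambda>i. c (i - 1) * ((t (i + d + 1) - x) / (t (i + d + 1) - t i) * N d i x))"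
  have "N d 0 x = 0"
  proof (rule ccontr)
    assume "N d 0 x \<noteq> 0"
    then have "q + (k - 1) \<le> d"
      using N_local[OF q, of d 0] by simp
    then show False
      using d by linarith
  qed
  moreover have "N d M x = 0"
  proof (rule ccontr)
    assume "N d M x \<noteq> 0"
    then have "M \<le> q + (k - 1)"
      using N_local[OF q, of d M] by simp
    then show False
      using q by linarith
  qed
  ultimately have "g 0 = 0" "g M = 0"
    by (auto simp: g_def)
  then have shift: "(\<Sum>i<M. g (Suc i)) = (\<Sum>i<M. g i)"
    using sum.lessThan_Suc_shift[of g M] sum.lessThan_Suc[of g M] by linarith
  have "(\<Sum>i<M. c i * N (Suc d) i x)
      = (\<Sum>i<M. c i * ((x - t i) / (t (i + d + 1) - t i) * N d i x) + g (Suc i))"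
    by (simp add: g_def algebra_simps)
  also have "\<dots> = (\<Sum>i<M. c i * ((x - t i) / (t (i + d + 1) - t i) * N d i x) + g i)"
    by (simp only: sum.distrib shift)
  also have "\<dots> = (\<Sum>i<M. ((x - t i) * c i + (t (i + d + 1) - x) * c (i - 1)) / (t (i + d + 1) - t i) * N d i x)"
    by (rule sum.cong[OF refl]) (simp add: g_def add_divide_distrib diff_divide_distrib algebra_simps)
  finally show ?thesis .
qed

lemma active_knots_less:
  assumes "q < m" "x \<in> a q" "N d i x \<noteq> 0"
  shows "t i < t (i + d + 1)"
  using N_local[OF assms] by (intro knot_step[OF assms(1)]) auto

lemma partition_of_unity:
  assumes q: "q < m" "x \<in> a q" and "d \<le> k - 1"
  shows "(\<Sum>i<M. N d i x) = 1"
  using assms(3)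
proof (induction d)
  case 0
  have "(\<Sum>i<M. N 0 i x) = (\<Sum>i<M. if i = q + (k - 1) then 1 else 0)"
  proof (rule sum.cong[OF refl])
    fix i assume "i \<in> {..<M}"
    show "N 0 i x = (if i = q + (k - 1) then 1 else 0)"
    proof (cases "i = q + (k - 1)")
      case False
      then have "N 0 i x = 0"
        using N_local[OF q, of 0 i] by linarith
      then show ?thesis
        using False by simp
    qed (use q in \<open>simp add: N_0\<close>)
  qed
  then show ?case
    using q by simp
next
  case (Suc d)
  have "(\<Sum>i<M. N (Suc d) i x) = (\<Sum>i<M. 1 * N (Suc d) i x)"
    by simp
  also have "\<dots> = (\<Sum>i<M. N d i x)"
    unfolding sum_N_Suc[OF q Suc.prems]
  proof (rule sum.cong[OF refl])
    fix i
    show "((x - t i) * 1 + (t (i + d + 1) - x) * 1) / (t (i + d + 1) - t i) * N d i x = N d i x"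
      using active_knots_less[OF q, of d i] by (cases "N d i x = 0") auto
  qed
  finally show ?case
    using Suc by simp
qed

text \<open>In the induction step the coefficients that meet at one B-spline of lower order are the
  common product times \<open>t (i + d + 1) - \<tau>\<close> and \<open>t i - \<tau>\<close>; the weights of the recursion interpolate
  linearly between these two numbers and yield \<open>x - \<tau>\<close>.\<close>

lemma marsden_identity:
  assumes q: "q < m" "x \<in> a q" and "d \<le> k - 1"
  shows "(\<Sum>i<M. (\<Prod>r<d. t (i + 1 + r) - \<tau>) * N d i x) = (x - \<tau>) ^ d"
  using assms(3)
proof (induction d)
  case 0
  then show ?case
    using partition_of_unity[OF q] by simp
next
  case (Suc d)
  define c where "c = (\<lambda>i. \<Prod>r<Suc d. t (i + 1 + r) - \<tau>)"
  have "(\<Sum>i<M. c i * N (Suc d) i x)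
      = (\<Sum>i<M. (x - \<tau>) * ((\<Prod>r<d. t (i + 1 + r) - \<tau>) * N d i x))"
    unfolding sum_N_Suc[OF q Suc.prems]
  proof (rule sum.cong[OF refl])
    fix i
    define P where "P = (\<Prod>r<d. t (i + 1 + r) - \<tau>)"
    show "((x - t i) * c i + (t (i + d + 1) - x) * c (i - 1)) / (t (i + d + 1) - t i) * N d i x
        = (x - \<tau>) * ((\<Prod>r<d. t (i + 1 + r) - \<tau>) * N d i x)"
    proof (cases "N d i x = 0")
      case False
      have less: "t i < t (i + d + 1)"
        by (rule active_knots_less[OF q False])
      have "i \<noteq> 0"
        using N_local[OF q False] Suc.prems by auto
      then have "c (i - 1) = (\<Prod>r<Suc d. t (i + r) - \<tau>)"
        unfolding c_def by (intro prod.cong) auto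
      also have "\<dots> = (t i - \<tau>) * P"
        unfolding P_def prod.lessThan_Suc_shift by (simp add: mult.commute)
      finally have c1: "c (i - 1) = (t i - \<tau>) * P" .
      have c0: "c i = (t (i + d + 1) - \<tau>) * P"
        by (simp add: c_def P_def mult.commute)
      have "(x - t i) * c i + (t (i + d + 1) - x) * c (i - 1) = (x - \<tau>) * P * (t (i + d + 1) - t i)"
        unfolding c0 c1 by (simp add: algebra_simps)
      then show ?thesis
        using less by (simp add: P_def)
    qed simp
  qed
  also have "\<dots> = (x - \<tau>) * (x - \<tau>) ^ d"
    unfolding sum_distrib_left[symmetric] using Suc by simp
  finally show ?case
    by (simp add: c_def)
qed

text \<open>Marsden's identity is the case of powers, where polar forms are products; linearity gives
  the rest.\<close>

lemma polar_reproduction: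
  assumes q: "q < m" "x \<in> a q" and deg: "degree p \<le> k - 1"
  shows "(\<Sum>i<M. polar (k - 1) (\<lambda>r. t (i + 1 + r)) p * N (k - 1) i x) = poly p x"
proof (rule linear_functionals_eq_on_powers[OF _ _ _ _ _ deg])
  fix \<tau>
  show "(\<Sum>i<M. polar (k - 1) (\<lambda>r. t (i + 1 + r)) ([:-\<tau>, 1:] ^ (k - 1)) * N (k - 1) i x)
      = poly ([:-\<tau>, 1:] ^ (k - 1)) x"
    using marsden_identity[OF q, of "k - 1" \<tau>] by (simp add: polar_power)
qed (simp_all add: polar_add polar_smult sum.distrib sum_distrib_left algebra_simps)

lemma num_bsplines_eq: "num_bsplines k \<F> = M"
  using k_pos by (simp add: num_bsplines_def card_atoms)

text \<open>A B-spline is strictly positive inside every atom between its first and its last knot.\<close>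

lemma bspline_support_eq:
  assumes "i < M"
  shows "bspline_support k \<F> i = {t i..t (i + k)}"
  unfolding bspline_support_def bspline_def
proof
  show "closure {x. N (k - 1) i x \<noteq> 0} \<subseteq> {t i..t (i + k)}"
  proof (rule closure_minimal)
    show "{x. N (k - 1) i x \<noteq> 0} \<subseteq> {t i..t (i + k)}"
    proof
      fix x assume "x \<in> {x. N (k - 1) i x \<noteq> 0}"
      then have nz: "N (k - 1) i x \<noteq> 0" by simp
      then obtain q where q: "q < m" "x \<in> a q"
        using N_outside atom_exists by blast
      show "x \<in> {t i..t (i + k)}"
        using N_local[OF q nz] knot_le_atom[OF q, of i] atom_le_knot[OF q, of "i + k"] k_pos by auto
    qed
  qed simp
  show "{t i..t (i + k)} \<subseteq> closure {x. N (k - 1) i x \<noteq> 0}"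
  proof
    fix z assume z: "z \<in> {t i..t (i + k)}"
    have lo: "t i = s (i - (k - 1))" "i - (k - 1) < m"
      using assms m_pos by (auto simp: knot_eq min_def)
    have hi: "t (i + k) = s (min (i + 1) m)"
      using k_pos by (simp add: knot_eq)
    have "i - (k - 1) < min (i + 1) m"
      using lo by auto
    then obtain q where q: "i - (k - 1) \<le> q" "q < min (i + 1) m" "s q \<le> z" "z \<le> s (Suc q)"
      using locate_between[of "i - (k - 1)" "min (i + 1) m" z] z lo hi by auto
    have "q < m"
      using q by simp
    have "{s q<..<s (Suc q)} \<subseteq> {x. N (k - 1) i x \<noteq> 0}"
      using N_pos[OF \<open>q < m\<close>, of _ i "k - 1"] q by fastforce
    then have "closure {s q<..<s (Suc q)} \<subseteq> closure {x. N (k - 1) i x \<noteq> 0}"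
      by (rule closure_mono)
    then show "z \<in> closure {x. N (k - 1) i x \<noteq> 0}"
      using q s_step[OF \<open>q < m\<close>] by (auto simp: closure_greaterThanLessThan)
  qed
qed

definition support_length :: "nat \<Rightarrow> real" where
  "support_length i = t (i + k) - t i"

lemma support_length_pos: "i < M \<Longrightarrow> 0 < support_length i"
  using knot_step[of "i - (k - 1)" i "i + k"] k_pos m_pos by (auto simp: support_length_def)

lemma measure_support: "i < M \<Longrightarrow> measure lborel (bspline_support k \<F> i) = support_length i"
  using knot_mono[of i "i + k"] by (simp add: bspline_support_eq support_length_def)

lemma regularity_eq:
  "regularity k \<F> = (if M \<le> 1 then 1
    else Max ((\<lambda>i. max (support_length i / support_length (i + 1))
                         (support_length (i + 1) / support_length i)) ` {i. i + 1 < M}))"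
proof -
  have "{i. i + 1 < M} = {} \<longleftrightarrow> M \<le> 1"
  proof
    assume "{i. i + 1 < M} = {}"
    then have "\<not> 0 + 1 < M"
      by blast
    then show "M \<le> 1"
      by simp
  qed auto
  then show ?thesis
    unfolding regularity_def num_bsplines_eq Let_def
    by (auto intro!: arg_cong[where f = Max] image_cong simp: measure_support)
qed

lemma regularity_max:
  assumes "i + 1 < M"
  shows "max (support_length i / support_length (i + 1)) (support_length (i + 1) / support_length i)
    \<le> regularity k \<F>"
proof -
  have "finite {i. i + 1 < M}"
    by (rule finite_subset[of _ "{..<M}"]) auto
  moreover have "\<not> M \<le> 1"
    using assms by simp
  ultimately show ?thesis
    unfolding regularity_eq using assms by (simp only: if_False) (intro Max_ge finite_imageI imageI CollectI)
qed

lemma regularity_ge_1: "1 \<le> regularity k \<F>"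
proof (cases "M \<le> 1")
  case True
  then show ?thesis
    by (simp add: regularity_eq)
next
  case False
  then have pos: "0 < support_length 0" "0 < support_length (0 + 1)"
    by (auto intro: support_length_pos)
  have "1 \<le> max (support_length 0 / support_length (0 + 1)) (support_length (0 + 1) / support_length 0)"
    using pos by (auto simp: le_max_iff_disj field_simps)
  then show ?thesis
    using regularity_max[of 0] False by linarith
qed

lemma support_length_comparable:
  assumes reg: "regularity k \<F> \<le> \<Gamma>" and "i < M" "j < M" "i \<le> j + n" "j \<le> i + n"
  shows "support_length i \<le> \<Gamma> ^ n * support_length j"
proof -
  have "1 \<le> \<Gamma>"
    using regularity_ge_1 reg by simp
  have step: "support_length i \<le> \<Gamma> * support_length (i + 1)" "support_length (i + 1) \<le> \<Gamma> * support_length i"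
    if "i + 1 < M" for i
  proof -
    have "support_length i / support_length (i + 1) \<le> \<Gamma>" "support_length (i + 1) / support_length i \<le> \<Gamma>"
      using regularity_max[OF that] reg by auto
    moreover have "0 < support_length i" "0 < support_length (i + 1)"
      using support_length_pos that by auto
    ultimately show "support_length i \<le> \<Gamma> * support_length (i + 1)" "support_length (i + 1) \<le> \<Gamma> * support_length i"
      by (simp_all add: divide_le_eq)
  qed
  have chain: "support_length i \<le> \<Gamma> ^ n * support_length (i + n) \<and> support_length (i + n) \<le> \<Gamma> ^ n * support_length i"
    if "i + n < M" for i n
    using that
  proof (induction n)
    case (Suc n)
    have IH: "support_length i \<le> \<Gamma> ^ n * support_length (i + n)" "support_length (i + n) \<le> \<Gamma> ^ n * support_length i"
      using Suc by auto
    have st: "support_length (i + n) \<le> \<Gamma> * support_length (i + Suc n)" "support_length (i + Suc n) \<le> \<Gamma> * support_length (i + n)"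
      using step[of "i + n"] Suc.prems by auto
    have "support_length i \<le> \<Gamma> ^ n * (\<Gamma> * support_length (i + Suc n))"
      using IH(1) st(1) \<open>1 \<le> \<Gamma>\<close> by (meson mult_left_mono order_trans zero_le_power zero_le_one)
    moreover have "support_length (i + Suc n) \<le> \<Gamma> * (\<Gamma> ^ n * support_length i)"
      using IH(2) st(2) \<open>1 \<le> \<Gamma>\<close> by (meson mult_left_mono order_trans zero_le_one)
    ultimately show ?case
      by (simp add: mult_ac)
  qed simp
  define l where "l = (if i \<le> j then j - i else i - j)"
  have "support_length i \<le> \<Gamma> ^ l * support_length j"
    using chain[of i "j - i"] chain[of j "i - j"] assms by (auto simp: l_def)
  also have "\<dots> \<le> \<Gamma> ^ n * support_length j"
    using \<open>1 \<le> \<Gamma>\<close> assms less_imp_le[OF support_length_pos[of j]]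
    by (intro mult_right_mono power_increasing) (auto simp: l_def)
  finally show ?thesis .
qed

lemma atom_le_support:
  assumes "q < m" "i \<le> q + (k - 1)" "q \<le> i"
  shows "{s q..s (Suc q)} \<subseteq> {t i..t (i + k)}"
  using knot_mono[of i "q + (k - 1)"] knot_mono[of "Suc q + (k - 1)" "i + k"] knot_shift[of q]
    knot_shift[of "Suc q"] assms k_pos by auto

text \<open>A support consists of at most \<open>k\<close> atoms.\<close>

lemma large_atom_in_support:
  assumes "i < M"
  shows "\<exists>q<m. q \<le> i \<and> i \<le> q + (k - 1) \<and> support_length i \<le> real k * (s (Suc q) - s q)"
proof (rule ccontr)
  assume neg: "\<not> ?thesis"
  define lo where "lo = i - (k - 1)"
  define hi where "hi = min (i + 1) m"
  have lo: "t i = s lo" "lo < m" and hi: "t (i + k) = s hi" "lo < hi"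
    using assms m_pos k_pos by (auto simp: knot_eq min_def lo_def hi_def)
  have "hi \<le> i + 1" "i \<le> lo + (k - 1)"
    by (auto simp: lo_def hi_def)
  then have "real (hi - lo) \<le> real k"
    using k_pos by linarith
  have "(\<Sum>q = lo..<hi. s (Suc q) - s q) < (\<Sum>q = lo..<hi. support_length i / real k)"
  proof (rule sum_strict_mono)
    fix q assume "q \<in> {lo..<hi}"
    then have "q < m" "q \<le> i" "i \<le> q + (k - 1)"
      by (auto simp: lo_def hi_def)
    then have "\<not> support_length i \<le> real k * (s (Suc q) - s q)"
      using neg by blast
    then show "s (Suc q) - s q < support_length i / real k"
      using k_pos by (simp add: field_simps)
  qed (use hi in auto)
  also have "\<dots> = real (hi - lo) * (support_length i / real k)"
    by simp
  also have "\<dots> \<le> real k * (support_length i / real k)"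
    using support_length_pos[OF assms] \<open>real (hi - lo) \<le> real k\<close> by (intro mult_right_mono) auto
  also have "\<dots> = support_length i"
    using k_pos by simp
  finally have "s hi - s lo < support_length i"
    using s_diff_sum[of lo hi] hi by simp
  then show False
    using lo hi by (simp add: support_length_def)
qed

text \<open>The regularity parameter does not control the ratio of adjacent atoms. But each atom is
  contained in a support, and supports with nearby indices have comparable lengths.\<close>

lemma window_le_support:
  assumes reg: "regularity k \<F> \<le> \<Gamma>" and j: "j < m" and i: "j \<le> i" "i \<le> j + (k - 1)"
  shows "s (min (j + W + 1) m) - s (j - W) \<le> real (2 * W + 1) * \<Gamma> ^ (W + k) * support_length i"
proof -
  define lo where "lo = j - W"
  define hi where "hi = min (j + W + 1) m"
  have "lo \<le> hi" "hi \<le> m" "i < M"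
    using assms by (auto simp: lo_def hi_def)
  have "1 \<le> \<Gamma>"
    using regularity_ge_1 reg by simp
  have "s hi - s lo = (\<Sum>q = lo..<hi. s (Suc q) - s q)"
    by (rule s_diff_sum) fact
  also have "\<dots> \<le> (\<Sum>q = lo..<hi. \<Gamma> ^ (W + k) * support_length i)"
  proof (rule sum_mono)
    fix q assume q: "q \<in> {lo..<hi}"
    then have qm: "q < m"
      using \<open>hi \<le> m\<close> by simp
    have "s (Suc q) - s q \<le> support_length (q + (k - 1))"
      using atom_le_support[OF qm, of "q + (k - 1)"] s_step[OF qm] by (auto simp: support_length_def)
    also have "\<dots> \<le> \<Gamma> ^ (W + k) * support_length i"
      using q qm i by (intro support_length_comparable[OF reg _ \<open>i < M\<close>]) (auto simp: lo_def hi_def)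
    finally show "s (Suc q) - s q \<le> \<Gamma> ^ (W + k) * support_length i" .
  qed
  also have "\<dots> = real (hi - lo) * (\<Gamma> ^ (W + k) * support_length i)"
    by simp
  also have "\<dots> \<le> real (2 * W + 1) * (\<Gamma> ^ (W + k) * support_length i)"
    using support_length_pos[OF \<open>i < M\<close>] \<open>1 \<le> \<Gamma>\<close>
    by (intro mult_right_mono) (auto simp: lo_def hi_def)
  finally show ?thesis
    by (simp add: lo_def hi_def mult.assoc)
qed

end

section \<open>Local lower bounds for square functions of splines\<close>

lemma power_dvd_if_derivatives_vanish:
  fixes r :: "real poly"
  assumes "\<And>j. j < n \<Longrightarrow> poly ((pderiv ^^ j) r) \<tau> = 0"
  shows "[:-\<tau>, 1:] ^ n dvd r"
  using assms
proof (induction n arbitrary: r)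
  case (Suc n)
  show ?case
  proof (cases "r = 0")
    case False
    have root: "poly r \<tau> = 0"
      using Suc.prems[of 0] by simp
    have "poly ((pderiv ^^ j) (pderiv r)) \<tau> = 0" if "j < n" for j
      using Suc.prems[of "Suc j"] that by (simp add: funpow_swap1)
    then have "[:-\<tau>, 1:] ^ n dvd pderiv r"
      by (rule Suc.IH)
    moreover have "pderiv r \<noteq> 0"
    proof
      assume "pderiv r = 0"
      then obtain c where "r = [:c:]"
        by (auto simp: pderiv_eq_0_iff elim: degree_eq_zeroE)
      then show False
        using root False by simp
    qed
    ultimately have "n \<le> order \<tau> (pderiv r)"
      by (simp add: order_divides)
    then have "Suc n \<le> order \<tau> r"
      using order_pderiv[OF False root] by simp
    then show ?thesis
      using order_divides by blast
  qed simp
qed simp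

text \<open>At the endpoints the values of \<open>f\<close> may follow a neighbouring piece, so there the
  derivatives are identified with those of \<open>p\<close> by continuity.\<close>

lemma derivatives_on_polynomial_piece:
  assumes "l < r" and sub: "{l..r} \<subseteq> {0..1::real}"
    and D0: "\<And>x. x \<in> {0..1} \<Longrightarrow> D 0 x = f x"
    and D: "\<And>j x. j < n \<Longrightarrow> x \<in> {0..1} \<Longrightarrow> (D j has_real_derivative D (Suc j) x) (at x within {0..1})"
    and cont: "\<And>j. j \<le> n \<Longrightarrow> continuous_on {0..1} (D j)"
    and f: "\<And>x. x \<in> {l<..<r} \<Longrightarrow> f x = poly p x"
    and "j \<le> n"
  shows "\<forall>x\<in>{l..r}. D j x = poly ((pderiv ^^ j) p) x"
proof -
  have extend: "\<forall>x\<in>{l..r}. D j x = poly ((pderiv ^^ j) p) x"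
    if eq: "\<And>x. x \<in> {l<..<r} \<Longrightarrow> D j x = poly ((pderiv ^^ j) p) x" and "j \<le> n" for j
  proof -
    have cl: "closure {l<..<r} = {l..r}"
      using \<open>l < r\<close> by (rule closure_greaterThanLessThan)
    have "D j x - poly ((pderiv ^^ j) p) x = 0" if "x \<in> closure {l<..<r}" for x
    proof (rule continuous_constant_on_closure[OF _ _ that])
      show "continuous_on (closure {l<..<r}) (\<lambda>x. D j x - poly ((pderiv ^^ j) p) x)"
        unfolding cl
        by (intro continuous_intros continuous_on_subset[OF cont[OF \<open>j \<le> n\<close>] sub])
    qed (use eq in auto)
    then show ?thesis
      by (simp add: cl)
  qed
  show ?thesis
    using \<open>j \<le> n\<close>
  proof (induction j)
    case 0
    have sub': "x \<in> {0..1}" if "x \<in> {l<..<r}" for x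
      using sub that by auto
    show ?case
      by (rule extend) (auto simp: D0[OF sub'] f)
  next
    case (Suc j)
    show ?case
    proof (rule extend[OF _ Suc.prems])
      fix x assume x: "x \<in> {l<..<r}"
      have sub': "{l<..<r} \<subseteq> {0..1}"
        using sub by auto
      have "(D j has_real_derivative D (Suc j) x) (at x within {l<..<r})"
      proof (rule DERIV_subset[OF D sub'])
        show "j < n" "x \<in> {0..1}"
          using Suc.prems x sub' by auto
      qed
      then have "(D j has_real_derivative D (Suc j) x) (at x)"
        using x by (simp add: at_within_open[OF _ open_greaterThanLessThan])
      moreover have "(D j has_real_derivative poly (pderiv ((pderiv ^^ j) p)) x) (at x)"
      proof (rule DERIV_cong_ev[THEN iffD2])
        show "\<forall>\<^sub>F y in nhds x. D j y = poly ((pderiv ^^ j) p) y"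
          using eventually_nhds_in_open[OF open_greaterThanLessThan x]
          by eventually_elim (use Suc in auto)
      qed (auto intro: poly_DERIV)
      ultimately show "D (Suc j) x = poly ((pderiv ^^ Suc j) p) x"
        by (simp add: DERIV_unique)
    qed
  qed
qed

text \<open>The variance of \<open>v\<close> under the weights \<open>w\<close> is non-negative.\<close>

lemma weighted_square_le:
  fixes w v :: "'a \<Rightarrow> real"
  assumes "\<And>i. i \<in> I \<Longrightarrow> 0 \<le> w i" "(\<Sum>i\<in>I. w i) = 1"
  shows "(\<Sum>i\<in>I. v i * w i)\<^sup>2 \<le> (\<Sum>i\<in>I. (v i)\<^sup>2 * w i)"
proof -
  define \<mu> where "\<mu> = (\<Sum>i\<in>I. v i * w i)"
  have "0 \<le> (\<Sum>i\<in>I. (v i - \<mu>)\<^sup>2 * w i)"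
    using assms(1) by (intro sum_nonneg) auto
  also have "\<dots> = (\<Sum>i\<in>I. (v i)\<^sup>2 * w i - 2 * \<mu> * (v i * w i) + \<mu>\<^sup>2 * w i)"
    by (rule sum.cong[OF refl]) (simp add: power2_eq_square algebra_simps)
  also have "\<dots> = (\<Sum>i\<in>I. (v i)\<^sup>2 * w i) - 2 * \<mu> * \<mu> + \<mu>\<^sup>2"
    by (simp only: sum.distrib sum_subtractf sum_distrib_left[symmetric] \<mu>_def[symmetric] assms(2) mult_1_right)
  finally show ?thesis
    by (simp add: \<mu>_def power2_eq_square)
qed

context spline_grid
begin

definition piece :: "(real \<Rightarrow> real) \<Rightarrow> nat \<Rightarrow> real poly" where
  "piece f q = (SOME p. degree p \<le> k - 1 \<and> (\<forall>x\<in>a q. f x = poly p x))"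

lemma piece:
  assumes "f \<in> spline_space k \<F>" "q < m"
  shows "degree (piece f q) \<le> k - 1" "x \<in> a q \<Longrightarrow> f x = poly (piece f q) x"
proof -
  have "a q \<in> atoms \<F>"
    using assms(2) by (simp add: atoms_eq)
  then have "\<exists>p::real poly. degree p < k \<and> (\<forall>x\<in>a q. f x = poly p x)"
    using assms(1) unfolding spline_space_def by blast
  then have "\<exists>p::real poly. degree p \<le> k - 1 \<and> (\<forall>x\<in>a q. f x = poly p x)"
    by (metis less_Suc_eq_le Suc_pred' k_pos less_eq_Suc_le One_nat_def)
  then have *: "degree (piece f q) \<le> k - 1 \<and> (\<forall>x\<in>a q. f x = poly (piece f q) x)"
    unfolding piece_def by (rule someI_ex)
  then show "degree (piece f q) \<le> k - 1" "x \<in> a q \<Longrightarrow> f x = poly (piece f q) x"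
    by auto
qed

text \<open>At their common breakpoint the two pieces have the same derivatives up to order \<open>k - 2\<close>,
  so their difference has a zero of order \<open>k - 1\<close>; by its degree it can have no other factor.\<close>

lemma adjacent_pieces:
  assumes f: "f \<in> spline_space k \<F>" and q: "Suc q < m"
  shows "\<exists>c. piece f (Suc q) = piece f q + smult c ([:- s (Suc q), 1:] ^ (k - 1))"
proof -
  define \<tau> where "\<tau> = s (Suc q)"
  define r where "r = piece f (Suc q) - piece f q"
  have "[:-\<tau>, 1:] ^ (k - 1) dvd r"
  proof (cases "k \<ge> 2")
    case True
    then have "C_on (k - 2) {0..1} f"
      using f by (simp add: spline_space_def)
    then obtain D where D0: "\<And>x. x \<in> {0..1} \<Longrightarrow> D 0 x = f x"
      and D: "\<And>j x. j < k - 2 \<Longrightarrow> x \<in> {0..1} \<Longrightarrow> (D j has_real_derivative D (Suc j) x) (at x within {0..1})"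
      and cont: "\<And>j. j \<le> k - 2 \<Longrightarrow> continuous_on {0..1} (D j)"
      unfolding C_on_def by blast
    have eq: "D j x = poly ((pderiv ^^ j) (piece f i)) x"
      if "i < m" "j \<le> k - 2" "x \<in> {s i..s (Suc i)}" for i j x
    proof -
      have "{s i..s (Suc i)} \<subseteq> {0..1}"
        using s_range[of i] s_range[of "Suc i"] that by auto
      moreover have "f x = poly (piece f i) x" if "x \<in> {s i<..<s (Suc i)}" for x
        using piece(2)[OF f \<open>i < m\<close>] open_subset_atom[OF \<open>i < m\<close>] that by blast
      ultimately show ?thesis
        using derivatives_on_polynomial_piece[OF s_step[OF \<open>i < m\<close>] _ D0 D cont, where p = "piece f i" and j = j] that
        by blast
    qed
    show ?thesis
    proof (rule power_dvd_if_derivatives_vanish)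
      fix j assume "j < k - 1"
      then have j: "j \<le> k - 2"
        by simp
      have "(pderiv ^^ j) r = (pderiv ^^ j) (piece f (Suc q)) - (pderiv ^^ j) (piece f q)"
        unfolding r_def by (induction j) (simp_all add: pderiv_diff)
      moreover have "poly ((pderiv ^^ j) (piece f (Suc q))) \<tau> = D j \<tau>"
        using eq[of "Suc q" j \<tau>] q j s_step[OF q] by (simp add: \<tau>_def)
      moreover have "poly ((pderiv ^^ j) (piece f q)) \<tau> = D j \<tau>"
        using eq[of q j \<tau>] q j s_step[of q] by (simp add: \<tau>_def)
      ultimately show "poly ((pderiv ^^ j) r) \<tau> = 0"
        by simp
    qed
  qed simp
  then obtain h where h: "r = [:-\<tau>, 1:] ^ (k - 1) * h"
    by (elim dvdE)
  have "degree r \<le> k - 1"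
    unfolding r_def using piece(1)[OF f] q by (intro degree_diff_le) auto
  have "degree h = 0"
  proof (cases "h = 0")
    case False
    then have "degree r = k - 1 + degree h"
      by (simp add: h degree_mult_eq degree_linear_power)
    then show ?thesis
      using \<open>degree r \<le> k - 1\<close> by simp
  qed simp
  then obtain c where "h = [:c:]"
    by (elim degree_eq_zeroE)
  then have "piece f (Suc q) = piece f q + smult c ([:-\<tau>, 1:] ^ (k - 1))"
    using h by (simp add: r_def algebra_simps)
  then show ?thesis
    unfolding \<tau>_def by blast
qed

text \<open>The coefficient of the B-spline \<open>i\<close> in a spline, read off from one polynomial piece.\<close>

definition spline_coeff :: "nat \<Rightarrow> real poly \<Rightarrow> real" where
  "spline_coeff i = polar (k - 1) (\<lambda>r. t (i + 1 + r))"

text \<open>The pieces differ by a multiple of \<open>(x - s (Suc q)) ^ (k - 1)\<close>. The breakpoint \<open>s (Suc q)\<close> is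
  an interior knot of the B-spline \<open>i\<close>, so one factor of the polar form of this power vanishes.\<close>

lemma spline_coeff_step:
  assumes f: "f \<in> spline_space k \<F>" and q: "Suc q < m" and i: "Suc q \<le> i" "i \<le> q + (k - 1)"
  shows "spline_coeff i (piece f (Suc q)) = spline_coeff i (piece f q)"
proof -
  obtain c where c: "piece f (Suc q) = piece f q + smult c ([:- s (Suc q), 1:] ^ (k - 1))"
    using adjacent_pieces[OF f q] by blast
  define r where "r = q + (k - 1) - i"
  have "t (i + 1 + r) = s (Suc q)"
    using knot_shift[of "Suc q"] q i by (simp add: r_def)
  moreover have "r < k - 1"
    using i by (simp add: r_def)
  ultimately have "(\<Prod>r<k - 1. t (i + 1 + r) - s (Suc q)) = 0"
    by (intro prod_zero) auto
  then show ?thesis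
    unfolding c spline_coeff_def polar_add polar_smult polar_power by simp
qed

lemma spline_coeff_indep:
  assumes f: "f \<in> spline_space k \<F>" and "q < m" "q' < m"
    and i: "q \<le> i" "i \<le> q + (k - 1)" "q' \<le> i" "i \<le> q' + (k - 1)"
  shows "spline_coeff i (piece f q) = spline_coeff i (piece f q')"
proof -
  have up: "spline_coeff i (piece f (q + n)) = spline_coeff i (piece f q)"
    if "q + n < m" "q + n \<le> i" "i \<le> q + (k - 1)" for q n
    using that
  proof (induction n)
    case (Suc n)
    have "spline_coeff i (piece f (Suc (q + n))) = spline_coeff i (piece f (q + n))"
      by (rule spline_coeff_step[OF f]) (use Suc.prems in auto)
    then show ?case
      using Suc by simp
  qed simp
  show ?thesis
    using up[of q "q' - q"] up[of q' "q - q'"] assms by (cases "q \<le> q'") auto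
qed

text \<open>On the atom \<open>j\<close> each \<open>f l\<close> is a convex combination of the coefficients of the B-splines
  \<open>j, \<dots>, j + (k - 1)\<close>, hence the sum of squares is at most the largest sum over \<open>l\<close> of squared
  coefficients. The coefficient of the B-spline \<open>i\<close> can be computed from the piece on any atom in its
  support; on the largest one it is bounded by values of that piece, because the knots of the
  B-spline are within distance \<open>k\<close> times the length of this atom.\<close>

lemma square_function_le_large_atom:
  assumes "finite L" and f: "\<And>l. l \<in> L \<Longrightarrow> f l \<in> spline_space k \<F>" and j: "j < m"
    and C: "0 < C" "\<And>(p::real poly) c h u. degree p \<le> k - 1 \<Longrightarrow> h > 0 \<Longrightarrow>
          \<forall>r<k - 1. \<bar>u r - c\<bar> \<le> real k * h \<Longrightarrow>
          \<bar>polar (k - 1) u p\<bar> \<le> C * (\<Sum>n\<le>k - 1. \<bar>poly p (c + h * (1/2)^n)\<bar>)"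
  shows "\<exists>i q z. j \<le> i \<and> i \<le> j + (k - 1) \<and> q < m \<and> q \<le> i \<and> i \<le> q + (k - 1) \<and>
     support_length i \<le> real k * (s (Suc q) - s q) \<and> z \<in> {s q..s (Suc q)} \<and>
     (\<forall>x\<in>a j. (\<Sum>l\<in>L. (f l x)\<^sup>2) \<le> C\<^sup>2 * (real k)\<^sup>2 * (\<Sum>l\<in>L. (poly (piece (f l) q) z)\<^sup>2))"
proof -
  define \<Lambda> where "\<Lambda> = (\<lambda>i. \<Sum>l\<in>L. (spline_coeff i (piece (f l) j))\<^sup>2)"
  have "Max (\<Lambda> ` {j..j + (k - 1)}) \<in> \<Lambda> ` {j..j + (k - 1)}"
    by (rule Max_in) auto
  then obtain i where "i \<in> {j..j + (k - 1)}" and Max_i: "Max (\<Lambda> ` {j..j + (k - 1)}) = \<Lambda> i"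
    by (rule imageE)
  then have i: "j \<le> i" "i \<le> j + (k - 1)"
    by auto
  have \<Lambda>_max: "\<Lambda> i' \<le> \<Lambda> i" if "j \<le> i'" "i' \<le> j + (k - 1)" for i'
    unfolding Max_i[symmetric] using that by (intro Max_ge) auto
  have X_le: "(\<Sum>l\<in>L. (f l x)\<^sup>2) \<le> \<Lambda> i" if x: "x \<in> a j" for x
  proof -
    have unity: "(\<Sum>i<M. N (k - 1) i x) = 1"
      by (rule partition_of_unity[OF j x]) simp
    have "(f l x)\<^sup>2 \<le> (\<Sum>i<M. (spline_coeff i (piece (f l) j))\<^sup>2 * N (k - 1) i x)" if "l \<in> L" for l
    proof -
      have "f l x = (\<Sum>i<M. spline_coeff i (piece (f l) j) * N (k - 1) i x)"
        using polar_reproduction[OF j x piece(1)[OF f[OF that] j]] piece(2)[OF f[OF that] j x]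
        by (simp add: spline_coeff_def)
      then show ?thesis
        using weighted_square_le[of "{..<M}" "\<lambda>i. N (k - 1) i x" "\<lambda>i. spline_coeff i (piece (f l) j)"]
          unity N_nonneg by simp
    qed
    then have "(\<Sum>l\<in>L. (f l x)\<^sup>2) \<le> (\<Sum>l\<in>L. \<Sum>i<M. (spline_coeff i (piece (f l) j))\<^sup>2 * N (k - 1) i x)"
      by (rule sum_mono)
    also have "\<dots> = (\<Sum>i<M. \<Lambda> i * N (k - 1) i x)"
      unfolding \<Lambda>_def sum_distrib_right by (rule sum.swap)
    also have "\<dots> \<le> (\<Sum>i'<M. \<Lambda> i * N (k - 1) i' x)"
    proof (rule sum_mono)
      fix i'
      show "\<Lambda> i' * N (k - 1) i' x \<le> \<Lambda> i * N (k - 1) i' x"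
      proof (cases "N (k - 1) i' x = 0")
        case False
        then show ?thesis
          using N_local[OF j x False] by (intro mult_right_mono \<Lambda>_max N_nonneg) auto
      qed simp
    qed
    also have "\<dots> = \<Lambda> i"
      unfolding sum_distrib_left[symmetric] unity by simp
    finally show ?thesis .
  qed
  have iM: "i < M"
    using i j by simp
  obtain q where q: "q < m" "q \<le> i" "i \<le> q + (k - 1)"
    and large: "support_length i \<le> real k * (s (Suc q) - s q)"
    using large_atom_in_support[OF iM] by blast
  define h where "h = s (Suc q) - s q"
  have "h > 0"
    using s_step[OF q(1)] by (simp add: h_def)
  define Y where "Y = (\<lambda>y. \<Sum>l\<in>L. (poly (piece (f l) q) y)\<^sup>2)"
  define node where "node = (\<lambda>n. s q + h * (1/2::real)^n)"
  \<comment> \<open>All knots of the B-spline lie in its support, whose length is at most k times h.\<close>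
  have near: "\<forall>r<k - 1. \<bar>t (i + 1 + r) - s q\<bar> \<le> real k * h"
  proof (intro allI impI)
    fix r assume "r < k - 1"
    then have "t i \<le> t (i + 1 + r)" "t (i + 1 + r) \<le> t (i + k)"
      by (auto intro: knot_mono)
    moreover have "t i \<le> s q" "s q \<le> t (i + k)"
      using atom_le_support[OF q(1,3,2)] s_step[OF q(1)] by auto
    ultimately show "\<bar>t (i + 1 + r) - s q\<bar> \<le> real k * h"
      using large unfolding support_length_def h_def by linarith
  qed
  have coeff_le: "(spline_coeff i (piece (f l) j))\<^sup>2
      \<le> C\<^sup>2 * real k * (\<Sum>n\<le>k - 1. (poly (piece (f l) q) (node n))\<^sup>2)" if l: "l \<in> L" for l
  proof -
    have "spline_coeff i (piece (f l) j) = spline_coeff i (piece (f l) q)"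
      by (rule spline_coeff_indep[OF f[OF l] j q(1)]) (use i q in auto)
    then have "\<bar>spline_coeff i (piece (f l) j)\<bar> \<le> C * (\<Sum>n\<le>k - 1. \<bar>poly (piece (f l) q) (node n)\<bar>)"
      unfolding spline_coeff_def node_def
      using C(2)[OF piece(1)[OF f[OF l] q(1)] \<open>h > 0\<close> near] by simp
    then have "(spline_coeff i (piece (f l) j))\<^sup>2 \<le> (C * (\<Sum>n\<le>k - 1. \<bar>poly (piece (f l) q) (node n)\<bar>))\<^sup>2"
      by (metis abs_ge_zero power2_abs power_mono)
    also have "\<dots> = C\<^sup>2 * (\<Sum>n\<le>k - 1. \<bar>poly (piece (f l) q) (node n)\<bar>)\<^sup>2"
      by (simp add: power_mult_distrib)
    also have "\<dots> \<le> C\<^sup>2 * ((\<Sum>n\<le>k - 1. \<bar>poly (piece (f l) q) (node n)\<bar>\<^sup>2) * card {..k - 1})"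
      by (intro mult_left_mono sum_squared_le_sum_of_squares) auto
    finally show ?thesis
      using k_pos by (simp add: mult_ac)
  qed
  have "Max ((\<lambda>n. Y (node n)) ` {..k - 1}) \<in> (\<lambda>n. Y (node n)) ` {..k - 1}"
    by (rule Max_in) auto
  then obtain n where "n \<in> {..k - 1}" and Max_n: "Max ((\<lambda>n. Y (node n)) ` {..k - 1}) = Y (node n)"
    by (rule imageE)
  have Y_max: "Y (node n') \<le> Y (node n)" if "n' \<le> k - 1" for n'
    unfolding Max_n[symmetric] using that by (intro Max_ge) auto
  have "\<Lambda> i \<le> (\<Sum>l\<in>L. C\<^sup>2 * real k * (\<Sum>n\<le>k - 1. (poly (piece (f l) q) (node n))\<^sup>2))"
    unfolding \<Lambda>_def by (intro sum_mono coeff_le)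
  also have "\<dots> = C\<^sup>2 * real k * (\<Sum>n\<le>k - 1. Y (node n))"
    unfolding Y_def sum_distrib_left[symmetric] by (subst sum.swap) simp
  also have "\<dots> \<le> C\<^sup>2 * real k * (\<Sum>n'\<le>k - 1. Y (node n))"
    by (intro mult_left_mono sum_mono Y_max) auto
  also have "\<dots> = C\<^sup>2 * (real k)\<^sup>2 * Y (node n)"
    using k_pos by (simp add: power2_eq_square)
  finally have \<Lambda>_le: "\<Lambda> i \<le> C\<^sup>2 * (real k)\<^sup>2 * Y (node n)" .
  have "h * (1/2)^n \<le> h * 1"
    using \<open>h > 0\<close> by (intro mult_left_mono) (auto simp: power_le_one)
  moreover have "0 \<le> h * (1/2)^n"
    using \<open>h > 0\<close> by simp
  ultimately have "node n \<in> {s q..s q + h}"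
    by (simp add: node_def)
  then have "node n \<in> {s q..s (Suc q)}"
    by (simp add: h_def)
  moreover have "\<forall>x\<in>a j. (\<Sum>l\<in>L. (f l x)\<^sup>2) \<le> C\<^sup>2 * (real k)\<^sup>2 * Y (node n)"
    using X_le \<Lambda>_le by fastforce
  ultimately show ?thesis
    using i q large unfolding Y_def by blast
qed

end

text \<open>The atom \<open>j\<close> itself may be much shorter than its neighbours. The lower bound is therefore
  established on part of a long atom at most \<open>k - 1\<close> steps away, so that the length of the interval
  is comparable to a whole window of \<open>2 * W + 1\<close> atoms.\<close>

lemma square_function_large_nearby:
  assumes "1 \<le> k"
  obtains C c where "C > 0" "c > 0"
    "\<And>\<F> s a m (L::nat set) f j. spline_grid \<F> s a m k \<Longrightarrow> regularity k \<F> \<le> \<Gamma> \<Longrightarrow>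
     finite L \<Longrightarrow> (\<And>l. l \<in> L \<Longrightarrow> f l \<in> spline_space k \<F>) \<Longrightarrow> j < m \<Longrightarrow>
     \<exists>q \<alpha> \<beta>. q < m \<and> q \<le> j + (k - 1) \<and> j \<le> q + (k - 1) \<and> s q \<le> \<alpha> \<and> \<alpha> < \<beta> \<and> \<beta> \<le> s (Suc q) \<and>
        c * (s (min (j + W + 1) m) - s (j - W)) \<le> \<beta> - \<alpha> \<and>
        (\<forall>x\<in>a j. \<forall>y\<in>{\<alpha><..<\<beta>}. (\<Sum>l\<in>L. (f l x)\<^sup>2) \<le> C * (\<Sum>l\<in>L. (f l y)\<^sup>2))"
proof -
  obtain C where "C > 0" and C: "\<And>(p::real poly) c h u. degree p \<le> k - 1 \<Longrightarrow> h > 0 \<Longrightarrow>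
          \<forall>r<k - 1. \<bar>u r - c\<bar> \<le> real k * h \<Longrightarrow>
          \<bar>polar (k - 1) u p\<bar> \<le> C * (\<Sum>n\<le>k - 1. \<bar>poly p (c + h * (1/2)^n)\<bar>)"
    using polar_bound[of "k - 1" "real k"] by blast
  obtain c where "c > 0" and c: "\<And>(Y::real poly) b h z. degree Y \<le> 2 * (k - 1) \<Longrightarrow> h > 0 \<Longrightarrow> z \<in> {b..b+h} \<Longrightarrow>
     (\<forall>y\<in>{b..b+h}. 0 \<le> poly Y y) \<Longrightarrow>
     (\<exists>\<alpha> \<beta>. b \<le> \<alpha> \<and> \<alpha> < \<beta> \<and> \<beta> \<le> b + h \<and> c * h \<le> \<beta> - \<alpha> \<and>
        (\<forall>y\<in>{\<alpha><..<\<beta>}. poly Y z / 2 \<le> poly Y y))"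
    using large_on_subinterval[of "2 * (k - 1)"] by blast
  define G where "G = max 1 \<Gamma>"
  define K where "K = real (2 * W + 1) * G ^ (W + k) * real k"
  have "G \<ge> 1"
    by (simp add: G_def)
  then have "K > 0"
    using assms unfolding K_def by (intro mult_pos_pos) auto
  show ?thesis
  proof (rule that)
    show "0 < 2 * C\<^sup>2 * (real k)\<^sup>2" "0 < c / K"
      using \<open>C > 0\<close> \<open>c > 0\<close> \<open>K > 0\<close> assms by auto
  next
    fix \<F> s a m and L :: "nat set" and f j
    assume grid: "spline_grid \<F> s a m k" and reg: "regularity k \<F> \<le> \<Gamma>" and L: "finite L"
      and f: "\<And>l. l \<in> L \<Longrightarrow> f l \<in> spline_space k \<F>" and j: "j < m"
    interpret spline_grid \<F> s a m k
      by (rule grid)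
    obtain i q z where i: "j \<le> i" "i \<le> j + (k - 1)" and q: "q < m" "q \<le> i" "i \<le> q + (k - 1)"
      and large: "support_length i \<le> real k * (s (Suc q) - s q)" and z: "z \<in> {s q..s (Suc q)}"
      and X_le: "\<And>x. x \<in> a j \<Longrightarrow> (\<Sum>l\<in>L. (f l x)\<^sup>2) \<le> C\<^sup>2 * (real k)\<^sup>2 * (\<Sum>l\<in>L. (poly (piece (f l) q) z)\<^sup>2)"
      using square_function_le_large_atom[of L f j C, OF L f j \<open>C > 0\<close> C] by blast
    define Y where "Y = (\<Sum>l\<in>L. (piece (f l) q)\<^sup>2)"
    have Y: "poly Y y = (\<Sum>l\<in>L. (poly (piece (f l) q) y)\<^sup>2)" for y
      by (simp add: Y_def poly_sum)
    have "degree Y \<le> 2 * (k - 1)"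
      unfolding Y_def
    proof (rule degree_sum_le[OF L])
      fix l assume "l \<in> L"
      then have "degree (piece (f l) q) \<le> k - 1"
        using piece(1) f q by simp
      then show "degree ((piece (f l) q)\<^sup>2) \<le> 2 * (k - 1)"
        using degree_power_le[of "piece (f l) q" 2] by simp
    qed
    moreover have "0 < s (Suc q) - s q"
      using s_step[OF q(1)] by simp
    moreover have "z \<in> {s q..s q + (s (Suc q) - s q)}"
      using z by simp
    moreover have "\<forall>y\<in>{s q..s q + (s (Suc q) - s q)}. 0 \<le> poly Y y"
      by (simp add: Y sum_nonneg)
    ultimately obtain \<alpha> \<beta> where \<alpha>\<beta>: "s q \<le> \<alpha>" "\<alpha> < \<beta>" "\<beta> \<le> s (Suc q)"
      and len: "c * (s (Suc q) - s q) \<le> \<beta> - \<alpha>"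
      and half: "\<And>y. y \<in> {\<alpha><..<\<beta>} \<Longrightarrow> poly Y z / 2 \<le> poly Y y"
      using c[of Y "s (Suc q) - s q" z "s q"] by auto
    have reg': "regularity k \<F> \<le> G"
      using reg by (simp add: G_def)
    have "s (min (j + W + 1) m) - s (j - W) \<le> real (2 * W + 1) * G ^ (W + k) * support_length i"
      by (rule window_le_support[OF reg' j i])
    also have "\<dots> \<le> real (2 * W + 1) * G ^ (W + k) * (real k * (s (Suc q) - s q))"
      using large \<open>G \<ge> 1\<close> by (intro mult_left_mono) auto
    also have "\<dots> = K * (s (Suc q) - s q)"
      by (simp add: K_def)
    finally have "s (min (j + W + 1) m) - s (j - W) \<le> K * (s (Suc q) - s q)" .
    then have "c / K * (s (min (j + W + 1) m) - s (j - W)) \<le> c / K * (K * (s (Suc q) - s q))"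
      using \<open>c > 0\<close> \<open>K > 0\<close> by (intro mult_left_mono) auto
    also have "\<dots> = c * (s (Suc q) - s q)"
      using \<open>K > 0\<close> by simp
    finally have len': "c / K * (s (min (j + W + 1) m) - s (j - W)) \<le> \<beta> - \<alpha>"
      using len by simp
    have "(\<Sum>l\<in>L. (f l x)\<^sup>2) \<le> 2 * C\<^sup>2 * (real k)\<^sup>2 * (\<Sum>l\<in>L. (f l y)\<^sup>2)"
      if x: "x \<in> a j" and y: "y \<in> {\<alpha><..<\<beta>}" for x y
    proof -
      have "y \<in> a q"
        using y \<alpha>\<beta> open_subset_atom[OF q(1)] by auto
      then have Xy: "(\<Sum>l\<in>L. (f l y)\<^sup>2) = poly Y y"
        unfolding Y using f piece(2)[OF _ q(1)] by (intro sum.cong) auto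
      have "(\<Sum>l\<in>L. (f l x)\<^sup>2) \<le> C\<^sup>2 * (real k)\<^sup>2 * poly Y z"
        using X_le[OF x] by (simp add: Y)
      also have "\<dots> \<le> C\<^sup>2 * (real k)\<^sup>2 * (2 * poly Y y)"
        using half[OF y] by (intro mult_left_mono) auto
      finally show ?thesis
        by (simp add: Xy mult_ac)
    qed
    then show "\<exists>q \<alpha> \<beta>. q < m \<and> q \<le> j + (k - 1) \<and> j \<le> q + (k - 1) \<and> s q \<le> \<alpha> \<and> \<alpha> < \<beta> \<and> \<beta> \<le> s (Suc q) \<and>
        c / K * (s (min (j + W + 1) m) - s (j - W)) \<le> \<beta> - \<alpha> \<and>
        (\<forall>x\<in>a j. \<forall>y\<in>{\<alpha><..<\<beta>}. (\<Sum>l\<in>L. (f l x)\<^sup>2) \<le> 2 * C\<^sup>2 * (real k)\<^sup>2 * (\<Sum>l\<in>L. (f l y)\<^sup>2))"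
      using i q \<alpha>\<beta> len' by (intro exI[of _ q] exI[of _ \<alpha>] exI[of _ \<beta>]) auto
  qed
qed

section \<open>Smooth bump functions\<close>

lemma C_on_lincomb:
  assumes "C_on n S f" "C_on n S g"
  shows "C_on n S (\<lambda>x. \<alpha> * f x + \<beta> * g x)"
proof -
  obtain D where D: "\<forall>x\<in>S. D 0 x = f x"
      "\<forall>j<n. \<forall>x\<in>S. (D j has_real_derivative D (Suc j) x) (at x within S)"
      "\<forall>j\<le>n. continuous_on S (D j)"
    using assms(1) unfolding C_on_def by (elim exE conjE)
  obtain E where E: "\<forall>x\<in>S. E 0 x = g x"
      "\<forall>j<n. \<forall>x\<in>S. (E j has_real_derivative E (Suc j) x) (at x within S)"
      "\<forall>j\<le>n. continuous_on S (E j)"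
    using assms(2) unfolding C_on_def by (elim exE conjE)
  show ?thesis
    unfolding C_on_def
    by (rule exI[of _ "\<lambda>j x. \<alpha> * D j x + \<beta> * E j x"])
       (intro conjI ballI allI impI continuous_intros DERIV_add DERIV_cmult; use D E in simp)
qed

lemma spline_lincomb:
  assumes f: "f \<in> spline_space k \<F>" and g: "g \<in> spline_space k \<F>"
  shows "(\<lambda>x. \<alpha> * f x + \<beta> * g x) \<in> spline_space k \<F>"
proof -
  have "\<exists>p::real poly. degree p < k \<and> (\<forall>x\<in>A. \<alpha> * f x + \<beta> * g x = poly p x)" if "A \<in> atoms \<F>" for A
  proof -
    have "\<exists>p::real poly. degree p < k \<and> (\<forall>x\<in>A. f x = poly p x)"
      using f that by (simp add: spline_space_def)
    then obtain p :: "real poly" where p: "degree p < k" "\<forall>x\<in>A. f x = poly p x"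
      by (elim exE conjE)
    have "\<exists>q::real poly. degree q < k \<and> (\<forall>x\<in>A. g x = poly q x)"
      using g that by (simp add: spline_space_def)
    then obtain q :: "real poly" where q: "degree q < k" "\<forall>x\<in>A. g x = poly q x"
      by (elim exE conjE)
    have "degree (smult \<alpha> p + smult \<beta> q) < k"
      by (rule degree_add_less[OF le_less_trans[OF degree_smult_le p(1)] le_less_trans[OF degree_smult_le q(1)]])
    then show ?thesis
      using p q by (intro exI[of _ "smult \<alpha> p + smult \<beta> q"]) auto
  qed
  then show ?thesis
    using f g C_on_lincomb[of "k - 2" "{0..1}" f g \<alpha> \<beta>] by (simp add: spline_space_def)
qed

lemma spline_const:
  assumes "1 \<le> k"
  shows "(\<lambda>x. c) \<in> spline_space k \<F>"
proof -
  have "C_on n S (\<lambda>x. c)" for n and S :: "real set"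
    unfolding C_on_def by (rule exI[of _ "\<lambda>j x. if j = 0 then c else 0"]) auto
  moreover have "\<exists>p::real poly. degree p < k \<and> (\<forall>x\<in>A. c = poly p x)" for A
    using assms by (intro exI[of _ "[:c:]"]) auto
  ultimately show ?thesis
    by (simp add: spline_space_def)
qed

lemma spline_diff:
  "f \<in> spline_space k \<F> \<Longrightarrow> g \<in> spline_space k \<F> \<Longrightarrow> (\<lambda>x. f x - g x) \<in> spline_space k \<F>"
  using spline_lincomb[of f k \<F> g 1 "-1"] by simp

lemma spline_sum:
  assumes "1 \<le> k" "finite I" "\<And>i. i \<in> I \<Longrightarrow> f i \<in> spline_space k \<F>"
  shows "(\<lambda>x. \<Sum>i\<in>I. c i * f i x) \<in> spline_space k \<F>"
  using assms(2,3)
proof (induction rule: finite_induct)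
  case empty
  then show ?case
    using spline_const[OF assms(1), of 0] by simp
next
  case (insert i I)
  then show ?case
    using spline_lincomb[of "f i" k \<F> "\<lambda>x. \<Sum>i\<in>I. c i * f i x" "c i" 1] by simp
qed

lemma antiderivative_poly:
  "\<exists>A::real poly. pderiv A = p \<and> degree A \<le> Suc (degree p)"
proof -
  define A where "A = (\<Sum>i\<le>degree p. monom (coeff p i / real (Suc i)) (Suc i))"
  have "pderiv A = (\<Sum>i\<le>degree p. pderiv (monom (coeff p i / real (Suc i)) (Suc i)))"
    unfolding A_def by (rule higher_pderiv_sum[of 1, simplified])
  also have "\<dots> = (\<Sum>i\<le>degree p. monom (coeff p i) i)"
    by (simp add: pderiv_monom del: of_nat_Suc)
  also have "\<dots> = p"
    by (rule poly_as_sum_of_monoms)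
  finally have "pderiv A = p" .
  moreover have "degree A \<le> Suc (degree p)"
    unfolding A_def
  proof (rule degree_sum_le)
    fix i assume "i \<in> {..degree p}"
    then show "degree (monom (coeff p i / real (Suc i)) (Suc i)) \<le> Suc (degree p)"
      using degree_monom_le[of "coeff p i / real (Suc i)" "Suc i"] by simp
  qed simp
  ultimately show ?thesis
    by blast
qed

text \<open>The solution of \<open>w 1 = 0\<close> and \<open>w (k + 1) = 2 * w k + 1\<close>, the recursion that repeated
  integration produces in \<open>transition_exists\<close>.\<close>

definition transition_width :: "nat \<Rightarrow> nat" where
  "transition_width k = 2 ^ (k - 1) - 1"

context interval_grid
begin

lemma atom_borel:
  assumes "q < m"
  shows "a q \<in> sets borel"
proof -
  have eq: "a q = {s q<..<s (Suc q)} \<union> (a q \<inter> {s q, s (Suc q)})"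
    using open_subset_atom[OF assms] atom_subset_closed[OF assms] by force
  have "closed (a q \<inter> {s q, s (Suc q)})"
    by (rule finite_imp_closed) simp
  then show ?thesis
    by (subst eq) (intro sets.Un borel_closed borel_open open_greaterThanLessThan)
qed

lemma piecewise_continuous_integrable:
  assumes cont: "\<And>q. q < m \<Longrightarrow> continuous_on {0..1} (h q)"
    and f: "\<And>q x. q < m \<Longrightarrow> x \<in> a q \<Longrightarrow> f x = h q x"
  shows "set_integrable lborel {0..1} (f :: real \<Rightarrow> real)"
proof -
  have "set_integrable lborel (a q) (h q)" if "q < m" for q
  proof (rule set_integrable_subset[OF borel_integrable_atLeastAtMost'[OF cont[OF that]]])
    show "a q \<in> sets lborel"
      using atom_borel[OF that] by simp
  qed (rule atom_subset_unit[OF that])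
  then have "integrable lborel (\<lambda>x. \<Sum>q<m. indicator (a q) x *\<^sub>R h q x)"
    by (intro Bochner_Integration.integrable_sum) (simp add: set_integrable_def)
  moreover have "(\<Sum>q<m. indicator (a q) x *\<^sub>R h q x) = indicator {0..1} x *\<^sub>R f x" for x
  proof (cases "x \<in> {0..1}")
    case True
    then obtain q where q: "q < m" "x \<in> a q"
      using atom_exists by blast
    have "(\<Sum>q<m. indicator (a q) x *\<^sub>R h q x) = (\<Sum>i<m. if i = q then h q x else 0)"
    proof (rule sum.cong[OF refl])
      fix i assume "i \<in> {..<m}"
      show "indicator (a i) x *\<^sub>R h i x = (if i = q then h q x else 0)"
      proof (cases "i = q")
        case False
        then have "x \<notin> a i"
          using atom_unique[of i q x] q \<open>i \<in> {..<m}\<close> by blast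
        then show ?thesis
          using False by simp
      qed (use q in simp)
    qed
    then show ?thesis
      using q True f[OF q] by simp
  next
    case False
    then have "x \<notin> a q" if "q < m" for q
      using atom_subset_unit[OF that] by blast
    then show ?thesis
      using False by simp
  qed
  ultimately show ?thesis
    by (simp add: set_integrable_def)
qed

lemma spline_pieces:
  assumes "f \<in> spline_space k \<F>" "q < m"
  shows "\<exists>p::real poly. degree p < k \<and> (\<forall>x\<in>a q. f x = poly p x)"
proof -
  have "a q \<in> atoms \<F>"
    using assms(2) by (simp add: atoms_eq)
  then show ?thesis
    using assms(1) by (simp add: spline_space_def)
qed

lemma spline_integrable:
  assumes "f \<in> spline_space k \<F>"
  shows "set_integrable lborel {0..1} f"
proof -
  have "\<forall>q. \<exists>p::real poly. q < m \<longrightarrow> (\<forall>x\<in>a q. f x = poly p x)"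
    using spline_pieces[OF assms] by blast
  then obtain p :: "nat \<Rightarrow> real poly" where "\<And>q x. q < m \<Longrightarrow> x \<in> a q \<Longrightarrow> f x = poly (p q) x"
    by metis
  then show ?thesis
    by (intro piecewise_continuous_integrable[where h = "\<lambda>q. poly (p q)"] continuous_on_poly continuous_on_id)
qed

lemma integral_spline_piecewise_poly:
  assumes b: "b \<in> spline_space k \<F>" and q: "q < m"
  shows "\<exists>P. degree P < Suc k \<and> (\<forall>x\<in>a q. integral {0..x} b = poly P x)"
proof -
  have int: "b integrable_on {0..1}"
    using set_borel_integral_eq_integral(1)[OF spline_integrable[OF b]] .
  obtain p where p: "degree p < k" "\<And>x. x \<in> a q \<Longrightarrow> b x = poly p x"
    using spline_pieces[OF b q] by blast
  obtain A where A: "pderiv A = p" "degree A \<le> Suc (degree p)"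
    using antiderivative_poly by blast
  define P where "P = [:integral {0..s q} b - poly A (s q):] + A"
  have "integral {0..x} b = poly P x" if x: "x \<in> a q" for x
  proof -
    have le: "0 \<le> s q" "s q \<le> x" "x \<le> s (Suc q)" "x \<le> 1"
      using s_range[of q] s_range[of "Suc q"] atom_bounds[OF q x] q by auto
    have "(poly p has_integral poly A x - poly A (s q)) {s q..x}"
      by (rule fundamental_theorem_of_calculus)
         (use le in \<open>auto simp: A(1)[symmetric] has_real_derivative_iff_has_vector_derivative[symmetric]
            intro!: poly_DERIV[THEN DERIV_subset]\<close>)
    then have "(b has_integral poly A x - poly A (s q)) {s q..x}"
    proof (rule has_integral_spike_finite[rotated 2])
      fix y assume "y \<in> {s q..x} - {s q, x}"
      then have "y \<in> {s q<..<s (Suc q)}"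
        using le by auto
      then show "b y = poly p y"
        using p(2) open_subset_atom[OF q] by blast
    qed simp
    then have "integral {s q..x} b = poly A x - poly A (s q)"
      by (rule integral_unique)
    moreover have "integral {0..s q} b + integral {s q..x} b = integral {0..x} b"
      using le by (intro Henstock_Kurzweil_Integration.integral_combine integrable_on_subinterval[OF int]) auto
    ultimately show ?thesis
      by (simp add: P_def)
  qed
  moreover have "degree P < Suc k"
    unfolding P_def using A(2) p(1) by (intro degree_add_less) auto
  ultimately show ?thesis
    by blast
qed

text \<open>Integration raises the order by one: it adds one derivative and one to the degree.\<close>

lemma integral_spline:
  assumes k: "1 \<le> k" and b: "b \<in> spline_space k \<F>"
  shows "(\<lambda>x. integral {0..x} b) \<in> spline_space (Suc k) \<F>"
proof -
  have int: "b integrable_on {0..1}"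
    using set_borel_integral_eq_integral(1)[OF spline_integrable[OF b]] .
  have cont0: "continuous_on {0..1} (\<lambda>x. integral {0..x} b)"
    by (rule indefinite_integral_continuous_1[OF int])
  have "C_on (Suc k - 2) {0..1} (\<lambda>x. integral {0..x} b)"
  proof (cases "k = 1")
    case True
    then show ?thesis
      unfolding C_on_def using cont0 by (intro exI[of _ "\<lambda>j x. integral {0..x} b"]) auto
  next
    case False
    then have k2: "Suc k - 2 = Suc (k - 2)" "2 \<le> k"
      using k by auto
    then have "C_on (k - 2) {0..1} b"
      using b by (simp add: spline_space_def)
    then obtain E where E: "\<And>x. x \<in> {0..1} \<Longrightarrow> E 0 x = b x"
      "\<And>j x. j < k - 2 \<Longrightarrow> x \<in> {0..1} \<Longrightarrow> (E j has_real_derivative E (Suc j) x) (at x within {0..1})"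
      "\<And>j. j \<le> k - 2 \<Longrightarrow> continuous_on {0..1} (E j)"
      unfolding C_on_def by blast
    have cont: "continuous_on {0..1} b"
      using E(3)[of 0] E(1) by (subst continuous_on_cong[OF refl, of _ _ "E 0"]) auto
    define D where "D = (\<lambda>j. case j of 0 \<Rightarrow> (\<lambda>x. integral {0..x} b) | Suc j \<Rightarrow> E j)"
    have "(D j has_real_derivative D (Suc j) x) (at x within {0..1})"
      if "j < Suc (k - 2)" "x \<in> {0..1}" for j x
      using integral_has_real_derivative[OF cont that(2)] E(1)[OF that(2)] E(2)[OF _ that(2)] that(1)
      by (cases j) (auto simp: D_def)
    moreover have "continuous_on {0..1} (D j)" if "j \<le> Suc (k - 2)" for j
      using cont0 E(3) that by (cases j) (auto simp: D_def)
    ultimately show ?thesis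
      unfolding C_on_def k2 by (intro exI[of _ D]) (auto simp: D_def)
  qed
  then show ?thesis
    using integral_spline_piecewise_poly[OF b] unfolding spline_space_def atoms_eq by auto
qed

text \<open>A transition of order \<open>k + 1\<close> is the normalised primitive of a bump of order \<open>k\<close>, namely of
  the difference of two transitions of order \<open>k\<close>. The second of them starts only after the first
  has been completed, so the bump is non-negative and its primitive is increasing.\<close>

lemma transition_exists:
  assumes "1 \<le> k"
  shows "\<exists>H\<in>spline_space k \<F>. (\<forall>x\<in>{0..1}. 0 \<le> H x \<and> H x \<le> 1) \<and>
     (\<forall>q<m. \<forall>x\<in>a q. (q < i \<longrightarrow> H x = 0) \<and> (i + transition_width k \<le> q \<longrightarrow> H x = 1))"
  using assms
proof (induction k arbitrary: i rule: dec_induct)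
  case base
  define H where "H = (\<lambda>x. if \<exists>q. i \<le> q \<and> q < m \<and> x \<in> a q then 1 else 0 :: real)"
  have H: "H x = (if i \<le> q then 1 else 0)" if "q < m" "x \<in> a q" for q x
  proof -
    have "(\<exists>q'. i \<le> q' \<and> q' < m \<and> x \<in> a q') \<longleftrightarrow> i \<le> q"
      using atom_unique[OF that(1) _ that(2)] that by blast
    then show ?thesis
      by (simp add: H_def)
  qed
  have "H \<in> spline_space 1 \<F>"
    unfolding spline_space_def atoms_eq
  proof (intro CollectI conjI ballI impI)
    fix A assume "A \<in> a ` {..<m}"
    then obtain q where "q < m" "A = a q"
      by blast
    then show "\<exists>p::real poly. degree p < 1 \<and> (\<forall>x\<in>A. H x = poly p x)"
      using H[of q] by (intro exI[of _ "[:if i \<le> q then 1 else 0:]"]) simp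
  qed simp
  moreover have "\<forall>x\<in>{0..1}. 0 \<le> H x \<and> H x \<le> 1"
    by (simp add: H_def)
  ultimately show ?case
    using H by (intro bexI[of _ H] conjI allI impI ballI) (simp_all add: transition_width_def)
next
  case (step k)
  define w where "w = transition_width k"
  have w': "transition_width (Suc k) = 2 * w + 1"
  proof -
    have "k = Suc (k - 1)"
      using step.hyps by simp
    then have "(2::nat) ^ k = 2 * 2 ^ (k - 1)"
      by (metis power_Suc)
    moreover obtain v where "(2::nat) ^ (k - 1) = Suc v"
      using not0_implies_Suc[of "2 ^ (k - 1)"] by auto
    ultimately show ?thesis
      unfolding w_def transition_width_def by simp
  qed
  show ?case
  \<comment> \<open>If the partition ends before the bump reaches its plateau, no atom is so far to the right that H must be 1 on it.\<close>
  proof (cases "i + w < m")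
    case False
    have "(\<lambda>x. 0) \<in> spline_space (Suc k) \<F>"
      by (rule spline_const) simp
    then show ?thesis
      using False w' by (intro bexI[of _ "\<lambda>x. 0"]) auto
  next
    case True
    obtain H1 where H1: "H1 \<in> spline_space k \<F>" "\<And>x. x \<in> {0..1} \<Longrightarrow> 0 \<le> H1 x \<and> H1 x \<le> 1"
      and H1': "\<And>q x. q < m \<Longrightarrow> x \<in> a q \<Longrightarrow> (q < i \<longrightarrow> H1 x = 0) \<and> (i + w \<le> q \<longrightarrow> H1 x = 1)"
      using step.IH[of i] unfolding w_def by blast
    obtain H2 where H2: "H2 \<in> spline_space k \<F>" "\<And>x. x \<in> {0..1} \<Longrightarrow> 0 \<le> H2 x \<and> H2 x \<le> 1"
      and H2': "\<And>q x. q < m \<Longrightarrow> x \<in> a q \<Longrightarrow> (q < i + w + 1 \<longrightarrow> H2 x = 0) \<and> (i + w + 1 + w \<le> q \<longrightarrow> H2 x = 1)"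
      using step.IH[of "i + w + 1"] unfolding w_def by blast
    define b where "b = (\<lambda>x. H1 x - H2 x)"
    have b: "b \<in> spline_space k \<F>"
      unfolding b_def by (rule spline_diff[OF H1(1) H2(1)])
    have int: "b integrable_on {0..1}"
      using set_borel_integral_eq_integral(1)[OF spline_integrable[OF b]] .
    have b_nonneg: "0 \<le> b x" if x: "x \<in> {0..1}" for x
    proof -
      obtain q where q: "q < m" "x \<in> a q"
        using atom_exists x by blast
      show ?thesis
        using H1'[OF q] H2'[OF q] H1(2)[OF that] H2(2)[OF that]
        by (cases "q < i + w + 1") (auto simp: b_def)
    qed
    have b_left: "b x = 0" if "q < m" "x \<in> a q" "q < i" for q x
      using H1'[OF that(1,2)] H2'[OF that(1,2)] that(3) by (simp add: b_def)
    have b_right: "b x = 0" if "q < m" "x \<in> a q" "i + (2 * w + 1) \<le> q" for q x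
      using H1'[OF that(1,2)] H2'[OF that(1,2)] that(3) by (simp add: b_def)
    have b_mid: "b x = 1" if "x \<in> a (i + w)" for x
      using H1'[OF True that] H2'[OF True that] by (simp add: b_def)
    have sub_int: "b integrable_on {x..y}" if "0 \<le> x" "y \<le> 1" for x y
      using that by (intro integrable_on_subinterval[OF int]) auto
    define c where "c = integral {0..1} b"
    have range: "0 \<le> s (i + w)" "s (Suc (i + w)) \<le> 1"
      using s_range[of "i + w"] s_range[of "Suc (i + w)"] True by auto
    have "((\<lambda>x. 1) has_integral s (Suc (i + w)) - s (i + w)) {s (i + w)..s (Suc (i + w))}"
      using has_integral_const_real[of "1::real" "s (i + w)" "s (Suc (i + w))"] s_step[OF True] by simp
    then have "(b has_integral s (Suc (i + w)) - s (i + w)) {s (i + w)..s (Suc (i + w))}"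
    proof (rule has_integral_spike_finite[rotated 2])
      fix y assume "y \<in> {s (i + w)..s (Suc (i + w))} - {s (i + w), s (Suc (i + w))}"
      then have "y \<in> {s (i + w)<..<s (Suc (i + w))}"
        by auto
      then show "b y = 1"
        using b_mid open_subset_atom[OF True] by blast
    qed simp
    then have "s (Suc (i + w)) - s (i + w) = integral {s (i + w)..s (Suc (i + w))} b"
      by (simp add: integral_unique)
    also have "\<dots> \<le> c"
      unfolding c_def using range b_nonneg by (intro integral_subset_le sub_int) auto
    finally have "c > 0"
      using s_step[OF True] by simp
    define H where "H = (\<lambda>x. integral {0..x} b / c)"
    have "(\<lambda>x. integral {0..x} b) \<in> spline_space (Suc k) \<F>"
      by (rule integral_spline[OF step.hyps(1) b])
    then have "H \<in> spline_space (Suc k) \<F>"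
      using spline_lincomb[of _ "Suc k" \<F> _ "1 / c" 0] by (fastforce simp: H_def)
    moreover have "\<forall>x\<in>{0..1}. 0 \<le> H x \<and> H x \<le> 1"
    proof
      fix x :: real assume x: "x \<in> {0..1}"
      have "0 \<le> integral {0..x} b"
        using x b_nonneg by (intro integral_nonneg sub_int) auto
      moreover have "integral {0..x} b \<le> c"
        unfolding c_def using x b_nonneg by (intro integral_subset_le sub_int) auto
      ultimately show "0 \<le> H x \<and> H x \<le> 1"
        using \<open>c > 0\<close> by (simp add: H_def)
    qed
    moreover have "H x = 0" if q: "q < m" "x \<in> a q" "q < i" for q x
    proof -
      have "b y = 0" if "y \<in> {0..x}" for y
      proof -
        have "y \<in> {0..1}"
          using that atom_subset_unit[OF q(1)] q(2) by auto
        then obtain q' where q': "q' < m" "y \<in> a q'"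
          using atom_exists by blast
        then have "q' \<le> q"
          using atom_le_index[OF q'(1) q(1) q'(2) q(2)] that by simp
        then show ?thesis
          using b_left[OF q'] q by simp
      qed
      then have "integral {0..x} b = integral {0..x} (\<lambda>y. 0)"
        by (intro Henstock_Kurzweil_Integration.integral_cong)
      then show ?thesis
        by (simp add: H_def)
    qed
    moreover have "H x = 1" if q: "q < m" "x \<in> a q" "i + (2 * w + 1) \<le> q" for q x
    proof -
      have x: "x \<in> {0..1}"
        using atom_subset_unit[OF q(1)] q(2) by auto
      have "b y = 0" if "y \<in> {x..1}" for y
      proof -
        have "y \<in> {0..1}"
          using that x by auto
        then obtain q' where q': "q' < m" "y \<in> a q'"
          using atom_exists by blast
        then have "q \<le> q'"
          using atom_le_index[OF q(1) q'(1) q(2) q'(2)] that by simp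
        then show ?thesis
          using b_right[OF q'] q by simp
      qed
      then have "integral {x..1} b = integral {x..1} (\<lambda>y. 0)"
        by (intro Henstock_Kurzweil_Integration.integral_cong)
      moreover have "integral {0..x} b + integral {x..1} b = c"
        unfolding c_def using x by (intro Henstock_Kurzweil_Integration.integral_combine int) auto
      ultimately show ?thesis
        using \<open>c > 0\<close> by (simp add: H_def)
    qed
    ultimately show ?thesis
      unfolding w' by (intro bexI[of _ H]) auto
  qed
qed

text \<open>The difference of a rising transition to the left of the plateau and one to its right.
  If there is no room on the left, the rising transition is replaced by the constant 1.\<close>

lemma bump_exists:
  assumes "1 \<le> k"
  shows "\<exists>B\<in>spline_space k \<F>. (\<forall>x\<in>{0..1}. 0 \<le> B x \<and> B x \<le> 1) \<and>
     (\<forall>q<m. \<forall>x\<in>a q. (q \<le> j + R \<and> j \<le> q + R \<longrightarrow> B x = 1) \<and>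
        (j + R + transition_width k < q \<or> q + R + transition_width k < j \<longrightarrow> B x = 0))"
proof -
  define w where "w = transition_width k"
  obtain H1 where H1: "H1 \<in> spline_space k \<F>" "\<And>x. x \<in> {0..1} \<Longrightarrow> 0 \<le> H1 x \<and> H1 x \<le> 1"
    and H1_0: "\<And>q x. q < m \<Longrightarrow> x \<in> a q \<Longrightarrow> q + R + w < j \<Longrightarrow> H1 x = 0"
    and H1_1: "\<And>q x. q < m \<Longrightarrow> x \<in> a q \<Longrightarrow> j \<le> q + R \<Longrightarrow> H1 x = 1"
  proof (cases "j < R + w")
    case True
    then show ?thesis
      using that[of "\<lambda>x. 1"] spline_const[OF assms, of 1] by auto
  next
    case False
    obtain H where H: "H \<in> spline_space k \<F>" "\<forall>x\<in>{0..1}. 0 \<le> H x \<and> H x \<le> 1"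
      "\<forall>q<m. \<forall>x\<in>a q. (q < j - R - w \<longrightarrow> H x = 0) \<and> (j - R - w + w \<le> q \<longrightarrow> H x = 1)"
      using transition_exists[OF assms, of "j - R - w"] unfolding w_def by blast
    show ?thesis
      by (rule that[of H]) (use H False in auto)
  qed
  obtain H2 where H2: "H2 \<in> spline_space k \<F>" "\<forall>x\<in>{0..1}. 0 \<le> H2 x \<and> H2 x \<le> 1"
      "\<forall>q<m. \<forall>x\<in>a q. (q < j + R + 1 \<longrightarrow> H2 x = 0) \<and> (j + R + 1 + w \<le> q \<longrightarrow> H2 x = 1)"
    using transition_exists[OF assms, of "j + R + 1"] unfolding w_def by blast
  define B where "B = (\<lambda>x. H1 x - H2 x)"
  have "B \<in> spline_space k \<F>"
    unfolding B_def by (rule spline_diff[OF H1(1) H2(1)])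
  moreover have "\<forall>x\<in>{0..1}. 0 \<le> B x \<and> B x \<le> 1"
  proof
    fix x :: real assume x: "x \<in> {0..1}"
    then obtain q where q: "q < m" "x \<in> a q"
      using atom_exists by blast
    show "0 \<le> B x \<and> B x \<le> 1"
    proof (cases "q < j + R + 1")
      case True
      then show ?thesis
        using H1(2)[OF x] H2(3) q by (simp add: B_def)
    next
      case False
      then show ?thesis
        using H1_1[OF q] H2(2) x by (simp add: B_def)
    qed
  qed
  moreover have "B x = 1" if "q < m" "x \<in> a q" "q \<le> j + R" "j \<le> q + R" for q x
    using H1_1[OF that(1,2,4)] H2(3) that by (simp add: B_def)
  moreover have "B x = 0" if q: "q < m" "x \<in> a q" "j + R + w < q \<or> q + R + w < j" for q x
    using q(3)
  proof
    assume "j + R + w < q"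
    then show ?thesis
      using H1_1[OF q(1,2)] H2(3) q by (simp add: B_def)
  next
    assume "q + R + w < j"
    then show ?thesis
      using H1_0[OF q(1,2)] H2(3) q by (simp add: B_def)
  qed
  ultimately show ?thesis
    unfolding w_def by (intro bexI[of _ B]) auto
qed

end

section \<open>The majorants\<close>

text \<open>A marker interval of an atom is at most \<open>k - 1\<close> atoms away from it. Two atoms whose marker
  intervals meet are then at most \<open>2 * (k - 1)\<close> atoms apart, and the bump of one is 1 on the other.\<close>

definition bump_radius :: "nat \<Rightarrow> nat" where
  "bump_radius k = 2 * (k - 1)"

definition is_bump :: "nat \<Rightarrow> real set set \<Rightarrow> nat \<Rightarrow> (real \<Rightarrow> real) \<Rightarrow> bool" where
  "is_bump k \<F> j B \<longleftrightarrow> B \<in> spline_space k \<F> \<and> (\<forall>x\<in>{0..1}. 0 \<le> B x \<and> B x \<le> 1) \<and>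
     (\<forall>x\<in>{0..1}. (atom_index \<F> x \<le> j + bump_radius k \<and> j \<le> atom_index \<F> x + bump_radius k \<longrightarrow> B x = 1) \<and>
        (j + bump_radius k + transition_width k < atom_index \<F> x \<or>
         atom_index \<F> x + bump_radius k + transition_width k < j \<longrightarrow> B x = 0))"

definition bump :: "nat \<Rightarrow> real set set \<Rightarrow> nat \<Rightarrow> real \<Rightarrow> real" where
  "bump k \<F> j = (SOME B. is_bump k \<F> j B)"

definition cell_sup :: "real set set \<Rightarrow> (real \<Rightarrow> real) \<Rightarrow> nat \<Rightarrow> real" where
  "cell_sup \<F> h j = Sup (h ` {x \<in> {0..1}. atom_index \<F> x = j})"

definition square_function :: "(nat \<Rightarrow> real \<Rightarrow> real) \<Rightarrow> nat \<Rightarrow> real \<Rightarrow> real" where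
  "square_function f n x = sqrt (\<Sum>l = 1..n. (f l x)\<^sup>2)"

definition exceeding_cells :: "real set set \<Rightarrow> (real \<Rightarrow> real) \<Rightarrow> (real \<Rightarrow> real) \<Rightarrow> nat set" where
  "exceeding_cells \<F> h g = {j. j < card (atoms \<F>) \<and> (\<exists>y\<in>{0..1}. atom_index \<F> y = j \<and> g y < h y)}"

text \<open>On every atom where the previous majorant fails, twice the supremum of the square function
  is added. The factor 2 makes the values that are added near a fixed point grow geometrically.\<close>

primrec majorant ::
    "nat \<Rightarrow> (nat \<Rightarrow> real set set) \<Rightarrow> (nat \<Rightarrow> real \<Rightarrow> real) \<Rightarrow> nat \<Rightarrow> real \<Rightarrow> real" where
  "majorant k \<F> f 0 = (\<lambda>x. 0)"
| "majorant k \<F> f (Suc n) = (\<lambda>x. majorant k \<F> f n x +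
     (\<Sum>j\<in>exceeding_cells (\<F> (Suc n)) (square_function f (Suc n)) (majorant k \<F> f n).
        2 * cell_sup (\<F> (Suc n)) (square_function f (Suc n)) j * bump k (\<F> (Suc n)) j x))"

lemma bump:
  assumes "1 \<le> k" "interval_sigma_algebra \<F>"
  shows bump_spline: "bump k \<F> j \<in> spline_space k \<F>"
    and bump_range: "x \<in> {0..1} \<Longrightarrow> 0 \<le> bump k \<F> j x \<and> bump k \<F> j x \<le> 1"
    and bump_eq_1: "x \<in> {0..1} \<Longrightarrow> atom_index \<F> x \<le> j + bump_radius k \<Longrightarrow>
          j \<le> atom_index \<F> x + bump_radius k \<Longrightarrow> bump k \<F> j x = 1"
    and bump_eq_0: "x \<in> {0..1} \<Longrightarrow> j + bump_radius k + transition_width k < atom_index \<F> x \<or>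
          atom_index \<F> x + bump_radius k + transition_width k < j \<Longrightarrow> bump k \<F> j x = 0"
proof -
  obtain s a m where "interval_grid \<F> s a m"
    using interval_sigma_algebra_grid[OF assms(2)] by blast
  then interpret interval_grid \<F> s a m .
  obtain B where B: "B \<in> spline_space k \<F>" "\<forall>x\<in>{0..1}. 0 \<le> B x \<and> B x \<le> 1"
    and B': "\<forall>q<m. \<forall>x\<in>a q. (q \<le> j + bump_radius k \<and> j \<le> q + bump_radius k \<longrightarrow> B x = 1) \<and>
        (j + bump_radius k + transition_width k < q \<or> q + bump_radius k + transition_width k < j \<longrightarrow> B x = 0)"
    using bump_exists[OF assms(1), of j "bump_radius k"] by blast
  have "(atom_index \<F> x \<le> j + bump_radius k \<and> j \<le> atom_index \<F> x + bump_radius k \<longrightarrow> B x = 1) \<and>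
        (j + bump_radius k + transition_width k < atom_index \<F> x \<or>
         atom_index \<F> x + bump_radius k + transition_width k < j \<longrightarrow> B x = 0)" if x: "x \<in> {0..1}" for x
  proof -
    obtain q where q: "q < m" "x \<in> a q"
      using atom_exists[OF x] by blast
    then show ?thesis
      using B' atom_index_eq[OF q] by simp
  qed
  then have "is_bump k \<F> j B"
    using B by (simp add: is_bump_def)
  then have "is_bump k \<F> j (bump k \<F> j)"
    unfolding bump_def by (rule someI[where P = "is_bump k \<F> j"])
  then show "bump k \<F> j \<in> spline_space k \<F>"
    and "x \<in> {0..1} \<Longrightarrow> 0 \<le> bump k \<F> j x \<and> bump k \<F> j x \<le> 1"
    and "x \<in> {0..1} \<Longrightarrow> atom_index \<F> x \<le> j + bump_radius k \<Longrightarrow>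
          j \<le> atom_index \<F> x + bump_radius k \<Longrightarrow> bump k \<F> j x = 1"
    and "x \<in> {0..1} \<Longrightarrow> j + bump_radius k + transition_width k < atom_index \<F> x \<or>
          atom_index \<F> x + bump_radius k + transition_width k < j \<Longrightarrow> bump k \<F> j x = 0"
    unfolding is_bump_def by blast+
qed

lemma (in interval_grid) cell_eq:
  assumes "j < m"
  shows "{x \<in> {0..1}. atom_index \<F> x = j} = a j"
proof (intro equalityI subsetI)
  fix x assume "x \<in> {x \<in> {0..1}. atom_index \<F> x = j}"
  then have x: "x \<in> {0..1}" "atom_index \<F> x = j"
    by auto
  obtain q where "q < m" "x \<in> a q"
    using atom_exists[OF x(1)] by blast
  then show "x \<in> a j"
    using atom_index_eq[of q x] x(2) by simp
next
  fix x assume "x \<in> a j"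
  then show "x \<in> {x \<in> {0..1}. atom_index \<F> x = j}"
    using atom_subset_unit[OF assms] atom_index_eq[OF assms] by auto
qed

lemma expect_bump_le:
  assumes k: "1 \<le> k" and F: "interval_sigma_algebra \<F>" and "interval_grid \<F> s a m" and j: "j < m"
  defines "W \<equiv> bump_radius k + transition_width k"
  shows "expect (bump k \<F> j) \<le> s (min (j + W + 1) m) - s (j - W)"
proof -
  interpret interval_grid \<F> s a m
    by fact
  define lo where "lo = s (j - W)"
  define hi where "hi = s (min (j + W + 1) m)"
  have "lo \<le> hi"
    unfolding lo_def hi_def using j by (intro s_mono) auto
  have "expect (bump k \<F> j) = (\<integral>x. indicator {0..1} x *\<^sub>R bump k \<F> j x \<partial>lborel)"
    by (simp add: expect_def set_lebesgue_integral_def)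
  also have "\<dots> \<le> (\<integral>x. indicator {lo..hi} x \<partial>lborel)"
  proof (rule integral_mono)
    show "integrable lborel (\<lambda>x. indicator {0..1} x *\<^sub>R bump k \<F> j x)"
      using spline_integrable[OF bump_spline[OF k F]] by (simp add: set_integrable_def)
    show "integrable lborel (indicator {lo..hi} :: real \<Rightarrow> real)"
      by (rule integrable_real_indicator) (simp_all add: emeasure_lborel_Icc_eq)
    fix x :: real
    show "indicator {0..1} x *\<^sub>R bump k \<F> j x \<le> indicator {lo..hi} x"
    proof (cases "x \<in> {0..1} \<and> bump k \<F> j x \<noteq> 0")
      case True
      then have x: "x \<in> {0..1}" and nz: "bump k \<F> j x \<noteq> 0"
        by auto
      obtain q where q: "q < m" "x \<in> a q"
        using atom_exists[OF x] by blast
      have "\<not> (j + bump_radius k + transition_width k < q \<or> q + bump_radius k + transition_width k < j)"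
        using bump_eq_0[OF k F x, of j] nz unfolding atom_index_eq[OF q] by blast
      then have "q \<le> j + W" "j \<le> q + W"
        unfolding W_def by linarith+
      then have "lo \<le> s q" "s (Suc q) \<le> hi"
        unfolding lo_def hi_def using q(1) by (auto intro!: s_mono)
      then have "x \<in> {lo..hi}"
        using atom_bounds[OF q] by auto
      then show ?thesis
        using bump_range[OF k F x, of j] x by simp
    next
      case False
      then have zero: "indicator {0..1} x *\<^sub>R bump k \<F> j x = 0"
        by auto
      show ?thesis
        unfolding zero by simp
    qed
  qed
  also have "\<dots> = hi - lo"
    using \<open>lo \<le> hi\<close> by simp
  finally show ?thesis
    by (simp add: lo_def hi_def)
qed

text \<open>The interval found by \<open>square_function_large_nearby\<close>, with the window chosen to contain the
  support of the bump: the term that is added for the atom \<open>j\<close> costs no more than a multiple of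
  \<open>cell_sup\<close> times the length of this marker interval.\<close>

lemma marker_interval:
  assumes k: "1 \<le> k"
  obtains C c where "C > 0" "c > 0"
    "\<And>\<F> f n j. interval_sigma_algebra \<F> \<Longrightarrow> regularity k \<F> \<le> \<Gamma> \<Longrightarrow>
       (\<And>l. l \<in> {1..n} \<Longrightarrow> f l \<in> spline_space k \<F>) \<Longrightarrow> j < card (atoms \<F>) \<Longrightarrow>
       (\<exists>\<alpha> \<beta>. 0 \<le> \<alpha> \<and> \<alpha> < \<beta> \<and> \<beta> \<le> 1 \<and> c * expect (bump k \<F> j) \<le> \<beta> - \<alpha> \<and>
          (\<forall>y\<in>{\<alpha><..<\<beta>}. atom_index \<F> y \<le> j + (k - 1) \<and> j \<le> atom_index \<F> y + (k - 1) \<and>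
             cell_sup \<F> (square_function f n) j \<le> C * square_function f n y))"
proof -
  define W where "W = bump_radius k + transition_width k"
  obtain C c where "C > 0" "c > 0" and main:
    "\<And>\<F> s a m (L::nat set) f j. spline_grid \<F> s a m k \<Longrightarrow> regularity k \<F> \<le> \<Gamma> \<Longrightarrow>
     finite L \<Longrightarrow> (\<And>l. l \<in> L \<Longrightarrow> f l \<in> spline_space k \<F>) \<Longrightarrow> j < m \<Longrightarrow>
     \<exists>q \<alpha> \<beta>. q < m \<and> q \<le> j + (k - 1) \<and> j \<le> q + (k - 1) \<and> s q \<le> \<alpha> \<and> \<alpha> < \<beta> \<and> \<beta> \<le> s (Suc q) \<and>
        c * (s (min (j + W + 1) m) - s (j - W)) \<le> \<beta> - \<alpha> \<and>
        (\<forall>x\<in>a j. \<forall>y\<in>{\<alpha><..<\<beta>}. (\<Sum>l\<in>L. (f l x)\<^sup>2) \<le> C * (\<Sum>l\<in>L. (f l y)\<^sup>2))"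
    by (rule square_function_large_nearby[OF k, of \<Gamma> W]) (erule (1) that, blast)
  show ?thesis
  proof (rule that)
    show "0 < sqrt C" "0 < c"
      using \<open>C > 0\<close> \<open>c > 0\<close> by auto
  next
    fix \<F> :: "real set set" and f :: "nat \<Rightarrow> real \<Rightarrow> real" and n j :: nat
    assume F: "interval_sigma_algebra \<F>" and reg: "regularity k \<F> \<le> \<Gamma>"
      and f: "\<And>l. l \<in> {1..n} \<Longrightarrow> f l \<in> spline_space k \<F>" and j: "j < card (atoms \<F>)"
    obtain s a m where grid: "interval_grid \<F> s a m"
      using interval_sigma_algebra_grid[OF F] by blast
    then interpret interval_grid \<F> s a m .
    have jm: "j < m"
      using j by (simp add: card_atoms)
    have "spline_grid \<F> s a m k"
      by unfold_locales fact
    from main[where L = "{1..n}" and f = f and j = j, OF this reg _ f jm]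
    obtain q \<alpha> \<beta> where q: "q < m" "q \<le> j + (k - 1)" "j \<le> q + (k - 1)"
      and \<alpha>\<beta>: "s q \<le> \<alpha>" "\<alpha> < \<beta>" "\<beta> \<le> s (Suc q)"
      and len: "c * (s (min (j + W + 1) m) - s (j - W)) \<le> \<beta> - \<alpha>"
      and le: "\<forall>x\<in>a j. \<forall>y\<in>{\<alpha><..<\<beta>}. (\<Sum>l = 1..n. (f l x)\<^sup>2) \<le> C * (\<Sum>l = 1..n. (f l y)\<^sup>2)"
      by auto
    have le': "square_function f n x \<le> sqrt C * square_function f n y" if "x \<in> a j" "y \<in> {\<alpha><..<\<beta>}" for x y
      unfolding square_function_def real_sqrt_mult[symmetric] using le that by (intro real_sqrt_le_mono) blast
    have "c * expect (bump k \<F> j) \<le> c * (s (min (j + W + 1) m) - s (j - W))"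
      using expect_bump_le[OF k F grid jm] \<open>c > 0\<close> unfolding W_def by (intro mult_left_mono) auto
    moreover have "atom_index \<F> y = q" if "y \<in> {\<alpha><..<\<beta>}" for y
      by (rule atom_index_eq[OF q(1)]) (use that \<alpha>\<beta> open_subset_atom[OF q(1)] in force)
    moreover have "cell_sup \<F> (square_function f n) j \<le> sqrt C * square_function f n y" if "y \<in> {\<alpha><..<\<beta>}" for y
      unfolding cell_sup_def cell_eq[OF jm]
      by (rule cSUP_least[OF atom_nonempty[OF jm] le'[OF _ that]])
    moreover have "0 \<le> \<alpha>" "\<beta> \<le> 1"
      using \<alpha>\<beta> s_range[of q] s_range[of "Suc q"] q(1) by auto
    ultimately show "\<exists>\<alpha> \<beta>. 0 \<le> \<alpha> \<and> \<alpha> < \<beta> \<and> \<beta> \<le> 1 \<and> c * expect (bump k \<F> j) \<le> \<beta> - \<alpha> \<and>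
          (\<forall>y\<in>{\<alpha><..<\<beta>}. atom_index \<F> y \<le> j + (k - 1) \<and> j \<le> atom_index \<F> y + (k - 1) \<and>
             cell_sup \<F> (square_function f n) j \<le> sqrt C * square_function f n y)"
      using \<alpha>\<beta>(2) q len by (intro exI[of _ \<alpha>] exI[of _ \<beta>]) auto
  qed
qed

text \<open>A geometric sum is at most twice its last term. The bound \<open>T\<close> is generalised in the
  induction because all terms before a non-empty time are at most half of its values.\<close>

lemma doubling_sum_le:
  fixes v :: "nat \<Rightarrow> nat \<Rightarrow> real"
  assumes fin: "\<And>l. finite (J l)" and card: "\<And>l. l \<in> {1..n} \<Longrightarrow> card (J l) \<le> b"
    and doubling: "\<And>l l' j j'. 1 \<le> l \<Longrightarrow> l < l' \<Longrightarrow> l' \<le> n \<Longrightarrow> j \<in> J l \<Longrightarrow> j' \<in> J l' \<Longrightarrow> 2 * v l j \<le> v l' j'"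
    and bound: "\<And>l j. l \<in> {1..n} \<Longrightarrow> j \<in> J l \<Longrightarrow> v l j \<le> T" and "0 \<le> T"
  shows "(\<Sum>l = 1..n. \<Sum>j\<in>J l. v l j) \<le> 2 * real b * T"
  using card doubling bound \<open>0 \<le> T\<close>
proof (induction n arbitrary: T)
  case (Suc n)
  have IH: "(\<Sum>l = 1..n. \<Sum>j\<in>J l. v l j) \<le> 2 * real b * T'"
    if "\<And>l j. l \<in> {1..n} \<Longrightarrow> j \<in> J l \<Longrightarrow> v l j \<le> T'" "0 \<le> T'" for T'
    by (rule Suc.IH) (use Suc.prems(1,2) that in auto)
  have new: "(\<Sum>j\<in>J (Suc n). v (Suc n) j) \<le> real b * T"
  proof -
    have "(\<Sum>j\<in>J (Suc n). v (Suc n) j) \<le> real (card (J (Suc n))) * T"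
      by (rule sum_bounded_above) (use Suc.prems(3) in auto)
    also have "\<dots> \<le> real b * T"
      using Suc.prems(1)[of "Suc n"] Suc.prems(4) by (intro mult_right_mono) auto
    finally show ?thesis .
  qed
  show ?case
  proof (cases "J (Suc n) = {}")
    case True
    then show ?thesis
      using IH[of T] Suc.prems(3,4) by simp
  next
    case False
    then obtain j' where j': "j' \<in> J (Suc n)"
      by blast
    have "v l j \<le> T / 2" if "l \<in> {1..n}" "j \<in> J l" for l j
      using Suc.prems(2)[of l "Suc n" j j'] Suc.prems(3)[of "Suc n" j'] that j' by auto
    then have "(\<Sum>l = 1..n. \<Sum>j\<in>J l. v l j) \<le> 2 * real b * (T / 2)"
      using Suc.prems(4) by (intro IH) auto
    then show ?thesis
      using new by simp
  qed
qed simp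

locale spline_sequence =
  fixes k :: nat and \<F> :: "nat \<Rightarrow> real set set" and f :: "nat \<Rightarrow> real \<Rightarrow> real"
  assumes k: "1 \<le> k" and filtration: "interval_filtration \<F>"
    and f: "\<And>n. 1 \<le> n \<Longrightarrow> f n \<in> spline_space k (\<F> n)"
begin

abbreviation g where "g \<equiv> majorant k \<F> f"
abbreviation u where "u \<equiv> square_function f"
abbreviation v where "v n \<equiv> cell_sup (\<F> n) (u n)"
abbreviation bad where "bad n \<equiv> exceeding_cells (\<F> n) (u n) (g (n - 1))"

lemma sigma: "1 \<le> n \<Longrightarrow> interval_sigma_algebra (\<F> n)"
  using filtration by (simp add: interval_filtration_def)

lemma spline_later:
  assumes "1 \<le> l" "l \<le> n"
  shows "spline_space k (\<F> l) \<subseteq> spline_space k (\<F> n)"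
  by (rule spline_space_mono) (use assms sigma interval_filtration_le[OF filtration] in auto)

lemma f_later: "l \<in> {1..n} \<Longrightarrow> f l \<in> spline_space k (\<F> n)"
  using f[of l] spline_later[of l n] by auto

lemma finite_bad: "finite (bad n)"
  unfolding exceeding_cells_def by simp

lemma bad_less: "j \<in> bad n \<Longrightarrow> j < card (atoms (\<F> n))"
  by (simp add: exceeding_cells_def)

lemma u_nonneg: "0 \<le> u n x"
  by (simp add: square_function_def sum_nonneg)

lemma u_mono: "l \<le> n \<Longrightarrow> u l x \<le> u n x"
  unfolding square_function_def by (intro real_sqrt_le_mono sum_mono2) auto

lemma index_less: "1 \<le> n \<Longrightarrow> x \<in> {0..1} \<Longrightarrow> atom_index (\<F> n) x < card (atoms (\<F> n))"
proof -
  assume n: "1 \<le> n" and x: "x \<in> {0..1}"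
  obtain s a m where "interval_grid (\<F> n) s a m"
    using interval_sigma_algebra_grid[OF sigma[OF n]] by blast
  then interpret interval_grid "\<F> n" s a m .
  obtain q where "q < m" "x \<in> a q"
    using atom_exists[OF x] by blast
  then show ?thesis
    using atom_index_eq by (simp add: card_atoms)
qed

lemma u_pieces:
  assumes n: "1 \<le> n"
  shows "\<exists>h. (\<forall>q. continuous_on {0..1} (h q)) \<and> (\<forall>x\<in>{0..1}. u n x = h (atom_index (\<F> n) x) x)"
proof -
  obtain s a m where "interval_grid (\<F> n) s a m"
    using interval_sigma_algebra_grid[OF sigma[OF n]] by blast
  then interpret interval_grid "\<F> n" s a m .
  have "\<exists>p::real poly. l \<in> {1..n} \<longrightarrow> q < m \<longrightarrow> (\<forall>x\<in>a q. f l x = poly p x)" for l q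
    using spline_pieces[OF f_later, of l q] by blast
  then obtain p :: "nat \<Rightarrow> nat \<Rightarrow> real poly"
    where p: "\<And>l q x. l \<in> {1..n} \<Longrightarrow> q < m \<Longrightarrow> x \<in> a q \<Longrightarrow> f l x = poly (p l q) x"
    by metis
  define h where "h = (\<lambda>q x. sqrt (\<Sum>l = 1..n. (poly (p l q) x)\<^sup>2))"
  have "continuous_on {0..1} (h q)" for q
    unfolding h_def by (intro continuous_intros)
  moreover have "u n x = h (atom_index (\<F> n) x) x" if x: "x \<in> {0..1}" for x
  proof -
    obtain q where q: "q < m" "x \<in> a q"
      using atom_exists[OF x] by blast
    have "(\<Sum>l = 1..n. (f l x)\<^sup>2) = (\<Sum>l = 1..n. (poly (p l q) x)\<^sup>2)"
      using p[OF _ q] by (intro sum.cong) simp_all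
    then show ?thesis
      by (simp only: square_function_def h_def atom_index_eq[OF q])
  qed
  ultimately show ?thesis
    by blast
qed

lemma u_le_v:
  assumes n: "1 \<le> n" and x: "x \<in> {0..1}"
  shows "u n x \<le> v n (atom_index (\<F> n) x)"
proof -
  define q where "q = atom_index (\<F> n) x"
  obtain h where h: "\<And>q. continuous_on {0..1} (h q)"
    and u: "\<And>y. y \<in> {0..1} \<Longrightarrow> u n y = h (atom_index (\<F> n) y) y"
    using u_pieces[OF n] by blast
  have "bounded (h q ` {0..1})"
    by (intro compact_imp_bounded compact_continuous_image h compact_Icc)
  then have "bdd_above (h q ` {0..1})"
    by (rule bounded_imp_bdd_above)
  moreover have "u n ` {y \<in> {0..1}. atom_index (\<F> n) y = q} \<subseteq> h q ` {0..1}"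
    using u by auto
  ultimately have "bdd_above (u n ` {y \<in> {0..1}. atom_index (\<F> n) y = q})"
    by (rule bdd_above_mono)
  then show ?thesis
    unfolding cell_sup_def q_def using x by (intro cSUP_upper) auto
qed

lemma v_nonneg: "1 \<le> n \<Longrightarrow> j \<in> bad n \<Longrightarrow> 0 \<le> v n j"
  unfolding exceeding_cells_def using u_le_v u_nonneg order_trans by blast

lemma increment_nonneg:
  assumes "1 \<le> n" "x \<in> {0..1}" "j \<in> bad n"
  shows "0 \<le> 2 * v n j * bump k (\<F> n) j x"
  using v_nonneg[OF assms(1,3)] bump_range[OF k sigma[OF assms(1)] assms(2)] by simp

lemma g_step: "x \<in> {0..1} \<Longrightarrow> g n x \<le> g (Suc n) x"
  using increment_nonneg[of "Suc n" x] by (auto intro!: sum_nonneg)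

lemma g_mono: "l \<le> n \<Longrightarrow> x \<in> {0..1} \<Longrightarrow> g l x \<le> g n x"
  by (rule lift_Suc_mono_le[of "\<lambda>n. g n x"]) (rule g_step)

lemma g_nonneg: "x \<in> {0..1} \<Longrightarrow> 0 \<le> g n x"
  using g_mono[of 0 n x] by simp

lemma g_spline: "1 \<le> n \<Longrightarrow> g n \<in> spline_space k (\<F> n)"
proof (induction n)
  case (Suc n)
  have "g n \<in> spline_space k (\<F> (Suc n))"
  proof (cases "n = 0")
    case True
    then show ?thesis
      using spline_const[OF k, of 0] by simp
  next
    case False
    then show ?thesis
      using Suc.IH spline_later[of n "Suc n"] by auto
  qed
  moreover have "(\<lambda>x. \<Sum>j\<in>bad (Suc n). (2 * v (Suc n) j) * bump k (\<F> (Suc n)) j x) \<in> spline_space k (\<F> (Suc n))"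
    by (intro spline_sum k finite_bad bump_spline sigma) simp
  ultimately show ?case
    using spline_lincomb[of "g n" k "\<F> (Suc n)" _ 1 1] by fastforce
qed simp

lemma bad_le_g:
  assumes n: "1 \<le> n" and j: "j \<in> bad n" and x: "x \<in> {0..1}"
    and near: "atom_index (\<F> n) x \<le> j + bump_radius k" "j \<le> atom_index (\<F> n) x + bump_radius k"
  shows "2 * v n j \<le> g n x"
proof -
  obtain n' where n': "n = Suc n'"
    using n by (cases n) auto
  have "2 * v n j = 2 * v n j * bump k (\<F> n) j x"
    using bump_eq_1[OF k sigma[OF n] x near] by simp
  also have "\<dots> \<le> (\<Sum>j\<in>bad n. 2 * v n j * bump k (\<F> n) j x)"
    by (rule member_le_sum[OF j]) (use increment_nonneg[OF n x] finite_bad in auto)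
  also have "\<dots> \<le> g n x"
    using g_nonneg[OF x, of n'] by (simp add: n')
  finally show ?thesis .
qed

lemma u_le_g:
  assumes n: "1 \<le> n" and x: "x \<in> {0..1}"
  shows "u n x \<le> g n x"
proof (cases "atom_index (\<F> n) x \<in> bad n")
  case True
  have "u n x \<le> v n (atom_index (\<F> n) x)"
    by (rule u_le_v[OF n x])
  also have "\<dots> \<le> 2 * v n (atom_index (\<F> n) x)"
    using v_nonneg[OF n True] by simp
  also have "\<dots> \<le> g n x"
    by (rule bad_le_g[OF n True x]) auto
  finally show ?thesis .
next
  case False
  then have "u n x \<le> g (n - 1) x"
    using x index_less[OF n x] by (auto simp: exceeding_cells_def not_less)
  then show ?thesis
    using g_mono[of "n - 1" n x] x by simp
qed

text \<open>Let marker intervals of two chosen atoms \<open>j\<close> and \<open>j'\<close> both contain \<open>x\<close>. The later atom contains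
  a point \<open>y\<close> where the majorant still failed. The point \<open>y\<close> is within \<open>k - 1\<close> fine atoms of \<open>x\<close>,
  hence within \<open>k - 1\<close> coarse atoms, so its distance to \<open>j\<close> is at most \<open>2 * (k - 1)\<close> and the bump of \<open>j\<close>
  equals 1 at \<open>y\<close>. Thus the
  majorant at \<open>y\<close> was already at least twice the earlier value.\<close>

lemma values_double:
  assumes l: "1 \<le> l" "l < l'" and j: "j \<in> bad l" and j': "j' \<in> bad l'" and x: "x \<in> {0..1}"
    and near: "atom_index (\<F> l) x \<le> j + (k - 1)" "j \<le> atom_index (\<F> l) x + (k - 1)"
    and near': "atom_index (\<F> l') x \<le> j' + (k - 1)" "j' \<le> atom_index (\<F> l') x + (k - 1)"
  shows "2 * v l j \<le> v l' j'"
proof -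
  obtain y where y: "y \<in> {0..1}" "atom_index (\<F> l') y = j'" "g (l' - 1) y < u l' y"
    using j' by (auto simp: exceeding_cells_def)
  have "\<bar>int (atom_index (\<F> l) x) - int (atom_index (\<F> l) y)\<bar>
      \<le> \<bar>int (atom_index (\<F> l') x) - int (atom_index (\<F> l') y)\<bar>"
    by (rule atom_index_refinement)
       (use l sigma interval_filtration_le[OF filtration] x y in auto)
  then have "2 * v l j \<le> g l y"
    using near near' y(2) by (intro bad_le_g[OF l(1) j y(1)]) (auto simp: bump_radius_def)
  also have "\<dots> \<le> g (l' - 1) y"
    using l y(1) by (intro g_mono) auto
  also have "\<dots> \<le> u l' y"
    using y by simp
  also have "\<dots> \<le> v l' j'"
    using u_le_v[of l' y] l y by simp
  finally show ?thesis .
qed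

lemma g_eq: "g n x = (\<Sum>l = 1..n. \<Sum>j\<in>bad l. 2 * v l j * bump k (\<F> l) j x)"
  by (induction n) auto

lemma u_integrable:
  assumes n: "1 \<le> n"
  shows "set_integrable lborel {0..1} (u n)"
proof -
  obtain s a m where "interval_grid (\<F> n) s a m"
    using interval_sigma_algebra_grid[OF sigma[OF n]] by blast
  then interpret interval_grid "\<F> n" s a m .
  obtain h where h: "\<And>q. continuous_on {0..1} (h q)"
    and u: "\<And>y. y \<in> {0..1} \<Longrightarrow> u n y = h (atom_index (\<F> n) y) y"
    using u_pieces[OF n] by blast
  show ?thesis
  proof (rule piecewise_continuous_integrable[OF h])
    fix q x assume q: "q < m" "x \<in> a q"
    then have "x \<in> {0..1}"
      using atom_subset_unit by blast
    then show "u n x = h q x"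
      using u atom_index_eq[OF q] by simp
  qed
qed

text \<open>Each bump is exchanged for its marker interval. At a fixed point \<open>x\<close> only \<open>2 * k\<close> atoms of
  each time can have a marker interval containing \<open>x\<close>, and their values double from time to time, so
  the sum of all these values is at most a multiple of the largest; every value is at most a
  multiple of the square function at \<open>x\<close>.\<close>

lemma expect_g_le:
  assumes n: "1 \<le> n" and "c > 0" "C > 0"
    and mark: "\<And>l j. l \<in> {1..n} \<Longrightarrow> j \<in> bad l \<Longrightarrow>
       0 \<le> \<alpha> l j \<and> \<alpha> l j < \<beta> l j \<and> \<beta> l j \<le> 1 \<and> c * expect (bump k (\<F> l) j) \<le> \<beta> l j - \<alpha> l j \<and>
          (\<forall>y\<in>{\<alpha> l j<..<\<beta> l j}. atom_index (\<F> l) y \<le> j + (k - 1) \<and> j \<le> atom_index (\<F> l) y + (k - 1) \<and>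
             v l j \<le> C * u l y)"
  shows "expect (g n) \<le> 4 * real (2 * k) * C / c * expect (u n)"
proof -
  define I where "I = (\<lambda>l j. {\<alpha> l j<..<\<beta> l j})"
  define h where "h = (\<lambda>x. \<Sum>l = 1..n. \<Sum>j\<in>bad l. v l j * indicator (I l j) x :: real)"
  have h_le: "h x \<le> 2 * real (2 * k) * (C * u n x)" if x: "x \<in> {0..1}" for x
  proof -
    define J where "J = (\<lambda>l. {j \<in> bad l. l \<in> {1..n} \<and> x \<in> I l j})"
    have J: "j \<in> bad l" "atom_index (\<F> l) x \<le> j + (k - 1)" "j \<le> atom_index (\<F> l) x + (k - 1)" "v l j \<le> C * u l x"
      if "j \<in> J l" for l j
      using that mark[of l j] unfolding J_def I_def by auto
    have "h x = (\<Sum>l = 1..n. \<Sum>j\<in>J l. v l j)"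
      unfolding h_def
    proof (rule sum.cong[OF refl])
      fix l assume "l \<in> {1..n}"
      then show "(\<Sum>j\<in>bad l. v l j * indicator (I l j) x) = (\<Sum>j\<in>J l. v l j)"
        unfolding J_def by (intro sum.mono_neutral_cong_right finite_bad) auto
    qed
    also have "\<dots> \<le> 2 * real (2 * k) * (C * u n x)"
    proof (rule doubling_sum_le)
      fix l
      show "finite (J l)"
        unfolding J_def using finite_bad by simp
      have "J l \<subseteq> {atom_index (\<F> l) x - (k - 1)..atom_index (\<F> l) x + (k - 1)}"
        using J[of _ l] by fastforce
      then have "card (J l) \<le> card {atom_index (\<F> l) x - (k - 1)..atom_index (\<F> l) x + (k - 1)}"
        by (intro card_mono) auto
      then show "card (J l) \<le> 2 * k"
        using k by simp
    next
      fix l l' j j' assume "1 \<le> l" "l < l'" "j \<in> J l" "j' \<in> J l'"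
      then show "2 * v l j \<le> v l' j'"
        using J[of j l] J[of j' l'] x by (intro values_double) auto
    next
      fix l j assume "l \<in> {1..n}" "j \<in> J l"
      then show "v l j \<le> C * u n x"
        using J(4)[of j l] u_mono[of l n x] \<open>C > 0\<close> by (meson atLeastAtMost_iff less_imp_le mult_left_mono order_trans)
    next
      show "0 \<le> C * u n x"
        using \<open>C > 0\<close> u_nonneg by simp
    qed
    finally show ?thesis .
  qed
  have ind_int: "set_integrable lborel {0..1} (\<lambda>x. indicator (I l j) x :: real)" for l j
    unfolding set_integrable_def I_def
  proof (rule integrable_mult_indicator)
    show "integrable lborel (indicator {\<alpha> l j<..<\<beta> l j} :: real \<Rightarrow> real)"
      by (cases "\<alpha> l j \<le> \<beta> l j") (auto intro!: integrable_real_indicator)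
  qed simp
  have expect_ind: "expect (\<lambda>x. indicator (I l j) x) = \<beta> l j - \<alpha> l j" if "l \<in> {1..n}" "j \<in> bad l" for l j
  proof -
    have \<alpha>\<beta>: "0 \<le> \<alpha> l j" "\<alpha> l j < \<beta> l j" "\<beta> l j \<le> 1"
      using mark[OF that] by simp_all
    then have eq: "(\<lambda>x. indicator {0..1} x *\<^sub>R indicator (I l j) x :: real) = indicator (I l j)"
      by (auto simp: I_def indicator_def fun_eq_iff)
    show ?thesis
      unfolding expect_def set_lebesgue_integral_def eq using \<alpha>\<beta> by (simp add: I_def)
  qed
  have bump_int: "set_integrable lborel {0..1} (bump k (\<F> l) j)" if "l \<in> {1..n}" for l j
  proof -
    have l: "1 \<le> l"
      using that by simp
    obtain s a m where "interval_grid (\<F> l) s a m"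
      using interval_sigma_algebra_grid[OF sigma[OF l]] by blast
    then show ?thesis
      using interval_grid.spline_integrable bump_spline[OF k sigma[OF l]] by blast
  qed
  have expect_sum: "set_integrable lborel {0..1} (\<lambda>x. \<Sum>l = 1..n. \<Sum>j\<in>bad l. w l j * \<phi> l j x) \<and>
      expect (\<lambda>x. \<Sum>l = 1..n. \<Sum>j\<in>bad l. w l j * \<phi> l j x) = (\<Sum>l = 1..n. \<Sum>j\<in>bad l. w l j * expect (\<phi> l j))"
    if "\<And>l j. l \<in> {1..n} \<Longrightarrow> set_integrable lborel {0..1} (\<phi> l j)"
    for w and \<phi> :: "nat \<Rightarrow> nat \<Rightarrow> real \<Rightarrow> real"
  proof -
    have int: "integrable lborel (\<lambda>x. w l j * (indicator {0..1} x *\<^sub>R \<phi> l j x))" if "l \<in> {1..n}" for l j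
      using \<open>\<And>l j. l \<in> {1..n} \<Longrightarrow> set_integrable lborel {0..1} (\<phi> l j)\<close>[OF that]
      unfolding set_integrable_def by (rule integrable_mult_right)
    have eq: "indicator {0..1} x *\<^sub>R (\<Sum>l = 1..n. \<Sum>j\<in>bad l. w l j * \<phi> l j x)
        = (\<Sum>l = 1..n. \<Sum>j\<in>bad l. w l j * (indicator {0..1} x *\<^sub>R \<phi> l j x))" for x
      by (simp add: sum_distrib_left mult_ac)
    let ?T = "\<lambda>l j x. w l j * (indicator {0..1} x *\<^sub>R \<phi> l j x)"
    have "integrable lborel (\<lambda>x. \<Sum>l = 1..n. \<Sum>j\<in>bad l. ?T l j x)"
      by (intro Bochner_Integration.integrable_sum int)
    moreover have "(\<integral>x. (\<Sum>l = 1..n. \<Sum>j\<in>bad l. ?T l j x) \<partial>lborel)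
        = (\<Sum>l = 1..n. \<integral>x. (\<Sum>j\<in>bad l. ?T l j x) \<partial>lborel)"
      by (intro Bochner_Integration.integral_sum Bochner_Integration.integrable_sum int)
    moreover have "\<dots> = (\<Sum>l = 1..n. \<Sum>j\<in>bad l. \<integral>x. ?T l j x \<partial>lborel)"
      by (intro sum.cong refl Bochner_Integration.integral_sum int)
    moreover have "\<dots> = (\<Sum>l = 1..n. \<Sum>j\<in>bad l. w l j * (\<integral>x. indicator {0..1} x *\<^sub>R \<phi> l j x \<partial>lborel))"
      by (simp only: integral_mult_right_zero)
    ultimately show ?thesis
      unfolding set_integrable_def expect_def set_lebesgue_integral_def eq by (simp only: simp_thms)
  qed
  have "expect (g n) = expect (\<lambda>x. \<Sum>l = 1..n. \<Sum>j\<in>bad l. 2 * v l j * bump k (\<F> l) j x)"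
    by (rule arg_cong[where f = expect], rule ext, rule g_eq)
  also have "\<dots> = (\<Sum>l = 1..n. \<Sum>j\<in>bad l. 2 * v l j * expect (bump k (\<F> l) j))"
    using expect_sum[of "\<lambda>l j. bump k (\<F> l) j" "\<lambda>l j. 2 * v l j", OF bump_int]
    by (rule conjunct2)
  also have "\<dots> \<le> (\<Sum>l = 1..n. \<Sum>j\<in>bad l. 2 / c * (v l j * expect (\<lambda>x. indicator (I l j) x)))"
  proof (intro sum_mono)
    fix l j assume l: "l \<in> {1..n}" and j: "j \<in> bad l"
    have "expect (bump k (\<F> l) j) \<le> (\<beta> l j - \<alpha> l j) / c"
      using mark[OF l j] \<open>c > 0\<close> by (simp add: field_simps)
    then have "2 * v l j * expect (bump k (\<F> l) j) \<le> 2 * v l j * ((\<beta> l j - \<alpha> l j) / c)"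
      using v_nonneg[of l j] l j by (intro mult_left_mono) auto
    then show "2 * v l j * expect (bump k (\<F> l) j) \<le> 2 / c * (v l j * expect (\<lambda>x. indicator (I l j) x))"
      by (simp add: expect_ind[OF l j])
  qed
  also have "\<dots> = 2 / c * expect h"
    unfolding h_def conjunct2[OF expect_sum[of "\<lambda>l j x. indicator (I l j) x" v, OF ind_int]]
    by (simp add: sum_distrib_left)
  also have "\<dots> \<le> 2 / c * (2 * real (2 * k) * C * expect (u n))"
  proof (rule mult_left_mono)
    have "expect h \<le> expect (\<lambda>x. 2 * real (2 * k) * C * u n x)"
      unfolding expect_def
    proof (rule set_integral_mono)
      show "set_integrable lborel {0..1} h"
        unfolding h_def
        by (rule conjunct1[OF expect_sum[of "\<lambda>l j x. indicator (I l j) x" v, OF ind_int]])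
      show "set_integrable lborel {0..1} (\<lambda>x. 2 * real (2 * k) * C * u n x)"
        using u_integrable[OF n] by (intro set_integrable_mult_right) auto
      show "h x \<le> 2 * real (2 * k) * C * u n x" if "x \<in> {0..1}" for x
        using h_le[OF that] by (simp add: mult_ac)
    qed
    also have "\<dots> = 2 * real (2 * k) * C * expect (u n)"
      unfolding expect_def by (rule set_integral_mult_right)
    finally show "expect h \<le> 2 * real (2 * k) * C * expect (u n)" .
    show "0 \<le> 2 / c"
      using \<open>c > 0\<close> by simp
  qed
  also have "\<dots> = 4 * real (2 * k) * C / c * expect (u n)"
    by simp
  finally show ?thesis .
qed

end

lemma expect_majorant_le:
  assumes "1 \<le> k"
  shows "\<exists>C. \<forall>\<F> f n. spline_sequence k \<F> f \<longrightarrow> 1 \<le> n \<longrightarrow> (\<forall>l\<in>{1..n}. regularity k (\<F> l) \<le> \<Gamma>) \<longrightarrow>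
    expect (majorant k \<F> f n) \<le> C * expect (square_function f n)"
proof -
  obtain C c where "C > 0" "c > 0" and main:
    "\<And>\<F> f n j. interval_sigma_algebra \<F> \<Longrightarrow> regularity k \<F> \<le> \<Gamma> \<Longrightarrow>
       (\<And>l. l \<in> {1..n} \<Longrightarrow> f l \<in> spline_space k \<F>) \<Longrightarrow> j < card (atoms \<F>) \<Longrightarrow>
       (\<exists>\<alpha> \<beta>. 0 \<le> \<alpha> \<and> \<alpha> < \<beta> \<and> \<beta> \<le> 1 \<and> c * expect (bump k \<F> j) \<le> \<beta> - \<alpha> \<and>
          (\<forall>y\<in>{\<alpha><..<\<beta>}. atom_index \<F> y \<le> j + (k - 1) \<and> j \<le> atom_index \<F> y + (k - 1) \<and>
             cell_sup \<F> (square_function f n) j \<le> C * square_function f n y))"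
    by (rule marker_interval[OF assms, of \<Gamma>]) (erule (1) that, blast)
  show ?thesis
  proof (intro exI[of _ "4 * real (2 * k) * C / c"] allI impI)
    fix \<F> f n
    assume "spline_sequence k \<F> f" and n: "1 \<le> n" and reg: "\<forall>l\<in>{1..n}. regularity k (\<F> l) \<le> \<Gamma>"
    interpret spline_sequence k \<F> f
      by fact
    have "\<exists>\<alpha> \<beta>. 0 \<le> \<alpha> \<and> \<alpha> < \<beta> \<and> \<beta> \<le> 1 \<and> c * expect (bump k (\<F> l) j) \<le> \<beta> - \<alpha> \<and>
          (\<forall>y\<in>{\<alpha><..<\<beta>}. atom_index (\<F> l) y \<le> j + (k - 1) \<and> j \<le> atom_index (\<F> l) y + (k - 1) \<and>
             v l j \<le> C * u l y)" if l: "l \<in> {1..n}" and j: "j \<in> bad l" for l j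
      by (rule main) (use reg l bad_less[OF j] sigma f_later in auto)
    then obtain \<alpha> \<beta> where "\<And>l j. l \<in> {1..n} \<Longrightarrow> j \<in> bad l \<Longrightarrow>
        0 \<le> \<alpha> l j \<and> \<alpha> l j < \<beta> l j \<and> \<beta> l j \<le> 1 \<and> c * expect (bump k (\<F> l) j) \<le> \<beta> l j - \<alpha> l j \<and>
          (\<forall>y\<in>{\<alpha> l j<..<\<beta> l j}. atom_index (\<F> l) y \<le> j + (k - 1) \<and> j \<le> atom_index (\<F> l) y + (k - 1) \<and>
             v l j \<le> C * u l y)"
      by metis
    then show "expect (majorant k \<F> f n) \<le> 4 * real (2 * k) * C / c * expect (square_function f n)"
      by (rule expect_g_le[OF n \<open>c > 0\<close> \<open>C > 0\<close>])
  qed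
qed

theorem proposition3p4:
  "\<exists>C :: nat \<Rightarrow> real \<Rightarrow> real.
     \<forall>k \<ge> 1. \<forall>(\<F> :: nat \<Rightarrow> real set set) (f :: nat \<Rightarrow> real \<Rightarrow> real).
       interval_filtration \<F> \<longrightarrow>
       (\<forall>n\<ge>1. f n \<in> spline_space k (\<F> n)) \<longrightarrow>
       (let X = (\<lambda>n x. \<Sum>l = 1..n. (f l x)\<^sup>2) in
        \<exists>g :: nat \<Rightarrow> real \<Rightarrow> real.
          (\<forall>n\<ge>1. g n \<in> spline_space k (\<F> n) \<and> (\<forall>x\<in>{0..1}. 0 \<le> g n x)) \<and>
          (\<forall>n\<ge>1.
             (\<forall>x\<in>{0..1}. g n x \<le> g (Suc n) x) \<and>
             (\<forall>x\<in>{0..1}. sqrt (X n x) \<le> g n x) \<and>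
             expect (g n)
               \<le> C k (SUP m\<in>{1..n}. regularity k (\<F> m)) * expect (\<lambda>x. sqrt (X n x))))"
proof -
  have "\<forall>k \<Gamma>. \<exists>C. 1 \<le> k \<longrightarrow> (\<forall>\<F> f n. spline_sequence k \<F> f \<longrightarrow> 1 \<le> n \<longrightarrow>
      (\<forall>l\<in>{1..n}. regularity k (\<F> l) \<le> \<Gamma>) \<longrightarrow>
      expect (majorant k \<F> f n) \<le> C * expect (square_function f n))"
    using expect_majorant_le by blast
  then obtain C :: "nat \<Rightarrow> real \<Rightarrow> real" where C: "\<And>k \<Gamma> \<F> f n. 1 \<le> k \<Longrightarrow> spline_sequence k \<F> f \<Longrightarrow> 1 \<le> n \<Longrightarrow>
      (\<forall>l\<in>{1..n}. regularity k (\<F> l) \<le> \<Gamma>) \<Longrightarrow>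
      expect (majorant k \<F> f n) \<le> C k \<Gamma> * expect (square_function f n)"
    by metis
  show ?thesis
    unfolding Let_def
  proof (rule exI[of _ C], intro allI impI)
    fix k :: nat and \<F> :: "nat \<Rightarrow> real set set" and f :: "nat \<Rightarrow> real \<Rightarrow> real"
    assume k: "1 \<le> k" and F: "interval_filtration \<F>" and f: "\<forall>n\<ge>1. f n \<in> spline_space k (\<F> n)"
    have seq: "spline_sequence k \<F> f"
      using k F f by unfold_locales auto
    interpret spline_sequence k \<F> f
      by (rule seq)
    have u_eq: "u = (\<lambda>n x. sqrt (\<Sum>l = 1..n. (f l x)\<^sup>2))"
      by (intro ext) (rule square_function_def)
    have expect_le: "expect (g n) \<le> C k (SUP m\<in>{1..n}. regularity k (\<F> m)) * expect (u n)" if n: "1 \<le> n" for n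
    proof (rule C[OF k seq n], intro ballI)
      fix l assume "l \<in> {1..n}"
      then show "regularity k (\<F> l) \<le> (SUP m\<in>{1..n}. regularity k (\<F> m))"
        by (intro cSUP_upper) auto
    qed
    show "\<exists>g :: nat \<Rightarrow> real \<Rightarrow> real.
          (\<forall>n\<ge>1. g n \<in> spline_space k (\<F> n) \<and> (\<forall>x\<in>{0..1}. 0 \<le> g n x)) \<and>
          (\<forall>n\<ge>1.
             (\<forall>x\<in>{0..1}. g n x \<le> g (Suc n) x) \<and>
             (\<forall>x\<in>{0..1}. sqrt (\<Sum>l = 1..n. (f l x)\<^sup>2) \<le> g n x) \<and>
             expect (g n)
               \<le> C k (SUP m\<in>{1..n}. regularity k (\<F> m)) * expect (\<lambda>x. sqrt (\<Sum>l = 1..n. (f l x)\<^sup>2)))"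
    proof (rule exI[of _ g], intro conjI allI impI ballI)
      fix n :: nat assume n: "1 \<le> n"
      show "g n \<in> spline_space k (\<F> n)"
        by (rule g_spline[OF n])
      show "expect (g n)
          \<le> C k (SUP m\<in>{1..n}. regularity k (\<F> m)) * expect (\<lambda>x. sqrt (\<Sum>l = 1..n. (f l x)\<^sup>2))"
        using expect_le[OF n] unfolding u_eq .
      fix x :: real assume x: "x \<in> {0..1}"
      show "0 \<le> g n x" "g n x \<le> g (Suc n) x"
        by (rule g_nonneg[OF x], rule g_step[OF x])
      show "sqrt (\<Sum>l = 1..n. (f l x)\<^sup>2) \<le> g n x"
        using u_le_g[OF n x] unfolding u_eq .
    qed
  qed
qed

end
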